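(* Let $p$ be a prime and $G$ a finite group. Suppose that $\chi \in \mathrm{Irr}(G)$ is faithful, non-linear, and such that $\chi(x)$ is a root of unity for every $p$-singular element $x\in G$. Assume that $P=\mathbf{O}_p(G)>1$. Then either (1) $P$ is a Sylow $p$-subgroup of $G$, $P$ is elementary abelian, $\mathbf{C}_G(P)=P\times \mathbf{Z}(G)$, $G/\mathbf{C}_G(P)$ acts (by conjugation) transitively on $\mathrm{Irr}(P)-\{1_P\}$, and $\chi(1)=|P|-1$; or (2) $p=2$ and $G\cong S_4\times \mathbf{Z}(G)$, where $|\mathbf{Z}(G)|$ is odd.
   Context: $\mathrm{Irr}(G)$ denotes the set of irreducible complex characters of $G$; $1_P$ is the trivial character of $P$. An element is $p$-singular if its order is divisible by $p$. $\mathbf{O}_p(G)$ is the largest normal $p$-subgroup of $G$, $\mathbf{C}_G(P)$ the centralizer of $P$ in $G$, $\mathbf{Z}(G)$ the center of $G$, and $S_4$ the symmetric group on 4 letters. A character is faithful if its kernel is trivial, and non-linear if $\chi(1)>1$. *)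

theory Defs
  imports "HOL-Algebra.Algebra" "HOL-Algebra.Sym_Groups" "Jordan_Normal_Form.Matrix"
begin

definition is_rep :: "('g, 'b) monoid_scheme \<Rightarrow> nat \<Rightarrow> ('g \<Rightarrow> complex mat) \<Rightarrow> bool" where
  "is_rep G n \<rho> \<longleftrightarrow>
     (\<forall>g \<in> carrier G. \<rho> g \<in> carrier_mat n n) \<and>
     \<rho> \<one>\<^bsub>G\<^esub> = 1\<^sub>m n \<and>
     (\<forall>g \<in> carrier G. \<forall>h \<in> carrier G. \<rho> (g \<otimes>\<^bsub>G\<^esub> h) = \<rho> g * \<rho> h)"

definition invariant_subspace :: "('g, 'b) monoid_scheme \<Rightarrow> nat \<Rightarrow> ('g \<Rightarrow> complex mat) \<Rightarrow> complex vec set \<Rightarrow> bool" where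
  "invariant_subspace G n \<rho> W \<longleftrightarrow>
     W \<subseteq> carrier_vec n \<and> 0\<^sub>v n \<in> W \<and>
     (\<forall>v \<in> W. \<forall>w \<in> W. v + w \<in> W) \<and>
     (\<forall>c. \<forall>v \<in> W. c \<cdot>\<^sub>v v \<in> W) \<and>
     (\<forall>g \<in> carrier G. \<forall>v \<in> W. \<rho> g *\<^sub>v v \<in> W)"

definition irreducible_rep :: "('g, 'b) monoid_scheme \<Rightarrow> nat \<Rightarrow> ('g \<Rightarrow> complex mat) \<Rightarrow> bool" where
  "irreducible_rep G n \<rho> \<longleftrightarrow> is_rep G n \<rho> \<and> n > 0 \<and>
     (\<forall>W. invariant_subspace G n \<rho> W \<longrightarrow> W = {0\<^sub>v n} \<or> W = carrier_vec n)"

definition mat_trace :: "complex mat \<Rightarrow> complex" where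
  "mat_trace A = (\<Sum>i < dim_row A. A $$ (i, i))"

(* chi is an irreducible complex character of G (values outside carrier G irrelevant) *)
definition irr_char :: "('g, 'b) monoid_scheme \<Rightarrow> ('g \<Rightarrow> complex) \<Rightarrow> bool" where
  "irr_char G \<chi> \<longleftrightarrow> (\<exists>n \<rho>. irreducible_rep G n \<rho> \<and> (\<forall>g \<in> carrier G. \<chi> g = mat_trace (\<rho> g)))"

definition char_kernel :: "('g, 'b) monoid_scheme \<Rightarrow> ('g \<Rightarrow> complex) \<Rightarrow> 'g set" where
  "char_kernel G \<chi> = {g \<in> carrier G. \<chi> g = \<chi> \<one>\<^bsub>G\<^esub>}"

definition faithful_char :: "('g, 'b) monoid_scheme \<Rightarrow> ('g \<Rightarrow> complex) \<Rightarrow> bool" where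
  "faithful_char G \<chi> \<longleftrightarrow> char_kernel G \<chi> = {\<one>\<^bsub>G\<^esub>}"

definition root_of_unity :: "complex \<Rightarrow> bool" where
  "root_of_unity z \<longleftrightarrow> (\<exists>n::nat. n > 0 \<and> z ^ n = 1)"

definition p_singular :: "('g, 'b) monoid_scheme \<Rightarrow> nat \<Rightarrow> 'g \<Rightarrow> bool" where
  "p_singular G p x \<longleftrightarrow> p dvd group.ord G x"

definition p_subgroup :: "('g, 'b) monoid_scheme \<Rightarrow> nat \<Rightarrow> 'g set \<Rightarrow> bool" where
  "p_subgroup G p H \<longleftrightarrow> subgroup H G \<and> (\<exists>k. card H = p ^ k)"

(* O_p(G): the subgroup generated by all normal p-subgroups, i.e. the largest normal p-subgroup *)
definition O_p :: "('g, 'b) monoid_scheme \<Rightarrow> nat \<Rightarrow> 'g set" where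
  "O_p G p = generate G (\<Union>{H. p_subgroup G p H \<and> H \<lhd> G})"

definition sylow_subgroup :: "('g, 'b) monoid_scheme \<Rightarrow> nat \<Rightarrow> 'g set \<Rightarrow> bool" where
  "sylow_subgroup G p P \<longleftrightarrow> subgroup P G \<and> card P = p ^ multiplicity p (order G)"

definition elementary_abelian :: "('g, 'b) monoid_scheme \<Rightarrow> nat \<Rightarrow> 'g set \<Rightarrow> bool" where
  "elementary_abelian G p P \<longleftrightarrow> subgroup P G \<and>
     (\<forall>x \<in> P. \<forall>y \<in> P. x \<otimes>\<^bsub>G\<^esub> y = y \<otimes>\<^bsub>G\<^esub> x) \<and>
     (\<forall>x \<in> P. x [^]\<^bsub>G\<^esub> p = \<one>\<^bsub>G\<^esub>)"

definition centralizer :: "('g, 'b) monoid_scheme \<Rightarrow> 'g set \<Rightarrow> 'g set" where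
  "centralizer G P = {g \<in> carrier G. \<forall>x \<in> P. g \<otimes>\<^bsub>G\<^esub> x = x \<otimes>\<^bsub>G\<^esub> g}"

definition group_center :: "('g, 'b) monoid_scheme \<Rightarrow> 'g set" where
  "group_center G = centralizer G (carrier G)"

definition internal_direct_product :: "('g, 'b) monoid_scheme \<Rightarrow> 'g set \<Rightarrow> 'g set \<Rightarrow> 'g set \<Rightarrow> bool" where
  "internal_direct_product G C A B \<longleftrightarrow> subgroup A G \<and> subgroup B G \<and>
     A <#>\<^bsub>G\<^esub> B = C \<and> A \<inter> B = {\<one>\<^bsub>G\<^esub>} \<and>
     (\<forall>a \<in> A. \<forall>b \<in> B. a \<otimes>\<^bsub>G\<^esub> b = b \<otimes>\<^bsub>G\<^esub> a)"

definition conj_char :: "('g, 'b) monoid_scheme \<Rightarrow> 'g \<Rightarrow> ('g \<Rightarrow> complex) \<Rightarrow> ('g \<Rightarrow> complex)" where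
  "conj_char G g \<theta> = (\<lambda>x. \<theta> (g \<otimes>\<^bsub>G\<^esub> x \<otimes>\<^bsub>G\<^esub> inv\<^bsub>G\<^esub> g))"

(* G (equivalently G/C_G(P)) acts transitively by conjugation on Irr(P) - {1_P};
   characters of P are compared as functions on P *)
definition transitive_on_nontriv_irr :: "('g, 'b) monoid_scheme \<Rightarrow> 'g set \<Rightarrow> bool" where
  "transitive_on_nontriv_irr G P \<longleftrightarrow>
     (\<forall>\<theta> \<theta>'. irr_char (G\<lparr>carrier := P\<rparr>) \<theta> \<and> (\<exists>x \<in> P. \<theta> x \<noteq> 1) \<and>
            irr_char (G\<lparr>carrier := P\<rparr>) \<theta>' \<and> (\<exists>x \<in> P. \<theta>' x \<noteq> 1) \<longrightarrow>
            (\<exists>g \<in> carrier G. \<forall>x \<in> P. conj_char G g \<theta> x = \<theta>' x))"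

end

theory Submission
  imports Defs "Jordan_Normal_Form.DL_Rank"
begin

text \<open>
  Let \<open>A\<close> be a nontrivial abelian normal \<open>p\<close>-subgroup, \<open>q = |A|\<close>. Diagonalise the representation
  on \<open>A\<close>. By irreducibility the weights of \<open>A\<close> form one orbit, \<open>t\<close> distinct weights of multiplicity
  \<open>e\<close>, and since \<open>|\<chi>| = 1\<close> on \<open>A - {1}\<close> the norm of \<open>\<chi>\<^sub>A\<close> gives \<open>e\<^sup>2 t (q - t) = q - 1\<close>. Hence
  \<open>e = 1\<close> and \<open>t = q - 1 = \<chi>(1)\<close>: the representation is monomial, all nontrivial characters of \<open>A\<close>
  are conjugate, and \<open>C\<^sub>G(A)\<close> is diagonal, so abelian. For \<open>A = \<Omega>\<^sub>1(Z(P))\<close> this makes \<open>P\<close> abelian, and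
  comparing \<open>|A| = \<chi>(1) + 1 = |P|\<close> makes it elementary.

  Parseval on the cosets \<open>xP\<close> does the rest. If \<open>x \<in> C\<^sub>G(P)\<close> is a \<open>p'\<close>-element, \<open>|\<chi>(x)| = \<chi>(1)\<close>, so
  \<open>x\<close> is central. If \<open>x\<close> is a \<open>p\<close>-element outside \<open>P\<close>, it fixes exactly one nontrivial character of
  \<open>P\<close>; the fixed characters form a group, so \<open>p = 2\<close>, and then \<open>|P| = 4\<close>. In that case \<open>G/C\<^sub>G(P)\<close> is
  \<open>S\<^sub>3\<close>, and it lifts to a complement of \<open>P\<close> that splits off the odd central subgroup.
\<close>

section \<open>Simultaneous diagonalisation\<close>

text \<open>The norm equation is rigid because t(q - t) - (q - 1) = (t - 1)(q - t - 1) is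
  nonnegative for 1 \<le> t < q. This forces e = 1, then t = 1 or t = q - 1, and t = 1 would make
  \<chi> linear. So all nontrivial abelian normal p-subgroups have the same order \<chi>(1) + 1,
  which identifies Omega_1(Z(P)) with P and later makes P a minimal normal subgroup.

  With distinct weights, \<chi>(xa) as a function of a is a combination of characters of A whose
  coefficients are the diagonal entries of x, each zero or of modulus one. Parseval on xA therefore
  counts the weights fixed by x: all of them if x centralises A, exactly one if \<chi> is unimodular
  on xA.

  The last obstacle is lifting S_3 to G: a preimage h of a 3-cycle has a cube known only modulo P
  and Z(G). Replacing h by its commutator with an involution t gives an element k inverted by t. The
  P-part of its cube is fixed by a 3-cycle, hence trivial, and the central part equals its own
  inverse, hence is trivial because |Z(G)| is odd.\<close>

lemma sum_powers_inverse_root_of_unity: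
  fixes m k :: nat
  assumes "k < m"
  defines "w \<equiv> cis (2 * pi / real m)"
  shows "(\<Sum>j<m. inverse (w ^ j) ^ k) = (if k = 0 then of_nat m else 0)"
proof (cases "k = 0")
  case False
  have wj: "w ^ j = cis (2 * pi * real j / real m)" for j
    by (simp add: w_def DeMoivre mult_ac)
  have ne: "w ^ k \<noteq> 1"
  proof
    assume "w ^ k = 1"
    then have "cis (2 * pi * real k / real m) = cis (2 * pi * real 0 / real m)"
      by (simp add: wj)
    then show False
      using bij_betw_roots_unity[of m] assms(1) False unfolding bij_betw_def inj_on_def
      by (metis lessThan_iff less_nat_zero_code not_gr_zero)
  qed
  define z where "z = inverse (w ^ k)"
  have z1: "z \<noteq> 1" using ne unfolding z_def by (metis inverse_inverse_eq inverse_1)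
  have "z ^ m = inverse ((w ^ m) ^ k)"
    by (simp add: z_def power_inverse power_mult[symmetric] mult.commute)
  also have "w ^ m = 1" using assms(1) by (simp add: wj)
  finally have zm: "z ^ m = 1" by simp
  have "(\<Sum>j<m. inverse (w ^ j) ^ k) = (\<Sum>j<m. z ^ j)"
    by (simp add: z_def power_inverse power_mult[symmetric] mult.commute)
  also have "\<dots> = 0" using geometric_sum[OF z1, of m] zm by simp
  finally show ?thesis using False by simp
qed simp

text \<open>Discrete Fourier transform along w, Mw, ..., M^(m-1)w: \<open>u j\<close> is the
  projection of w to the eigenspace of M for the j-th power of a primitive m-th root of unity. Being
  a polynomial in M, the projection preserves eigenvectors of every N commuting with M; this last
  clause drives the induction over a commuting family.\<close>

lemma eigenvector_components:
  fixes M :: "complex mat"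
  assumes M: "M \<in> carrier_mat n n" and m: "m > 0" and Mm: "M ^\<^sub>m m = 1\<^sub>m n"
    and w: "w \<in> carrier_vec n"
  obtains u where "\<And>j. u j \<in> carrier_vec n"
    and "w = vec n (\<lambda>i. \<Sum>j<m. u j $ i)"
    and "\<And>j. j < m \<Longrightarrow> \<exists>c. M *\<^sub>v u j = c \<cdot>\<^sub>v u j"
    and "\<And>N c j. N \<in> carrier_mat n n \<Longrightarrow> N * M = M * N \<Longrightarrow> N *\<^sub>v w = c \<cdot>\<^sub>v w \<Longrightarrow> N *\<^sub>v u j = c \<cdot>\<^sub>v u j"
proof -
  define z where "z = cis (2 * pi / real m)"
  define f where "f j k = inverse (z ^ j) ^ k" for j k :: nat
  define x where "x k = (M ^\<^sub>m k) *\<^sub>v w" for k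
  define u where "u j = vec n (\<lambda>i. (\<Sum>k<m. f j k * x k $ i) / of_nat m)" for j
  have zm: "z ^ m = 1" using m by (simp add: z_def DeMoivre)
  have z0: "z \<noteq> 0" by (simp add: z_def)
  have Mk: "M ^\<^sub>m k \<in> carrier_mat n n" for k using M by simp
  have xc: "x k \<in> carrier_vec n" for k unfolding x_def using Mk w by (rule mult_mat_vec_carrier)
  have xS: "M *\<^sub>v x k = x (Suc k)" for k
  proof -
    have "M * M ^\<^sub>m k = M ^\<^sub>m k * M"
    proof (induction k)
      case (Suc k)
      have "M * M ^\<^sub>m Suc k = (M * M ^\<^sub>m k) * M"
        using assoc_mult_mat[OF M Mk M] by simp
      then show ?case using Suc by simp
    qed (use M in simp)
    then show ?thesis using M Mk w by (simp add: x_def assoc_mult_mat_vec[symmetric, of M n n _ n])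
  qed
  have x0: "x 0 = w" using M w by (simp add: x_def)
  have xm: "x m = w" using Mm w by (simp add: x_def)
  have uc: "u j \<in> carrier_vec n" for j by (simp add: u_def)
  have mv: "N *\<^sub>v u j = vec n (\<lambda>i. (\<Sum>k<m. f j k * (N *\<^sub>v x k) $ i) / of_nat m)"
    if N: "N \<in> carrier_mat n n" for N j
  proof (rule eq_vecI)
    fix i assume "i < dim_vec (vec n (\<lambda>i. (\<Sum>k<m. f j k * (N *\<^sub>v x k) $ i) / of_nat m))"
    then have i: "i < n" by simp
    have "(N *\<^sub>v u j) $ i = (\<Sum>l\<in>{0..<n}. N $$ (i,l) * ((\<Sum>k<m. f j k * x k $ l) / of_nat m))"
      using N i by (simp add: scalar_prod_def u_def)
    also have "\<dots> = (\<Sum>l\<in>{0..<n}. \<Sum>k<m. f j k * (N $$ (i,l) * x k $ l) / of_nat m)"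
      by (intro sum.cong refl) (simp add: sum_divide_distrib sum_distrib_left mult_ac)
    also have "\<dots> = (\<Sum>k<m. f j k * (\<Sum>l\<in>{0..<n}. N $$ (i,l) * x k $ l) / of_nat m)"
      by (subst sum.swap) (simp add: sum_distrib_left sum_divide_distrib)
    also have "\<dots> = (\<Sum>k<m. f j k * (N *\<^sub>v x k) $ i) / of_nat m"
    proof -
      have "(N *\<^sub>v x k) $ i = (\<Sum>l\<in>{0..<n}. N $$ (i,l) * x k $ l)" for k
        using N i xc[of k] by (simp add: scalar_prod_def)
      then show ?thesis by (simp add: sum_divide_distrib)
    qed
    finally show "(N *\<^sub>v u j) $ i = vec n (\<lambda>i. (\<Sum>k<m. f j k * (N *\<^sub>v x k) $ i) / of_nat m) $ i"
      using i by simp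
  qed (use N in simp)
  show ?thesis
  proof (rule that[of u])
    show "w = vec n (\<lambda>i. \<Sum>j<m. u j $ i)"
    proof (rule eq_vecI)
      fix i assume "i < dim_vec (vec n (\<lambda>i. \<Sum>j<m. u j $ i))"
      then have i: "i < n" by simp
      have "(\<Sum>j<m. u j $ i) = (\<Sum>j<m. \<Sum>k<m. f j k * x k $ i / of_nat m)"
        using i by (simp add: u_def sum_divide_distrib)
      also have "\<dots> = (\<Sum>k<m. (\<Sum>j<m. f j k) * (x k $ i / of_nat m))"
        by (subst sum.swap) (simp add: sum_distrib_right sum_divide_distrib)
      also have "\<dots> = (\<Sum>k<m. if k = 0 then w $ i else 0)"
        using m by (intro sum.cong refl)
          (simp add: f_def z_def sum_powers_inverse_root_of_unity x0)
      also have "\<dots> = w $ i" using m by simp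
      finally show "w $ i = vec n (\<lambda>i. \<Sum>j<m. u j $ i) $ i" using i by simp
    qed (use w in simp)
    show "\<exists>c. M *\<^sub>v u j = c \<cdot>\<^sub>v u j" if "j < m" for j
    proof (intro exI[of _ "z ^ j"] eq_vecI)
      fix i assume "i < dim_vec (z ^ j \<cdot>\<^sub>v u j)"
      then have i: "i < n" by (simp add: u_def)
      \<comment> \<open>Applying M shifts k to k + 1 at the cost of a factor \<open>z ^ j\<close>.
        The shifted sum is the old one because the term at k = m equals the term at k = 0.\<close>
      define g where "g k = f j k * x k $ i" for k
      have "f j m = inverse ((z ^ m) ^ j)"
        by (simp only: f_def power_inverse power_mult[symmetric] mult.commute)
      then have "f j m = 1" by (simp only: zm power_one inverse_1)
      moreover have "f j 0 = 1" by (simp add: f_def)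
      ultimately have gm: "g m = g 0" by (simp add: g_def x0 xm)
      have "z ^ j * f j (Suc k) = f j k" for k using z0 by (simp add: f_def)
      then have "(\<Sum>k<m. f j k * x (Suc k) $ i) = z ^ j * (\<Sum>k<m. g (Suc k))"
        by (simp add: g_def sum_distrib_left mult.assoc[symmetric])
      also have "(\<Sum>k<m. g (Suc k)) = (\<Sum>k<m. g k)"
        using sum.lessThan_Suc_shift[of g m] gm by simp
      finally show "(M *\<^sub>v u j) $ i = (z ^ j \<cdot>\<^sub>v u j) $ i"
        using i by (simp add: mv[OF M] xS g_def) (simp add: u_def)
    qed (use M in \<open>simp add: u_def\<close>)
    show "N *\<^sub>v u j = c \<cdot>\<^sub>v u j"
      if N: "N \<in> carrier_mat n n" and NM: "N * M = M * N" and Nw: "N *\<^sub>v w = c \<cdot>\<^sub>v w" for N c j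
    proof -
      have Nx: "N *\<^sub>v x k = c \<cdot>\<^sub>v x k" for k
      proof (induction k)
        case (Suc k)
        have "N *\<^sub>v x (Suc k) = (N * M) *\<^sub>v x k" using N M xc by (simp add: xS[symmetric])
        also have "\<dots> = M *\<^sub>v (N *\<^sub>v x k)" using N M xc by (simp add: NM)
        also have "\<dots> = c \<cdot>\<^sub>v (M *\<^sub>v x k)" using Suc mult_mat_vec[OF M xc] by simp
        finally show ?case by (simp add: xS)
      qed (simp add: x0 Nw)
      show ?thesis
      proof (rule eq_vecI)
        fix i assume "i < dim_vec (c \<cdot>\<^sub>v u j)"
        then have i: "i < n" by (simp add: u_def)
        have "dim_vec (x k) = n" for k using xc[of k] by simp
        then show "(N *\<^sub>v u j) $ i = (c \<cdot>\<^sub>v u j) $ i"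
          using i by (simp add: mv[OF N] Nx) (simp add: u_def sum_distrib_left mult_ac)
      qed (use N in \<open>simp add: u_def\<close>)
    qed
  qed (rule uc)
qed

section \<open>Bases extracted from spanning sets\<close>

context vec_space
begin

lemma vec_sum_in_span:
  assumes W: "W \<subseteq> carrier_vec n" and u: "\<And>j. j < (m::nat) \<Longrightarrow> u j \<in> span W"
  shows "vec n (\<lambda>i. \<Sum>j<m. u j $ i) \<in> span W"
  using u
proof (induction m)
  case 0
  have "0\<^sub>v n \<in> span W" using in_spanI[of "0\<^sub>v n" _ "{}" W] by simp
  then show ?case by (simp add: zero_vec_def)
next
  case (Suc m)
  have c: "u m \<in> carrier_vec n" using Suc.prems[of m] W by (meson lessI span_closed)
  have "vec n (\<lambda>i. \<Sum>j<m. u j $ i) + u m \<in> span W"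
    using Suc W by (intro span_add1) auto
  also have "vec n (\<lambda>i. \<Sum>j<m. u j $ i) + u m = vec n (\<lambda>i. \<Sum>j<Suc m. u j $ i)"
    using c by (intro eq_vecI) auto
  finally show ?case .
qed

text \<open>A maximal independent subset of \<open>E\<close> is a basis. The point is that the
  columns are members of \<open>E\<close> itself: being a common eigenvector is not preserved by
  sums, so the basis has to be selected from the spanning set.\<close>

lemma invertible_mat_of_spanning_set:
  assumes E: "E \<subseteq> carrier_vec n" and sp: "carrier_vec n \<subseteq> span E"
  obtains Q where "Q \<in> carrier_mat n n" and "set (cols Q) \<subseteq> E" and "det Q \<noteq> 0"
proof -
  have empty: "lin_indpt {}" unfolding lin_dep_def by auto
  have bound: "finite S \<and> card S \<le> dim" if "S \<subseteq> E \<and> lin_indpt S" for S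
    using li_le_dim[OF fin_dim, of S] that E by auto
  obtain B where B: "finite B" "maximal B (\<lambda>S. S \<subseteq> E \<and> lin_indpt S)"
    using maximal_exists[of "\<lambda>S. S \<subseteq> E \<and> lin_indpt S" dim "{}"] bound empty by blast
  have BE: "B \<subseteq> E" and li: "lin_indpt B" using B(2) unfolding maximal_def by auto
  have Bc: "B \<subseteq> carrier V" using BE E by auto
  have "E \<subseteq> span B"
  proof
    fix v assume v: "v \<in> E"
    show "v \<in> span B"
    proof (cases "v \<in> B")
      case True then show ?thesis using Bc in_own_span by auto
    next
      case False
      then have "lin_dep (insert v B)" using B(2) v BE unfolding maximal_def
        by (metis insertI1 insert_subset subset_insertI)
      then have "lin_dep (B \<union> {v})" by (metis Un_insert_right sup_bot_right)
      then show ?thesis using lin_dep_iff_in_span[of B v] v E Bc li False by auto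
    qed
  qed
  then have "carrier V \<subseteq> span B" using span_subsetI[of B E] Bc sp by auto
  then have basis: "basis B" unfolding basis_def using li Bc span_closed[of B] by auto
  then have card: "card B = n" using dim_basis[OF B(1)] dim_is_n by simp
  obtain bs where bs: "set bs = B" "distinct bs" using B(1) finite_distinct_list by blast
  then have len: "length bs = n" using card distinct_card by fastforce
  define Q where "Q = mat_of_cols n bs"
  have cols: "cols Q = bs" unfolding Q_def using bs Bc by simp
  have Qc: "Q \<in> carrier_mat n n" unfolding Q_def using len by auto
  have "rank Q = n" using lin_indpt_full_rank[OF Qc] cols bs li by simp
  then have "det Q \<noteq> 0" using det_rank_iff[OF Qc] by simp
  then show ?thesis using that Qc cols bs BE by blast
qed

end

text \<open>Induction over the family, with the invariant that the common eigenvectors of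
  \<open>F\<close> span the space. Adding a, each common eigenvector of \<open>F\<close> splits into
  eigenvectors of \<open>R a\<close>, and by commutation the pieces remain eigenvectors for
  \<open>F\<close>. A basis is chosen only once, at the end.\<close>

lemma simultaneous_diagonalization:
  fixes R :: "'a \<Rightarrow> complex mat"
  assumes "finite A" and R: "\<And>a. a \<in> A \<Longrightarrow> R a \<in> carrier_mat n n"
    and comm: "\<And>a b. a \<in> A \<Longrightarrow> b \<in> A \<Longrightarrow> R a * R b = R b * R a"
    and finord: "\<And>a. a \<in> A \<Longrightarrow> \<exists>m>0. R a ^\<^sub>m m = 1\<^sub>m n"
  obtains P Q l where "P \<in> carrier_mat n n" "Q \<in> carrier_mat n n" "P * Q = 1\<^sub>m n" "Q * P = 1\<^sub>m n"
    "\<And>a i j. a \<in> A \<Longrightarrow> i < n \<Longrightarrow> j < n \<Longrightarrow> (P * R a * Q) $$ (i,j) = (if i = j then l i a else 0)"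
proof -
  interpret vec_space "TYPE(complex)" n .
  define E where "E F = {w \<in> carrier_vec n. \<forall>a\<in>F. \<exists>c. R a *\<^sub>v w = c \<cdot>\<^sub>v w}" for F
  have Ec: "E F \<subseteq> carrier_vec n" for F by (auto simp: E_def)
  have "carrier_vec n \<subseteq> span (E F)" if "finite F" "F \<subseteq> A" for F
    using that
  proof (induction F)
    case empty
    have "E {} = carrier_vec n" by (auto simp: E_def)
    then show ?case using in_own_span[of "carrier_vec n"] by simp
  next
    case (insert a F)
    then have a: "a \<in> A" and F: "F \<subseteq> A" by auto
    have "E F \<subseteq> span (E (insert a F))"
    proof
      fix w assume w: "w \<in> E F"
      then have wc: "w \<in> carrier_vec n" using Ec by auto
      obtain m where m: "m > 0" "R a ^\<^sub>m m = 1\<^sub>m n" using finord[OF a] by auto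
      obtain u where u: "\<And>j. u j \<in> carrier_vec n" "w = vec n (\<lambda>i. \<Sum>j<m. u j $ i)"
        "\<And>j. j < m \<Longrightarrow> \<exists>c. R a *\<^sub>v u j = c \<cdot>\<^sub>v u j"
        "\<And>N c j. N \<in> carrier_mat n n \<Longrightarrow> N * R a = R a * N \<Longrightarrow> N *\<^sub>v w = c \<cdot>\<^sub>v w \<Longrightarrow> N *\<^sub>v u j = c \<cdot>\<^sub>v u j"
        using eigenvector_components[OF R[OF a] m wc] by blast
      have "u j \<in> E (insert a F)" if "j < m" for j
      proof -
        have "\<exists>c. R b *\<^sub>v u j = c \<cdot>\<^sub>v u j" if b: "b \<in> F" for b
        proof -
          obtain c where "R b *\<^sub>v w = c \<cdot>\<^sub>v w" using w b by (auto simp: E_def)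
          then show ?thesis using u(4)[OF R comm] F a b by blast
        qed
        then show ?thesis using u(1,3) that by (auto simp: E_def)
      qed
      then have "\<And>j. j < m \<Longrightarrow> u j \<in> span (E (insert a F))"
        using in_own_span[of "E (insert a F)"] Ec by auto
      then show "w \<in> span (E (insert a F))"
        using vec_sum_in_span[OF Ec] u(2) by simp
    qed
    then have "span (E F) \<subseteq> span (E (insert a F))" using span_subsetI[OF Ec] by blast
    then show ?case using insert F by blast
  qed
  then have "carrier_vec n \<subseteq> span (E A)" using assms(1) by blast
  then obtain Q where Q: "Q \<in> carrier_mat n n" "set (cols Q) \<subseteq> E A" "det Q \<noteq> 0"
    using invertible_mat_of_spanning_set[OF Ec] by blast
  obtain P where P: "P \<in> carrier_mat n n" "P * Q = 1\<^sub>m n" "Q * P = 1\<^sub>m n"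
    using det_non_zero_imp_unit[OF Q(1,3)] unfolding Units_def ring_mat_def by auto
  have "\<forall>j a. \<exists>c. j < n \<longrightarrow> a \<in> A \<longrightarrow> R a *\<^sub>v col Q j = c \<cdot>\<^sub>v col Q j"
  proof (intro allI)
    fix j a
    have "col Q j \<in> E A" if "j < n" using Q(1,2) that cols_nth[of j Q]
      by (metis carrier_matD(2) cols_length nth_mem subsetD)
    then show "\<exists>c. j < n \<longrightarrow> a \<in> A \<longrightarrow> R a *\<^sub>v col Q j = c \<cdot>\<^sub>v col Q j"
      by (auto simp: E_def)
  qed
  then obtain l where l: "\<And>j a. j < n \<Longrightarrow> a \<in> A \<Longrightarrow> R a *\<^sub>v col Q j = l j a \<cdot>\<^sub>v col Q j" by metis
  have "(P * R a * Q) $$ (i,j) = (if i = j then l i a else 0)" if "a \<in> A" "i < n" "j < n" for a i j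
  proof -
    have "(P * R a * Q) $$ (i,j) = (P * (R a * Q)) $$ (i,j)"
      using P Q R that by (simp add: assoc_mult_mat[of P n n _ n _ n])
    also have "\<dots> = row P i \<bullet> col (R a * Q) j" using P Q R[OF that(1)] that by simp
    also have "col (R a * Q) j = R a *\<^sub>v col Q j" using Q R[OF that(1)] that by (intro eq_vecI) auto
    also have "row P i \<bullet> (R a *\<^sub>v col Q j) = l j a * (row P i \<bullet> col Q j)"
      using l that P Q by simp
    also have "row P i \<bullet> col Q j = (P * Q) $$ (i,j)" using P(1) Q(1) that by simp
    also have "(P * Q) $$ (i,j) = (if i = j then 1 else 0)" unfolding P(2) using that by simp
    finally show ?thesis by simp
  qed
  then show ?thesis using that P Q by blast
qed

section \<open>Representations in a weight basis\<close>

text \<open>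
  \<open>r g i j\<close> are the entries of the representing matrix in a basis of common eigenvectors of \<open>A\<close>, and
  \<open>l i\<close> is the weight of the \<open>i\<close>-th basis vector. Irreducibility is only needed for coordinate subspaces.
\<close>

locale weighted_rep = group G for G (structure) +
  fixes A :: "'a set" and n :: nat and r :: "'a \<Rightarrow> nat \<Rightarrow> nat \<Rightarrow> complex"
    and l :: "nat \<Rightarrow> 'a \<Rightarrow> complex" and \<chi> :: "'a \<Rightarrow> complex"
  assumes finite_G: "finite (carrier G)"
    and normal_A: "A \<lhd> G"
    and r_mult: "\<lbrakk>g \<in> carrier G; h \<in> carrier G; i < n; j < n\<rbrakk> \<Longrightarrow> r (g \<otimes> h) i j = (\<Sum>k<n. r g i k * r h k j)"
    and r_one: "\<lbrakk>i < n; j < n\<rbrakk> \<Longrightarrow> r \<one> i j = (if i = j then 1 else 0)"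
    and \<chi>_eq: "g \<in> carrier G \<Longrightarrow> \<chi> g = (\<Sum>i<n. r g i i)"
    and r_A: "\<lbrakk>a \<in> A; i < n; j < n\<rbrakk> \<Longrightarrow> r a i j = (if i = j then l i a else 0)"
    and irreducible: "\<lbrakk>I \<subseteq> {..<n}; \<And>g i j. \<lbrakk>g \<in> carrier G; i < n; i \<notin> I; j \<in> I\<rbrakk> \<Longrightarrow> r g i j = 0\<rbrakk>
      \<Longrightarrow> I = {} \<or> I = {..<n}"

lemma mat_trace_mult_commute:
  assumes "M \<in> carrier_mat n n" "N \<in> carrier_mat n n"
  shows "mat_trace (M * N) = mat_trace (N * M)"
proof -
  have "mat_trace (M * N) = (\<Sum>i<n. \<Sum>j\<in>{0..<n}. M $$ (i,j) * N $$ (j,i))"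
    using assms by (simp add: mat_trace_def scalar_prod_def)
  also have "\<dots> = (\<Sum>j<n. \<Sum>i\<in>{0..<n}. N $$ (j,i) * M $$ (i,j))"
    unfolding atLeast0LessThan by (subst sum.swap) (simp add: mult.commute)
  also have "\<dots> = mat_trace (N * M)"
    using assms by (simp add: mat_trace_def scalar_prod_def)
  finally show ?thesis .
qed

lemma index_mult_mat_sum:
  assumes "M \<in> carrier_mat n n" "N \<in> carrier_mat n n" "i < n" "j < n"
  shows "(M * N) $$ (i,j) = (\<Sum>k<n. M $$ (i,k) * N $$ (k,j))"
  using assms by (simp add: scalar_prod_def atLeast0LessThan)

lemma index_mult_mat_vec_sum:
  assumes "M \<in> carrier_mat n n" "v \<in> carrier_vec n" "i < n"
  shows "(M *\<^sub>v v) $ i = (\<Sum>k<n. M $$ (i,k) * v $ k)"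
  using assms by (simp add: scalar_prod_def atLeast0LessThan)

text \<open>The matrices are conjugated into an eigenbasis of A; trace and multiplicativity survive.
  Irreducibility is specialised to subspaces spanned by basis vectors: an index set \<open>I\<close>
  from which no entry of any \<open>r g\<close> leads out spans an invariant subspace.\<close>

lemma weighted_rep_exists:
  fixes G :: "('a, 'b) monoid_scheme"
  assumes G: "group G" and fin: "finite (carrier G)" and A: "A \<lhd> G"
    and comm: "\<And>a b. a \<in> A \<Longrightarrow> b \<in> A \<Longrightarrow> a \<otimes>\<^bsub>G\<^esub> b = b \<otimes>\<^bsub>G\<^esub> a"
    and irr: "irr_char G \<chi>"
  obtains n r l where "weighted_rep G A n r l \<chi>" and "n > 0" and "\<chi> \<one>\<^bsub>G\<^esub> = of_nat n"
proof -
  interpret group G by (rule G)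
  obtain n \<rho> where rep: "irreducible_rep G n \<rho>" and chi: "\<And>g. g \<in> carrier G \<Longrightarrow> \<chi> g = mat_trace (\<rho> g)"
    using irr unfolding irr_char_def by blast
  have n0: "n > 0" and \<rho>c: "\<And>g. g \<in> carrier G \<Longrightarrow> \<rho> g \<in> carrier_mat n n"
    and \<rho>1: "\<rho> \<one>\<^bsub>G\<^esub> = 1\<^sub>m n"
    and \<rho>m: "\<And>g h. g \<in> carrier G \<Longrightarrow> h \<in> carrier G \<Longrightarrow> \<rho> (g \<otimes>\<^bsub>G\<^esub> h) = \<rho> g * \<rho> h"
    and inv: "\<And>W. invariant_subspace G n \<rho> W \<Longrightarrow> W = {0\<^sub>v n} \<or> W = carrier_vec n"
    using rep unfolding irreducible_rep_def is_rep_def by auto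
  have AG: "A \<subseteq> carrier G" using A by (meson normal_imp_subgroup subgroup.subset)
  have pow: "\<rho> a ^\<^sub>m m = \<rho> (a [^]\<^bsub>G\<^esub> m)" if "a \<in> carrier G" for a and m :: nat
    using that \<rho>1 \<rho>c[OF that] by (induction m) (simp_all add: \<rho>m)
  obtain P Q l where P: "P \<in> carrier_mat n n" and Q: "Q \<in> carrier_mat n n"
    and PQ: "P * Q = 1\<^sub>m n" and QP: "Q * P = 1\<^sub>m n"
    and diag: "\<And>a i j. a \<in> A \<Longrightarrow> i < n \<Longrightarrow> j < n \<Longrightarrow> (P * \<rho> a * Q) $$ (i,j) = (if i = j then l i a else 0)"
  proof (rule simultaneous_diagonalization[of A \<rho> n])
    show "finite A" using AG fin finite_subset by blast
    show "\<rho> a \<in> carrier_mat n n" if "a \<in> A" for a using that AG \<rho>c by blast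
    show "\<rho> a * \<rho> b = \<rho> b * \<rho> a" if "a \<in> A" "b \<in> A" for a b
      using that AG comm \<rho>m by (metis subsetD)
    show "\<exists>m>0. \<rho> a ^\<^sub>m m = 1\<^sub>m n" if "a \<in> A" for a
    proof -
      have "a \<in> carrier G" using that AG by blast
      then show ?thesis using pow[of a "Coset.order G"] \<rho>1 pow_order_eq_1[of a] fin order_gt_0_iff_finite
        by (intro exI[of _ "Coset.order G"]) simp
    qed
  qed blast
  define r where "r g i j = (P * \<rho> g * Q) $$ (i,j)" for g i j
  have rc: "P * \<rho> g * Q \<in> carrier_mat n n" if "g \<in> carrier G" for g
    using P Q \<rho>c[OF that] by simp
  have PPQ: "(P * \<rho> g * Q) * P = P * \<rho> g" if "g \<in> carrier G" for g
  proof -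
    have "(P * \<rho> g * Q) * P = (P * \<rho> g) * (Q * P)"
      using P Q \<rho>c[OF that] by (intro assoc_mult_mat) auto
    then show ?thesis using P QP \<rho>c[OF that] by simp
  qed
  have "weighted_rep G A n r l \<chi>"
  proof (intro weighted_rep.intro weighted_rep_axioms.intro G fin A)
    fix g h i j assume g: "g \<in> carrier G" and h: "h \<in> carrier G" and i: "i < n" and j: "j < n"
    have "(P * \<rho> g * Q) * (P * \<rho> h * Q) = ((P * \<rho> g * Q) * P) * (\<rho> h * Q)"
      using P Q \<rho>c[OF g] \<rho>c[OF h] by (simp add: assoc_mult_mat[of _ n n _ n _ n])
    also have "\<dots> = P * \<rho> g * (\<rho> h * Q)" by (simp only: PPQ[OF g])
    also have "\<dots> = P * \<rho> (g \<otimes>\<^bsub>G\<^esub> h) * Q"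
      using P Q \<rho>c[OF g] \<rho>c[OF h] g h by (simp add: assoc_mult_mat[of _ n n _ n _ n] \<rho>m)
    finally have "r (g \<otimes>\<^bsub>G\<^esub> h) i j = ((P * \<rho> g * Q) * (P * \<rho> h * Q)) $$ (i,j)" by (simp add: r_def)
    also have "\<dots> = (\<Sum>k<n. r g i k * r h k j)"
      unfolding r_def by (rule index_mult_mat_sum[OF rc[OF g] rc[OF h] i j])
    finally show "r (g \<otimes>\<^bsub>G\<^esub> h) i j = (\<Sum>k<n. r g i k * r h k j)" .
  next
    fix i j assume "i < n" "j < n"
    then show "r \<one>\<^bsub>G\<^esub> i j = (if i = j then 1 else 0)" using P PQ \<rho>1 by (simp add: r_def)
  next
    fix g assume g: "g \<in> carrier G"
    have "(\<Sum>i<n. r g i i) = mat_trace (P * \<rho> g * Q)" using P by (simp add: mat_trace_def r_def)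
    also have "\<dots> = mat_trace (Q * (P * \<rho> g))"
      using P Q \<rho>c[OF g] by (intro mat_trace_mult_commute[of _ n]) auto
    also have "Q * (P * \<rho> g) = \<rho> g"
      using P Q QP \<rho>c[OF g] by (simp add: assoc_mult_mat[of Q n n P n "\<rho> g" n, symmetric])
    finally show "\<chi> g = (\<Sum>i<n. r g i i)" using chi[OF g] by simp
  next
    fix a i j assume "a \<in> A" "i < n" "j < n"
    then show "r a i j = (if i = j then l i a else 0)" using diag by (simp add: r_def)
  next
    fix I assume I: "I \<subseteq> {..<n}"
      and zero: "\<And>g i j. g \<in> carrier G \<Longrightarrow> i < n \<Longrightarrow> i \<notin> I \<Longrightarrow> j \<in> I \<Longrightarrow> r g i j = 0"
    define W where "W = {v \<in> carrier_vec n. \<forall>i<n. i \<notin> I \<longrightarrow> (P *\<^sub>v v) $ i = 0}"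
    have "invariant_subspace G n \<rho> W"
      unfolding invariant_subspace_def
    proof (intro conjI ballI allI)
      show "W \<subseteq> carrier_vec n" by (auto simp: W_def)
      show "0\<^sub>v n \<in> W" using P by (auto simp: W_def)
      show "v + w \<in> W" if "v \<in> W" "w \<in> W" for v w
        using that P by (auto simp: W_def scalar_prod_add_distrib[of _ n])
      show "c \<cdot>\<^sub>v v \<in> W" if "v \<in> W" for c v
        using that P by (auto simp: W_def mult_mat_vec[OF P])
      show "\<rho> g *\<^sub>v v \<in> W" if g: "g \<in> carrier G" and v: "v \<in> W" for g v
      proof -
        have vc: "v \<in> carrier_vec n" using v by (simp add: W_def)
        have "P *\<^sub>v (\<rho> g *\<^sub>v v) = (P * \<rho> g) *\<^sub>v v" using P \<rho>c[OF g] vc by simp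
        also have "\<dots> = (P * \<rho> g * Q) *\<^sub>v (P *\<^sub>v v)"
          using assoc_mult_mat_vec[OF rc[OF g] P vc] PPQ[OF g] by simp
        finally have e: "P *\<^sub>v (\<rho> g *\<^sub>v v) = (P * \<rho> g * Q) *\<^sub>v (P *\<^sub>v v)" .
        have "(P *\<^sub>v (\<rho> g *\<^sub>v v)) $ i = 0" if i: "i < n" "i \<notin> I" for i
        proof -
          have "(P *\<^sub>v (\<rho> g *\<^sub>v v)) $ i = (\<Sum>j<n. r g i j * (P *\<^sub>v v) $ j)"
            unfolding e r_def using P vc i by (intro index_mult_mat_vec_sum rc[OF g]) auto
          also have "\<dots> = 0"
            using zero[OF g i] v by (intro sum.neutral) (auto simp: W_def)
          finally show ?thesis .
        qed
        then show ?thesis using \<rho>c[OF g] vc by (auto simp: W_def)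
      qed
    qed
    then have W: "W = {0\<^sub>v n} \<or> W = carrier_vec n" by (rule inv)
    \<comment> \<open>The i-th eigenvector, that is, the i-th column of \<open>Q\<close>. These
      vectors test \<open>W\<close>: if it is zero no index lies in \<open>I\<close>, and if it is
      everything all indices do.\<close>
    define v where "v i = Q *\<^sub>v unit_vec n i" for i
    have vc: "v i \<in> carrier_vec n" for i using Q by (simp add: v_def)
    have Pv: "P *\<^sub>v v i = unit_vec n i" for i
      using P Q PQ by (simp add: v_def assoc_mult_mat_vec[OF P Q, symmetric])
    show "I = {} \<or> I = {..<n}"
    proof (rule disjE[OF W])
      assume W0: "W = {0\<^sub>v n}"
      have False if "i \<in> I" for i
      proof -
        have i: "i < n" using that I by auto
        have "v i \<in> W" using vc that i by (auto simp: W_def Pv unit_vec_def)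
        then have "v i = 0\<^sub>v n" using W0 by blast
        then have "unit_vec n i = P *\<^sub>v 0\<^sub>v n" using Pv[of i] by simp
        also have "\<dots> = 0\<^sub>v n" using P by auto
        finally have "unit_vec n i $ i = (0::complex)" using i by simp
        then show False using i by simp
      qed
      then show ?thesis by blast
    next
      assume W1: "W = carrier_vec n"
      have "i \<in> I" if i: "i < n" for i
      proof (rule ccontr)
        assume "i \<notin> I"
        then have "(P *\<^sub>v v i) $ i = 0" using vc[of i] W1 i by (auto simp: W_def)
        then show False using i by (simp add: Pv)
      qed
      then show ?thesis using I by blast
    qed
  qed
  moreover have "\<chi> \<one>\<^bsub>G\<^esub> = of_nat n" using chi[of "\<one>\<^bsub>G\<^esub>"] \<rho>1 by (simp add: mat_trace_def)
  ultimately show ?thesis using that n0 by blast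
qed

section \<open>Linear characters of abelian subgroups\<close>

text \<open>A homomorphism from A to the nonzero complex numbers, kept as a function on the whole
  type. Values outside A are arbitrary, so equality of characters is always stated pointwise on A;
  the condition at the identity excludes the zero function.\<close>

definition linear_char :: "('a, 'b) monoid_scheme \<Rightarrow> 'a set \<Rightarrow> ('a \<Rightarrow> complex) \<Rightarrow> bool" where
  "linear_char G A \<theta> \<longleftrightarrow> \<theta> \<one>\<^bsub>G\<^esub> = 1 \<and> (\<forall>a\<in>A. \<forall>b\<in>A. \<theta> (a \<otimes>\<^bsub>G\<^esub> b) = \<theta> a * \<theta> b)"

context group
begin

lemma norm_linear_char:
  assumes A: "subgroup A G" "finite A" and \<theta>: "linear_char G A \<theta>" and a: "a \<in> A"
  shows "cmod (\<theta> a) = 1"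
proof -
  have pow: "a [^] k \<in> A \<and> \<theta> (a [^] k) = \<theta> a ^ k" for k :: nat
  proof (induction k)
    case 0
    then show ?case using \<theta> A(1) by (simp add: linear_char_def subgroup.one_closed)
  next
    case (Suc k)
    then show ?case using \<theta> A(1) a by (simp add: linear_char_def subgroup.m_closed)
  qed
  interpret H: group "G\<lparr>carrier := A\<rparr>" using A(1) subgroup_imp_group by blast
  have "a [^]\<^bsub>G\<lparr>carrier := A\<rparr>\<^esub> Coset.order (G\<lparr>carrier := A\<rparr>) = \<one>"
    using H.pow_order_eq_1[of a] a by simp
  then have "a [^] card A = \<one>" by (simp add: Coset.order_def nat_pow_consistent[symmetric])
  then have "\<theta> a ^ card A = 1" using pow[of "card A"] \<theta> by (simp add: linear_char_def)
  then have "cmod (\<theta> a) ^ card A = 1 ^ card A" by (simp flip: norm_power)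
  moreover have "card A > 0" using A(2) a card_gt_0_iff by blast
  ultimately show ?thesis using power_eq_imp_eq_base[of "cmod (\<theta> a)" "card A" 1] by simp
qed

text \<open>If the characters differ at b, translating the summation by b multiplies the sum by
  \<theta>(b) times the conjugate of \<eta>(b). This factor is not 1 because both values have
  modulus one, so the sum vanishes.\<close>

lemma sum_linear_char_mult_cnj:
  assumes A: "subgroup A G" "finite A" and \<theta>: "linear_char G A \<theta>" and \<eta>: "linear_char G A \<eta>"
  shows "(\<Sum>a\<in>A. \<theta> a * cnj (\<eta> a)) = (if \<forall>a\<in>A. \<theta> a = \<eta> a then of_nat (card A) else 0)"
proof (cases "\<forall>a\<in>A. \<theta> a = \<eta> a")
  case True
  have "\<theta> a * cnj (\<eta> a) = 1" if "a \<in> A" for a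
    using norm_linear_char[OF A \<eta> that] True that by (simp add: complex_norm_square[symmetric])
  then show ?thesis using True by simp
next
  case False
  then obtain b where b: "b \<in> A" "\<theta> b \<noteq> \<eta> b" by blast
  define S where "S = (\<Sum>a\<in>A. \<theta> a * cnj (\<eta> a))"
  have bij: "bij_betw (\<lambda>a. b \<otimes> a) A A"
  proof (rule bij_betw_byWitness[of _ "\<lambda>a. inv b \<otimes> a"])
    have AG: "A \<subseteq> carrier G" using A(1) by (rule subgroup.subset)
    then show "\<forall>a\<in>A. inv b \<otimes> (b \<otimes> a) = a" "\<forall>a\<in>A. b \<otimes> (inv b \<otimes> a) = a"
      using b(1) by (auto simp: subset_iff m_assoc[symmetric])
    show "(\<otimes>) b ` A \<subseteq> A" "(\<otimes>) (inv b) ` A \<subseteq> A"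
      using b(1) subgroup.m_closed[OF A(1)] subgroup.m_inv_closed[OF A(1)] by auto
  qed
  have "S = (\<Sum>a\<in>A. \<theta> (b \<otimes> a) * cnj (\<eta> (b \<otimes> a)))"
    unfolding S_def by (rule sum.reindex_bij_betw[OF bij, symmetric])
  also have "\<dots> = (\<Sum>a\<in>A. (\<theta> b * cnj (\<eta> b)) * (\<theta> a * cnj (\<eta> a)))"
  proof (intro sum.cong refl)
    fix a assume "a \<in> A"
    then have "\<theta> (b \<otimes> a) = \<theta> b * \<theta> a" "\<eta> (b \<otimes> a) = \<eta> b * \<eta> a"
      using \<theta> \<eta> b(1) by (simp_all add: linear_char_def)
    then show "\<theta> (b \<otimes> a) * cnj (\<eta> (b \<otimes> a)) = (\<theta> b * cnj (\<eta> b)) * (\<theta> a * cnj (\<eta> a))"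
      by (simp only: complex_cnj_mult mult_ac)
  qed
  also have "\<dots> = \<theta> b * cnj (\<eta> b) * S" by (simp add: S_def sum_distrib_left)
  finally have "S = \<theta> b * cnj (\<eta> b) * S" .
  moreover have "\<theta> b * cnj (\<eta> b) \<noteq> 1"
  proof
    assume 1: "\<theta> b * cnj (\<eta> b) = 1"
    have "\<eta> b * cnj (\<eta> b) = 1" using norm_linear_char[OF A \<eta> b(1)]
      by (simp add: complex_norm_square[symmetric])
    then have "\<theta> b = \<theta> b * cnj (\<eta> b) * \<eta> b" by (simp add: mult_ac)
    then show False using 1 b(2) by simp
  qed
  ultimately have "S = 0" by (metis mult_cancel_right1)
  then show ?thesis unfolding S_def[symmetric] using False by (simp only: if_False)
qed

text \<open>Parseval for a family of pairwise distinct characters: after expanding the square,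
  orthogonality removes the cross terms. It is applied with the diagonal entries of a group element
  as coefficients.\<close>

lemma sum_norm_square_linear_chars:
  assumes A: "subgroup A G" "finite A" and F: "finite F"
    and \<theta>: "\<And>i. i \<in> F \<Longrightarrow> linear_char G A (\<theta> i)"
    and distinct: "\<And>i j. \<lbrakk>i \<in> F; j \<in> F; \<forall>a\<in>A. \<theta> i a = \<theta> j a\<rbrakk> \<Longrightarrow> i = j"
  shows "(\<Sum>a\<in>A. (cmod (\<Sum>i\<in>F. c i * \<theta> i a))\<^sup>2) = real (card A) * (\<Sum>i\<in>F. (cmod (c i))\<^sup>2)"
proof -
  have "complex_of_real (\<Sum>a\<in>A. (cmod (\<Sum>i\<in>F. c i * \<theta> i a))\<^sup>2)
      = (\<Sum>a\<in>A. (\<Sum>i\<in>F. c i * \<theta> i a) * cnj (\<Sum>j\<in>F. c j * \<theta> j a))"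
    by (simp only: of_real_sum complex_norm_square)
  also have "\<dots> = (\<Sum>a\<in>A. \<Sum>i\<in>F. \<Sum>j\<in>F. c i * cnj (c j) * (\<theta> i a * cnj (\<theta> j a)))"
    by (intro sum.cong refl) (simp only: sum_product cnj_sum complex_cnj_mult mult_ac)
  also have "\<dots> = (\<Sum>i\<in>F. \<Sum>j\<in>F. \<Sum>a\<in>A. c i * cnj (c j) * (\<theta> i a * cnj (\<theta> j a)))"
    by (subst sum.swap, rule sum.cong[OF refl], subst sum.swap) simp
  also have "\<dots> = (\<Sum>i\<in>F. \<Sum>j\<in>F. c i * cnj (c j) * (if i = j then of_nat (card A) else 0))"
  proof (intro sum.cong refl)
    fix i j assume ij: "i \<in> F" "j \<in> F"
    have "(\<Sum>a\<in>A. \<theta> i a * cnj (\<theta> j a)) = (if i = j then of_nat (card A) else 0)"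
      using sum_linear_char_mult_cnj[OF A \<theta>[OF ij(1)] \<theta>[OF ij(2)]] distinct[OF ij] by auto
    then show "(\<Sum>a\<in>A. c i * cnj (c j) * (\<theta> i a * cnj (\<theta> j a)))
        = c i * cnj (c j) * (if i = j then of_nat (card A) else 0)"
      by (simp add: sum_distrib_left[symmetric])
  qed
  also have "\<dots> = (\<Sum>i\<in>F. of_nat (card A) * (c i * cnj (c i)))"
  proof (intro sum.cong refl)
    fix i assume i: "i \<in> F"
    have "(\<Sum>j\<in>F. c i * cnj (c j) * (if i = j then of_nat (card A) else 0))
        = (\<Sum>j\<in>F. if j = i then of_nat (card A) * (c i * cnj (c i)) else 0)"
      by (intro sum.cong refl) simp
    then show "(\<Sum>j\<in>F. c i * cnj (c j) * (if i = j then of_nat (card A) else 0))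
        = of_nat (card A) * (c i * cnj (c i))"
      using F i by simp
  qed
  also have "\<dots> = complex_of_real (real (card A) * (\<Sum>i\<in>F. (cmod (c i))\<^sup>2))"
    by (simp only: of_real_mult of_real_sum complex_norm_square of_real_of_nat_eq sum_distrib_left)
  finally show ?thesis by (simp only: of_real_eq_iff)
qed

text \<open>In Parseval with all coefficients 1, the single term at the identity already contributes
  |F|^2, and the total is |A| |F|. This upper bound on the dual is what later shows that the weights
  exhaust it.\<close>

lemma card_linear_chars_le:
  assumes A: "subgroup A G" "finite A" and F: "finite F"
    and \<theta>: "\<And>i. i \<in> F \<Longrightarrow> linear_char G A (\<theta> i)"
    and distinct: "\<And>i j. \<lbrakk>i \<in> F; j \<in> F; \<forall>a\<in>A. \<theta> i a = \<theta> j a\<rbrakk> \<Longrightarrow> i = j"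
  shows "card F \<le> card A"
proof -
  have one: "\<one> \<in> A" using A(1) subgroup.one_closed by blast
  have "(cmod (\<Sum>i\<in>F. 1 * \<theta> i \<one>))\<^sup>2 \<le> (\<Sum>a\<in>A. (cmod (\<Sum>i\<in>F. 1 * \<theta> i a))\<^sup>2)"
    by (rule member_le_sum[OF one _ A(2)]) simp
  also have "\<dots> = real (card A) * (\<Sum>i\<in>F. (cmod 1)\<^sup>2)"
    by (rule sum_norm_square_linear_chars[OF A F \<theta> distinct])
  also have "(\<Sum>i\<in>F. (cmod 1)\<^sup>2) = real (card F)" by simp
  also have "(\<Sum>i\<in>F. 1 * \<theta> i \<one>) = (\<Sum>i\<in>F. 1)"
    using \<theta> by (intro sum.cong refl) (simp add: linear_char_def)
  finally have "real (card F * card F) \<le> real (card A * card F)"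
    by (simp add: power2_eq_square)
  then have "card F * card F \<le> card A * card F" by (simp only: of_nat_le_iff)
  then show ?thesis by (cases "card F = 0") simp_all
qed

end

text \<open>Equality case of the triangle inequality. With s the sum, the squares |s - n z_i|^2 add
  up to n^3 - n |s|^2, which is 0 here.\<close>

lemma norm_sum_eq_card_imp_equal:
  fixes z :: "nat \<Rightarrow> complex"
  assumes z: "\<And>i. i < n \<Longrightarrow> cmod (z i) = 1" and s: "cmod (\<Sum>i<n. z i) = real n" and i: "i < n"
  shows "(\<Sum>i<n. z i) = of_nat n * z i"
proof -
  define s where "s = (\<Sum>i<n. z i)"
  have ss: "s * cnj s = of_nat n * of_nat n"
  proof -
    have "cmod s = real n" using assms(2) by (simp only: s_def)
    then have "s * cnj s = complex_of_real ((real n)\<^sup>2)" by (simp only: complex_norm_square[symmetric])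
    then show ?thesis by (simp add: power2_eq_square)
  qed
  have zz: "z i * cnj (z i) = 1" if "i < n" for i
    using z[OF that] by (simp add: complex_norm_square[symmetric])
  have "complex_of_real (\<Sum>i<n. (cmod (s - of_nat n * z i))\<^sup>2)
      = (\<Sum>i<n. (s - of_nat n * z i) * cnj (s - of_nat n * z i))"
    by (simp only: of_real_sum complex_norm_square)
  also have "\<dots> = (\<Sum>i<n. s * cnj s + of_nat n * of_nat n * (z i * cnj (z i))
      - of_nat n * s * cnj (z i) - of_nat n * cnj s * z i)"
    by (intro sum.cong refl) (simp add: algebra_simps)
  also have "\<dots> = (\<Sum>i<n. 2 * of_nat n * of_nat n - of_nat n * s * cnj (z i) - of_nat n * cnj s * z i)"
    by (intro sum.cong refl) (simp add: ss zz)
  also have "\<dots> = of_nat n * (2 * of_nat n * of_nat n) - of_nat n * s * cnj s - of_nat n * cnj s * s"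
    by (simp only: sum_subtractf sum_distrib_left[symmetric] cnj_sum[symmetric] s_def[symmetric]
        sum_constant card_lessThan mult_ac)
  also have "\<dots> = of_nat n * (2 * of_nat n * of_nat n) - 2 * of_nat n * (s * cnj s)" by simp
  also have "\<dots> = 0" by (simp add: ss)
  finally have "(\<Sum>i<n. (cmod (s - of_nat n * z i))\<^sup>2) = 0" by (simp only: of_real_eq_0_iff)
  then have "(cmod (s - of_nat n * z i))\<^sup>2 = 0"
    using i by (subst (asm) sum_nonneg_eq_0_iff) auto
  then show ?thesis by (simp add: s_def)
qed

text \<open>The hypothesis \<open>eq\<close> is e^2 t (q - t) = q - 1 with the subtractions moved
  across, as everything is a natural number. The proof passes to integers, where (t - 1)(q - t - 1)
  \<ge> 0 gives t(q - t) \<ge> q - 1, hence e = 1 and equality; of the two equality cases, t = 1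
  contradicts e t > 1.\<close>

lemma orbit_size_equation:
  fixes e t q :: nat
  assumes q: "q \<ge> 2" and n: "e * t > 1" and eq: "(e * t)\<^sup>2 + q = q * (e * t * e) + 1"
  shows "e = 1" and "t + 1 = q"
proof -
  define E T Q where "E = int e" "T = int t" "Q = int q"
  have "e \<noteq> 0" using n by (intro notI) simp
  moreover have "t \<noteq> 0" using n by (intro notI) simp
  ultimately have e0: "E \<ge> 1" and t0: "T \<ge> 1" by (simp_all add: E_T_Q_def)
  have "int ((e * t)\<^sup>2 + q) = int (q * (e * t * e) + 1)" using eq by simp
  then have eq': "E * E * (T * (Q - T)) = Q - 1"
    by (simp add: E_T_Q_def power2_eq_square algebra_simps)
  have Q2: "Q \<ge> 2" using q by (simp add: E_T_Q_def)
  have "E * E * T > 0" using e0 t0 by simp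
  moreover have "(E * E * T) * (Q - T) > 0" using eq' Q2 by (simp add: mult.assoc)
  ultimately have QT: "Q - T \<ge> 1" using zero_less_mult_pos[of "E * E * T" "Q - T"] by simp
  have "(T - 1) * (Q - T - 1) \<ge> 0" using t0 QT by simp
  then have ge: "T * (Q - T) \<ge> Q - 1" by (simp add: algebra_simps)
  have E1: "E = 1"
  proof (rule ccontr)
    assume "E \<noteq> 1"
    then have "E * E \<ge> 2 * 2" using e0 by (intro mult_mono) auto
    then have "E * E * (T * (Q - T)) \<ge> 4 * (Q - 1)" using ge Q2 by (intro mult_mono) auto
    then show False using eq' Q2 by simp
  qed
  then show "e = 1" by (simp add: E_T_Q_def)
  have "(T - 1) * (Q - T - 1) = 0" using eq' E1 by (simp add: algebra_simps)
  moreover have "T \<noteq> 1" using n \<open>e = 1\<close> by (simp add: E_T_Q_def)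
  ultimately have "Q = T + 1" by simp
  then show "t + 1 = q" by (simp add: E_T_Q_def)
qed

section \<open>The weights form one orbit\<close>

context weighted_rep
begin

lemma subgroup_A: "subgroup A G"
  using normal_A by (rule normal_imp_subgroup)

lemma A_carrier: "a \<in> A \<Longrightarrow> a \<in> carrier G"
  using subgroup_A by (rule subgroup.mem_carrier)

lemma finite_A: "finite A"
  using finite_G subgroup.subset[OF subgroup_A] by (rule rev_finite_subset)

lemma conj_A: "\<lbrakk>g \<in> carrier G; a \<in> A\<rbrakk> \<Longrightarrow> g \<otimes> a \<otimes> inv g \<in> A"
  using normal_A normal_inv_iff by blast

lemma linear_char_l:
  assumes i: "i < n"
  shows "linear_char G A (l i)"
  unfolding linear_char_def
proof (intro conjI ballI)
  have one: "\<one> \<in> A" using subgroup_A by (rule subgroup.one_closed)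
  show "l i \<one> = 1" using r_A[OF one i i] r_one[OF i i] by simp
  fix a b assume ab: "a \<in> A" "b \<in> A"
  have "a \<otimes> b \<in> A" using subgroup.m_closed[OF subgroup_A ab] .
  then have "l i (a \<otimes> b) = (\<Sum>k<n. r a i k * r b k i)"
    using r_A[of "a \<otimes> b", OF _ i i] r_mult[OF A_carrier[OF ab(1)] A_carrier[OF ab(2)] i i] by simp
  also have "\<dots> = (\<Sum>k<n. if k = i then l i a * l i b else 0)"
    using ab i by (intro sum.cong refl) (auto simp: r_A)
  also have "\<dots> = l i a * l i b" using i by simp
  finally show "l i (a \<otimes> b) = l i a * l i b" .
qed

lemma r_mult_A:
  assumes x: "x \<in> carrier G" and a: "a \<in> A" and i: "i < n" and j: "j < n"
  shows "r (x \<otimes> a) i j = r x i j * l j a" and "r (a \<otimes> x) i j = l i a * r x i j"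
proof -
  have "r (x \<otimes> a) i j = (\<Sum>k<n. r x i k * r a k j)" by (rule r_mult[OF x A_carrier[OF a] i j])
  also have "\<dots> = (\<Sum>k<n. if k = j then r x i j * l j a else 0)"
    using a j by (intro sum.cong refl) (auto simp: r_A)
  also have "\<dots> = r x i j * l j a" using j by simp
  finally show "r (x \<otimes> a) i j = r x i j * l j a" .
  have "r (a \<otimes> x) i j = (\<Sum>k<n. r a i k * r x k j)" by (rule r_mult[OF A_carrier[OF a] x i j])
  also have "\<dots> = (\<Sum>k<n. if k = i then l i a * r x i j else 0)"
    using a i by (intro sum.cong refl) (auto simp: r_A)
  also have "\<dots> = l i a * r x i j" using i by simp
  finally show "r (a \<otimes> x) i j = l i a * r x i j" .
qed

text \<open>Compare the (i,j) entries of xa and (x a x^-1) x, which are the same element: A acts by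
  \<open>l j\<close> from the right and by \<open>l i\<close> from the left. A nonzero entry can be
  cancelled, so it ties the two weights together by conjugation with x.\<close>

lemma weights_of_nonzero_entry:
  assumes x: "x \<in> carrier G" and i: "i < n" and j: "j < n" and nz: "r x i j \<noteq> 0" and a: "a \<in> A"
  shows "l i (x \<otimes> a \<otimes> inv x) = l j a"
proof -
  have c: "x \<otimes> a \<otimes> inv x \<in> A" using conj_A[OF x a] .
  have "(x \<otimes> a \<otimes> inv x) \<otimes> x = x \<otimes> a" using x A_carrier[OF a] by (simp add: m_assoc)
  then have "l i (x \<otimes> a \<otimes> inv x) * r x i j = r x i j * l j a"
    using r_mult_A(1)[OF x a i j] r_mult_A(2)[OF x c i j] by metis
  then show ?thesis using nz by simp
qed

text \<open>The indices whose weight is conjugate to weight j form a nonempty set that no nonzero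
  entry leaves, so irreducibility makes it everything. This is the orbit part of Clifford's
  theorem.\<close>

lemma weights_transitive:
  assumes i: "i < n" and j: "j < n"
  shows "\<exists>g\<in>carrier G. \<forall>a\<in>A. l i (g \<otimes> a \<otimes> inv g) = l j a"
proof -
  define I where "I = {i. i < n \<and> (\<exists>g\<in>carrier G. \<forall>a\<in>A. l i (g \<otimes> a \<otimes> inv g) = l j a)}"
  have "j \<in> I" unfolding I_def using j A_carrier by (auto intro!: bexI[of _ \<one>])
  moreover have "I = {} \<or> I = {..<n}"
  proof (rule irreducible)
    fix g i k assume g: "g \<in> carrier G" and i: "i < n" "i \<notin> I" and k: "k \<in> I"
    then obtain h where h: "h \<in> carrier G" "\<And>a. a \<in> A \<Longrightarrow> l k (h \<otimes> a \<otimes> inv h) = l j a"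
      and kn: "k < n" unfolding I_def by blast
    show "r g i k = 0"
    proof (rule ccontr)
      assume nz: "r g i k \<noteq> 0"
      have "l i ((g \<otimes> h) \<otimes> a \<otimes> inv (g \<otimes> h)) = l j a" if a: "a \<in> A" for a
      proof -
        have "(g \<otimes> h) \<otimes> a \<otimes> inv (g \<otimes> h) = g \<otimes> (h \<otimes> a \<otimes> inv h) \<otimes> inv g"
          using g h(1) A_carrier[OF a] by (simp add: m_assoc inv_mult_group)
        then show ?thesis
          using weights_of_nonzero_entry[OF g i(1) kn nz conj_A[OF h(1) a]] h(2)[OF a] by simp
      qed
      then have "i \<in> I" unfolding I_def using i(1) g h(1) by blast
      then show False using i(2) by blast
    qed
  qed (auto simp: I_def)
  ultimately have "i \<in> I" using i by blast
  then show ?thesis unfolding I_def by blast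
qed

lemma \<chi>_mult_A:
  assumes x: "x \<in> carrier G" and a: "a \<in> A"
  shows "\<chi> (x \<otimes> a) = (\<Sum>i<n. r x i i * l i a)"
  using x A_carrier[OF a] by (simp add: \<chi>_eq r_mult_A(1)[OF x a])

lemma \<chi>_A: "a \<in> A \<Longrightarrow> \<chi> a = (\<Sum>i<n. l i a)"
  using A_carrier by (simp add: \<chi>_eq r_A)

lemma \<chi>_conj:
  assumes x: "x \<in> carrier G" and g: "g \<in> carrier G"
  shows "\<chi> (g \<otimes> x \<otimes> inv g) = \<chi> x"
proof -
  have "(\<Sum>i<n. r (u \<otimes> v) i i) = (\<Sum>i<n. r (v \<otimes> u) i i)" if "u \<in> carrier G" "v \<in> carrier G" for u v
  proof -
    have "(\<Sum>i<n. r (u \<otimes> v) i i) = (\<Sum>i<n. \<Sum>k<n. r u i k * r v k i)" using that by (simp add: r_mult)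
    also have "\<dots> = (\<Sum>k<n. \<Sum>i<n. r v k i * r u i k)" by (subst sum.swap) (simp add: mult.commute)
    also have "\<dots> = (\<Sum>k<n. r (v \<otimes> u) k k)" using that by (simp add: r_mult)
    finally show ?thesis .
  qed
  from this[of "g \<otimes> x" "inv g"] show ?thesis
    using x g by (simp add: \<chi>_eq m_assoc[symmetric])
qed

lemma card_equal_weights:
  assumes i: "i < n"
  shows "(\<Sum>a\<in>A. \<chi> a * cnj (l i a)) = of_nat (card A * card {j. j < n \<and> (\<forall>a\<in>A. l j a = l i a)})"
proof -
  have "(\<Sum>a\<in>A. \<chi> a * cnj (l i a)) = (\<Sum>a\<in>A. \<Sum>j<n. l j a * cnj (l i a))"
    by (simp add: \<chi>_A sum_distrib_right)
  also have "\<dots> = (\<Sum>j<n. \<Sum>a\<in>A. l j a * cnj (l i a))" by (rule sum.swap)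
  also have "\<dots> = (\<Sum>j<n. if \<forall>a\<in>A. l j a = l i a then of_nat (card A) else 0)"
    by (intro sum.cong refl sum_linear_char_mult_cnj[OF subgroup_A finite_A] linear_char_l)
       (use i in auto)
  also have "\<dots> = (\<Sum>j\<in>{j \<in> {..<n}. \<forall>a\<in>A. l j a = l i a}. of_nat (card A))"
    by (rule sum.inter_filter[symmetric]) simp
  also have "\<dots> = of_nat (card A * card {j. j < n \<and> (\<forall>a\<in>A. l j a = l i a)})"
    by simp
  finally show ?thesis .
qed

text \<open>The multiplicity of a weight is its inner product with \<chi> on A. Conjugation by g
  permutes A, leaves \<chi> unchanged and carries weight i to weight j, so the two inner products
  agree.\<close>

lemma card_equal_weights_const:
  assumes i: "i < n" and j: "j < n"
  shows "card {k. k < n \<and> (\<forall>a\<in>A. l k a = l i a)} = card {k. k < n \<and> (\<forall>a\<in>A. l k a = l j a)}"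
proof -
  obtain g where g: "g \<in> carrier G" "\<And>a. a \<in> A \<Longrightarrow> l i (g \<otimes> a \<otimes> inv g) = l j a"
    using weights_transitive[OF i j] by blast
  have bij: "bij_betw (\<lambda>a. g \<otimes> a \<otimes> inv g) A A"
  proof (rule bij_betw_byWitness[of _ "\<lambda>a. inv g \<otimes> a \<otimes> g"])
    show "\<forall>a\<in>A. inv g \<otimes> (g \<otimes> a \<otimes> inv g) \<otimes> g = a"
      using g(1) A_carrier by (simp add: m_assoc inv_solve_left')
    show "\<forall>a\<in>A. g \<otimes> (inv g \<otimes> a \<otimes> g) \<otimes> inv g = a"
      using g(1) A_carrier by (simp add: m_assoc) (simp add: m_assoc[symmetric])
    show "(\<lambda>a. g \<otimes> a \<otimes> inv g) ` A \<subseteq> A" using conj_A[OF g(1)] by blast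
    show "(\<lambda>a. inv g \<otimes> a \<otimes> g) ` A \<subseteq> A" using conj_A[of "inv g"] g(1) by auto
  qed
  have "(\<Sum>a\<in>A. \<chi> a * cnj (l i a)) = (\<Sum>a\<in>A. \<chi> (g \<otimes> a \<otimes> inv g) * cnj (l i (g \<otimes> a \<otimes> inv g)))"
    by (rule sum.reindex_bij_betw[OF bij, symmetric])
  also have "\<dots> = (\<Sum>a\<in>A. \<chi> a * cnj (l j a))"
    using g A_carrier by (intro sum.cong refl) (simp add: \<chi>_conj)
  finally have "card A * card {k. k < n \<and> (\<forall>a\<in>A. l k a = l i a)}
      = card A * card {k. k < n \<and> (\<forall>a\<in>A. l k a = l j a)}"
    by (simp only: card_equal_weights[OF i] card_equal_weights[OF j] of_nat_eq_iff)
  moreover have "card A \<noteq> 0" using finite_A subgroup.one_closed[OF subgroup_A] by auto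
  ultimately show ?thesis by simp
qed

text \<open>All weights have the same multiplicity \<open>e\<close>; if \<open>t\<close> of them are distinct and \<open>q = card A\<close>,
  the norm of the restriction of \<open>\<chi>\<close> to \<open>A\<close> gives \<open>e\<^sup>2 t (q - t) = q - 1\<close>.\<close>

lemma weights_distinct:
  assumes n: "n > 1" and A: "A \<noteq> {\<one>}" and unit: "\<And>a. \<lbrakk>a \<in> A; a \<noteq> \<one>\<rbrakk> \<Longrightarrow> cmod (\<chi> a) = 1"
  shows "card A = n + 1" and "\<And>i j. \<lbrakk>i < n; j < n; \<forall>a\<in>A. l i a = l j a\<rbrakk> \<Longrightarrow> i = j"
proof -
  define e where "e = card {k. k < n \<and> (\<forall>a\<in>A. l k a = l 0 a)}"
  \<comment> \<open>Restricting to A turns agreement on A into equality of functions, so that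
    distinct weights can be counted as the image of \<open>w\<close>.\<close>
  define w where "w i = restrict (l i) A" for i
  define t where "t = card (w ` {..<n})"
  have w_eq: "w i = w j \<longleftrightarrow> (\<forall>a\<in>A. l i a = l j a)" for i j
    unfolding w_def restrict_def fun_eq_iff by auto
  have e: "card {k. k < n \<and> (\<forall>a\<in>A. l k a = l i a)} = e" if "i < n" for i
    unfolding e_def using card_equal_weights_const[OF that, of 0] n by simp
  have one: "\<one> \<in> A" using subgroup_A by (rule subgroup.one_closed)
  have "n = (\<Sum>i<n. 1)" by simp
  also have "\<dots> = (\<Sum>y\<in>w ` {..<n}. \<Sum>i\<in>{i \<in> {..<n}. w i = y}. 1)" by (rule sum.image_gen) simp
  also have "\<dots> = (\<Sum>y\<in>w ` {..<n}. e)"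
  proof (intro sum.cong refl)
    fix y assume "y \<in> w ` {..<n}"
    then obtain i where i: "i < n" "y = w i" by blast
    have "{k \<in> {..<n}. w k = y} = {k. k < n \<and> (\<forall>a\<in>A. l k a = l i a)}"
      unfolding i(2) w_eq by blast
    then show "(\<Sum>i\<in>{i \<in> {..<n}. w i = y}. 1) = e" using e[OF i(1)] by simp
  qed
  also have "\<dots> = e * t" by (simp add: t_def)
  finally have net: "n = e * t" .
  \<comment> \<open>The square norm of \<chi> on A is evaluated twice. By weights, each of the e t
    indices contributes |A| e; by values, the identity contributes n^2 and every other element
    1.\<close>
  have "complex_of_real (\<Sum>a\<in>A. (cmod (\<chi> a))\<^sup>2) = (\<Sum>a\<in>A. \<chi> a * cnj (\<chi> a))"
    by (simp only: of_real_sum complex_norm_square)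
  also have "\<dots> = (\<Sum>a\<in>A. \<Sum>i<n. \<chi> a * cnj (l i a))"
    by (intro sum.cong refl) (simp add: \<chi>_A sum_distrib_left)
  also have "\<dots> = (\<Sum>i<n. \<Sum>a\<in>A. \<chi> a * cnj (l i a))" by (rule sum.swap)
  also have "\<dots> = (\<Sum>i<n. of_nat (card A * e))"
    by (intro sum.cong refl) (simp only: card_equal_weights e lessThan_iff)
  also have "\<dots> = complex_of_real (real (card A * (e * t * e)))"
    by (simp add: net)
  finally have sum1: "(\<Sum>a\<in>A. (cmod (\<chi> a))\<^sup>2) = real (card A * (e * t * e))"
    by (simp only: of_real_eq_iff)
  have \<chi>1: "\<chi> \<one> = of_nat n" using \<chi>_eq[of \<one>] by (simp add: r_one)
  have "(\<Sum>a\<in>A. (cmod (\<chi> a))\<^sup>2) = (cmod (\<chi> \<one>))\<^sup>2 + (\<Sum>a\<in>A - {\<one>}. (cmod (\<chi> a))\<^sup>2)"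
    by (rule sum.remove[OF finite_A one])
  also have "(\<Sum>a\<in>A - {\<one>}. (cmod (\<chi> a))\<^sup>2) = (\<Sum>a\<in>A - {\<one>}. 1)"
    by (intro sum.cong refl) (simp add: unit)
  also have "\<dots> = real (card A - 1)" using one finite_A by simp
  finally have sum2: "(\<Sum>a\<in>A. (cmod (\<chi> a))\<^sup>2) = real (n\<^sup>2 + (card A - 1))"
    by (simp add: \<chi>1)
  have "card A * (e * t * e) = n\<^sup>2 + (card A - 1)" using sum1 sum2 by (metis of_nat_eq_iff)
  moreover have q: "card A \<ge> 2"
  proof -
    have "card {\<one>} < card A" using A one finite_A by (intro psubset_card_mono) auto
    then show ?thesis by simp
  qed
  ultimately have eq: "(e * t)\<^sup>2 + card A = card A * (e * t * e) + 1" by (simp add: net)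
  have e1: "e = 1" and t: "t + 1 = card A"
    using orbit_size_equation[OF q _ eq] n net by simp_all
  show "card A = n + 1" using t net e1 by simp
  fix i j assume ij: "i < n" "j < n" "\<forall>a\<in>A. l i a = l j a"
  have "card (w ` {..<n}) = card {..<n}" using net e1 t_def by simp
  then have "inj_on w {..<n}" by (simp add: eq_card_imp_inj_on)
  then show "i = j" using ij w_eq by (simp add: inj_on_def)
qed

end

section \<open>Multiplicity-free weights\<close>

text \<open>The outcome of the orbit count is frozen as a set of hypotheses because it is used for
  several normal subgroups: Omega_1(Z(P)), P itself, and normal subgroups of G inside P.
  Unimodularity of \<chi> is left to the single lemmas, since each of them needs it on a different
  coset.\<close>

locale simple_weights = weighted_rep +
  assumes n_gt_1: "n > 1"
    and faithful: "\<lbrakk>g \<in> carrier G; \<chi> g = \<chi> \<one>\<rbrakk> \<Longrightarrow> g = \<one>"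
    and card_A: "card A = n + 1"
    and distinct: "\<lbrakk>i < n; j < n; \<forall>a\<in>A. l i a = l j a\<rbrakk> \<Longrightarrow> i = j"
begin

text \<open>If g and h have equal matrices, g h^-1 has the diagonal of the identity, hence the same
  character value as the identity, and faithfulness applies. Identities in G can thus be checked
  entrywise.\<close>

lemma r_inject:
  assumes g: "g \<in> carrier G" and h: "h \<in> carrier G"
    and eq: "\<And>i j. \<lbrakk>i < n; j < n\<rbrakk> \<Longrightarrow> r g i j = r h i j"
  shows "g = h"
proof -
  have "r (g \<otimes> inv h) i i = r \<one> i i" if i: "i < n" for i
  proof -
    have "r (g \<otimes> inv h) i i = (\<Sum>k<n. r g i k * r (inv h) k i)" using g h i by (simp add: r_mult)
    also have "\<dots> = (\<Sum>k<n. r h i k * r (inv h) k i)" using eq i by simp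
    also have "\<dots> = r (h \<otimes> inv h) i i" using h i by (simp only: r_mult inv_closed)
    finally show ?thesis using h by simp
  qed
  then have "\<chi> (g \<otimes> inv h) = \<chi> \<one>" using g h by (simp add: \<chi>_eq)
  then have "g \<otimes> inv h = \<one>" using g h by (intro faithful) auto
  then show ?thesis using inv_equality[of g "inv h"] g h by simp
qed

text \<open>The trivial character is its own orbit under conjugation, so by transitivity all n > 1
  weights would be trivial, against distinctness.\<close>

lemma weights_nontrivial:
  assumes i: "i < n"
  shows "\<exists>a\<in>A. l i a \<noteq> 1"
proof (rule ccontr)
  assume "\<not> ?thesis"
  then have triv: "\<And>a. a \<in> A \<Longrightarrow> l i a = 1" by blast
  have "\<forall>a\<in>A. l j a = 1" if j: "j < n" for j
  proof -
    obtain g where g: "g \<in> carrier G" "\<And>a. a \<in> A \<Longrightarrow> l i (g \<otimes> a \<otimes> inv g) = l j a"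
      using weights_transitive[OF i j] by blast
    then show ?thesis using triv conj_A by metis
  qed
  then have "(0::nat) = 1" using n_gt_1 by (intro distinct) auto
  then show False by simp
qed

text \<open>The n weights and the trivial character are already n + 1 = |A| distinct characters. A
  further one, placed at index n + 1 of the list \<open>f\<close> after the trivial one at index n,
  would exceed the bound on the dual.\<close>

lemma linear_char_is_weight:
  assumes \<theta>: "linear_char G A \<theta>" and nt: "\<exists>a\<in>A. \<theta> a \<noteq> 1"
  shows "\<exists>i<n. \<forall>a\<in>A. \<theta> a = l i a"
proof (rule ccontr)
  assume no: "\<not> ?thesis"
  define f where "f i = (if i < n then l i else if i = n then (\<lambda>_. 1) else \<theta>)" for i
  have "card {..<n + 2} \<le> card A"
  proof (rule card_linear_chars_le[OF subgroup_A finite_A, where \<theta> = f])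
    show "linear_char G A (f i)" for i
      using linear_char_l \<theta> by (simp add: f_def) (simp add: linear_char_def)
    have ltF: False if ij: "i < j" "j < n + 2" and eq: "\<forall>a\<in>A. f i a = f j a" for i j
    proof -
      consider "j < n" | "j = n" | "j = n + 1" "i < n" | "j = n + 1" "i = n" using ij by linarith
      then show False
      proof cases
        case 1
        then have "\<forall>a\<in>A. l i a = l j a" using eq ij by (simp add: f_def)
        then show False using distinct[of i j] ij 1 by simp
      next
        case 2
        then have "\<forall>a\<in>A. l i a = 1" using eq ij by (simp add: f_def)
        then show False using weights_nontrivial[of i] ij 2 by blast
      next
        case 3
        then have "\<forall>a\<in>A. l i a = \<theta> a" using eq by (simp add: f_def)
        then show False using no 3 by metis
      next
        case 4
        then have "\<forall>a\<in>A. 1 = \<theta> a" using eq by (simp add: f_def)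
        then show False using nt by metis
      qed
    qed
    fix i j assume ij: "i \<in> {..<n+2}" "j \<in> {..<n+2}" and eq: "\<forall>a\<in>A. f i a = f j a"
    show "i = j"
    proof (cases i j rule: linorder_cases)
      case less then show ?thesis using ltF[of i j] ij eq by simp
    next
      case greater then show ?thesis using ltF[of j i] ij eq by simp
    qed
  qed simp
  then show False using card_A by simp
qed

text \<open>If x fixes weight i, an entry of row i off the diagonal would force a second index with
  the same weight, so row i is concentrated on the diagonal. Then that entry cannot vanish, x being
  invertible, and it is multiplicative along powers of x, so it is a root of unity.\<close>

lemma diagonal_entry:
  assumes x: "x \<in> carrier G" and i: "i < n"
  shows "r x i i \<noteq> 0 \<longleftrightarrow> (\<forall>a\<in>A. l i (x \<otimes> a \<otimes> inv x) = l i a)"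
    and "r x i i \<noteq> 0 \<Longrightarrow> cmod (r x i i) = 1"
proof -
  have off: "r x i j = 0" if j: "j < n" "j \<noteq> i" and fixed: "\<forall>a\<in>A. l i (x \<otimes> a \<otimes> inv x) = l i a" for j
  proof (rule ccontr)
    assume nz: "r x i j \<noteq> 0"
    have "\<forall>a\<in>A. l j a = l i a" using weights_of_nonzero_entry[OF x i j(1) nz] fixed by metis
    then show False using distinct[OF j(1) i] j(2) by blast
  qed
  show iff: "r x i i \<noteq> 0 \<longleftrightarrow> (\<forall>a\<in>A. l i (x \<otimes> a \<otimes> inv x) = l i a)"
  proof
    assume "r x i i \<noteq> 0"
    then show "\<forall>a\<in>A. l i (x \<otimes> a \<otimes> inv x) = l i a" using weights_of_nonzero_entry[OF x i i] by blast
  next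
    assume fixed: "\<forall>a\<in>A. l i (x \<otimes> a \<otimes> inv x) = l i a"
    show "r x i i \<noteq> 0"
    proof
      assume z: "r x i i = 0"
      have zero: "r x i k * r (inv x) k i = 0" if "k < n" for k
        using off[OF that _ fixed] z by (cases "k = i") auto
      have "r (x \<otimes> inv x) i i = (\<Sum>k<n. r x i k * r (inv x) k i)" using x i by (simp only: r_mult inv_closed)
      also have "\<dots> = 0" using zero by (intro sum.neutral) simp
      finally show False using x r_one[OF i i] by simp
    qed
  qed
  assume nz: "r x i i \<noteq> 0"
  then have fixed: "\<forall>a\<in>A. l i (x \<otimes> a \<otimes> inv x) = l i a" using iff by blast
  have pow: "r (x [^] m) i i = r x i i ^ m" for m :: nat
  proof (induction m)
    case 0 then show ?case using r_one[OF i i] by simp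
  next
    case (Suc m)
    have zero: "r x i k * r (x [^] m) k i = (if k = i then r x i i * r (x [^] m) i i else 0)" if "k < n" for k
      using off[OF that _ fixed] by (cases "k = i") auto
    have "x [^] Suc m = x \<otimes> x [^] m" using nat_pow_Suc2[OF x] .
    then have "r (x [^] Suc m) i i = (\<Sum>k<n. r x i k * r (x [^] m) k i)"
      using r_mult[OF x nat_pow_closed[OF x] i i, of m] by simp
    also have "\<dots> = (\<Sum>k<n. if k = i then r x i i * r (x [^] m) i i else 0)"
      by (intro sum.cong refl zero) simp
    also have "\<dots> = r x i i * r (x [^] m) i i" using i by simp
    finally show ?case by (simp add: Suc)
  qed
  have "r x i i ^ Coset.order G = 1"
    using pow[of "Coset.order G"] pow_order_eq_1[OF x] r_one[OF i i] by simp
  then have "cmod (r x i i) ^ Coset.order G = 1 ^ Coset.order G" by (simp flip: norm_power)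
  moreover have "Coset.order G > 0" using finite_G order_gt_0_iff_finite by blast
  ultimately show "cmod (r x i i) = 1"
    using power_eq_imp_eq_base[of "cmod (r x i i)" "Coset.order G" 1] by simp
qed

text \<open>On xA the character is a combination of the distinct weights with the diagonal entries
  of x as coefficients. By Parseval only the number of nonzero entries matters, as each of them has
  modulus one.\<close>

lemma sum_norm_square_coset:
  assumes x: "x \<in> carrier G"
  shows "(\<Sum>a\<in>A. (cmod (\<chi> (x \<otimes> a)))\<^sup>2) = real (card A * card {i. i < n \<and> r x i i \<noteq> 0})"
proof -
  have "(\<Sum>a\<in>A. (cmod (\<chi> (x \<otimes> a)))\<^sup>2) = (\<Sum>a\<in>A. (cmod (\<Sum>i<n. r x i i * l i a))\<^sup>2)"
    by (intro sum.cong refl) (simp only: \<chi>_mult_A[OF x])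
  also have "\<dots> = real (card A) * (\<Sum>i<n. (cmod (r x i i))\<^sup>2)"
    by (rule sum_norm_square_linear_chars[OF subgroup_A finite_A]) (auto intro: linear_char_l distinct)
  also have "(\<Sum>i<n. (cmod (r x i i))\<^sup>2) = (\<Sum>i<n. if r x i i \<noteq> 0 then 1 else 0)"
    using diagonal_entry(2)[OF x] by (intro sum.cong refl) auto
  also have "\<dots> = (\<Sum>i\<in>{i \<in> {..<n}. r x i i \<noteq> 0}. 1)" by (rule sum.inter_filter[symmetric]) simp
  also have "\<dots> = real (card {i. i < n \<and> r x i i \<noteq> 0})" by simp
  finally show ?thesis by simp
qed

lemma centralizer_fixes:
  assumes "c \<in> centralizer G A" and a: "a \<in> A"
  shows "c \<otimes> a \<otimes> inv c = a"
proof -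
  have "c \<in> carrier G" "c \<otimes> a = a \<otimes> c" using assms by (auto simp: centralizer_def)
  then show ?thesis using A_carrier[OF a] by (simp add: m_assoc)
qed

text \<open>Conjugation by c is trivial on A, so a nonzero entry at (i,j) would equate weights i and
  j. Thus C_G(A) consists of invertible diagonal matrices.\<close>

lemma r_centralizer:
  assumes c: "c \<in> centralizer G A" and i: "i < n" and j: "j < n"
  shows "i \<noteq> j \<Longrightarrow> r c i j = 0" and "r c i i \<noteq> 0"
proof -
  have cG: "c \<in> carrier G" using c by (simp add: centralizer_def)
  show "r c i i \<noteq> 0" using diagonal_entry(1)[OF cG i] centralizer_fixes[OF c] by simp
  assume "i \<noteq> j"
  show "r c i j = 0"
  proof (rule ccontr)
    assume nz: "r c i j \<noteq> 0"
    have "\<forall>a\<in>A. l i a = l j a"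
      using weights_of_nonzero_entry[OF cG i j nz] centralizer_fixes[OF c] by simp
    then show False using distinct[OF i j] \<open>i \<noteq> j\<close> by blast
  qed
qed

lemma r_mult_centralizer:
  assumes c: "c \<in> centralizer G A" and x: "x \<in> carrier G" and i: "i < n" and j: "j < n"
  shows "r (c \<otimes> x) i j = r c i i * r x i j" and "r (x \<otimes> c) i j = r x i j * r c j j"
proof -
  have cG: "c \<in> carrier G" using c by (simp add: centralizer_def)
  have "r (c \<otimes> x) i j = (\<Sum>k<n. r c i k * r x k j)" by (rule r_mult[OF cG x i j])
  also have "\<dots> = (\<Sum>k<n. if k = i then r c i i * r x i j else 0)"
    using r_centralizer(1)[OF c i] by (intro sum.cong refl) auto
  also have "\<dots> = r c i i * r x i j" using i by simp
  finally show "r (c \<otimes> x) i j = r c i i * r x i j" .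
  have "r (x \<otimes> c) i j = (\<Sum>k<n. r x i k * r c k j)" by (rule r_mult[OF x cG i j])
  also have "\<dots> = (\<Sum>k<n. if k = j then r x i j * r c j j else 0)"
    using r_centralizer(1)[OF c _ j] by (intro sum.cong refl) auto
  also have "\<dots> = r x i j * r c j j" using j by simp
  finally show "r (x \<otimes> c) i j = r x i j * r c j j" .
qed

lemma centralizer_commute:
  assumes c: "c \<in> centralizer G A" and d: "d \<in> centralizer G A"
  shows "c \<otimes> d = d \<otimes> c"
proof -
  have cG: "c \<in> carrier G" and dG: "d \<in> carrier G" using c d by (auto simp: centralizer_def)
  show ?thesis
  proof (rule r_inject)
    fix i j assume ij: "i < n" "j < n"
    show "r (c \<otimes> d) i j = r (d \<otimes> c) i j"
      using r_mult_centralizer(1)[OF c dG ij] r_mult_centralizer(2)[OF c dG ij] r_centralizer(1)[OF d ij]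
      by (cases "i = j") auto
  qed (use cG dG in auto)
qed

text \<open>All n diagonal entries of c are nonzero, so the coset sum is (n + 1) n. The n elements c
  a with a not the identity account for n of it, which leaves n^2 for |\<chi>(c)|^2. Equality in the
  triangle inequality then makes c a scalar matrix.\<close>

lemma centralizer_central:
  assumes c: "c \<in> centralizer G A" and unit: "\<And>a. \<lbrakk>a \<in> A; a \<noteq> \<one>\<rbrakk> \<Longrightarrow> cmod (\<chi> (c \<otimes> a)) = 1"
  shows "c \<in> group_center G"
proof -
  have cG: "c \<in> carrier G" using c by (simp add: centralizer_def)
  have one: "\<one> \<in> A" using subgroup_A by (rule subgroup.one_closed)
  have nz: "r c i i \<noteq> 0" if "i < n" for i using r_centralizer(2)[OF c that that] .
  have "{i. i < n \<and> r c i i \<noteq> 0} = {..<n}" using nz by auto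
  then have "real (card A * n) = (\<Sum>a\<in>A. (cmod (\<chi> (c \<otimes> a)))\<^sup>2)"
    using sum_norm_square_coset[OF cG] by simp
  also have "\<dots> = (cmod (\<chi> (c \<otimes> \<one>)))\<^sup>2 + (\<Sum>a\<in>A - {\<one>}. (cmod (\<chi> (c \<otimes> a)))\<^sup>2)"
    by (rule sum.remove[OF finite_A one])
  also have "(\<Sum>a\<in>A - {\<one>}. (cmod (\<chi> (c \<otimes> a)))\<^sup>2) = (\<Sum>a\<in>A - {\<one>}. 1)"
    by (intro sum.cong refl) (simp add: unit)
  also have "\<dots> = real n" using one finite_A card_A by simp
  finally have "(cmod (\<chi> c))\<^sup>2 = (real n)\<^sup>2"
    using cG card_A by (simp add: power2_eq_square algebra_simps)
  then have "cmod (\<chi> c) = real n" by (rule power2_eq_imp_eq) simp_all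
  then have s: "cmod (\<Sum>i<n. r c i i) = real n" using \<chi>_eq[OF cG] by simp
  have sum: "(\<Sum>k<n. r c k k) = of_nat n * r c i i" if "i < n" for i
    by (rule norm_sum_eq_card_imp_equal[OF diagonal_entry(2)[OF cG _ nz] s that])
  have eq: "r c i i = r c j j" if "i < n" "j < n" for i j
  proof -
    have "of_nat n * r c i i = of_nat n * r c j j" by (simp only: sum[OF that(1), symmetric] sum[OF that(2), symmetric])
    then show ?thesis using n_gt_1 by simp
  qed
  have "c \<otimes> x = x \<otimes> c" if x: "x \<in> carrier G" for x
  proof (rule r_inject)
    fix i j assume ij: "i < n" "j < n"
    show "r (c \<otimes> x) i j = r (x \<otimes> c) i j"
      using r_mult_centralizer[OF c x ij] eq[OF ij] by simp
  qed (use cG x in auto)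
  then show ?thesis using cG by (simp add: group_center_def centralizer_def)
qed

text \<open>By transitivity all weights take the same value on a central z in A, so |\<chi>(z)| = n
  > 1, which unimodularity allows only at the identity.\<close>

lemma center_inter_A:
  assumes unit: "\<And>a. \<lbrakk>a \<in> A; a \<noteq> \<one>\<rbrakk> \<Longrightarrow> cmod (\<chi> a) = 1"
  shows "A \<inter> group_center G = {\<one>}"
proof -
  have "z = \<one>" if z: "z \<in> A" "z \<in> group_center G" for z
  proof (rule ccontr)
    assume "z \<noteq> \<one>"
    then have "cmod (\<chi> z) = 1" using unit z by blast
    have eq: "l i z = l 0 z" if i: "i < n" for i
    proof -
      obtain g where g: "g \<in> carrier G" "\<And>a. a \<in> A \<Longrightarrow> l i (g \<otimes> a \<otimes> inv g) = l 0 a"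
        using weights_transitive[OF i, of 0] n_gt_1 by auto
      have "g \<otimes> z = z \<otimes> g" using z g(1) by (simp add: group_center_def centralizer_def)
      then have "g \<otimes> z \<otimes> inv g = z" using g(1) A_carrier[OF z(1)] by (simp add: m_assoc)
      then show ?thesis using g(2)[OF z(1)] by simp
    qed
    have "\<chi> z = (\<Sum>i<n. l i z)" by (rule \<chi>_A[OF z(1)])
    also have "\<dots> = (\<Sum>i<n. l 0 z)" by (intro sum.cong refl eq) simp
    finally have "cmod (\<chi> z) = real n * cmod (l 0 z)" by (simp add: norm_mult)
    also have "cmod (l 0 z) = 1"
      using norm_linear_char[OF subgroup_A finite_A linear_char_l z(1)] n_gt_1 by simp
    finally show False using \<open>cmod (\<chi> z) = 1\<close> n_gt_1 by simp
  qed
  moreover have "\<one> \<in> A" using subgroup_A by (rule subgroup.one_closed)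
  moreover have "\<one> \<in> group_center G" by (simp add: group_center_def centralizer_def)
  ultimately show ?thesis by blast
qed

text \<open>A coset sum equal to |A| leaves exactly one nonzero diagonal entry, that is, one weight
  fixed by x. Since every nontrivial character of A is a weight, the characters fixed by x are just
  this weight and the trivial one, and any fixed character built later must be one of the
  two.\<close>

lemma unique_fixed_weight:
  assumes x: "x \<in> carrier G" and unit: "\<And>a. a \<in> A \<Longrightarrow> cmod (\<chi> (x \<otimes> a)) = 1"
  obtains i where "i < n" and "\<And>a. a \<in> A \<Longrightarrow> l i (x \<otimes> a \<otimes> inv x) = l i a"
    and "\<And>\<theta>. \<lbrakk>linear_char G A \<theta>; \<And>a. a \<in> A \<Longrightarrow> \<theta> (x \<otimes> a \<otimes> inv x) = \<theta> a\<rbrakk>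
      \<Longrightarrow> (\<forall>a\<in>A. \<theta> a = 1) \<or> (\<forall>a\<in>A. \<theta> a = l i a)"
proof -
  have "real (card A * card {i. i < n \<and> r x i i \<noteq> 0}) = (\<Sum>a\<in>A. 1)"
    unfolding sum_norm_square_coset[OF x, symmetric] by (intro sum.cong refl) (simp add: unit)
  also have "\<dots> = real (card A)" by simp
  finally have "card A * card {i. i < n \<and> r x i i \<noteq> 0} = card A" by (simp only: of_nat_eq_iff)
  then have "card A * card {i. i < n \<and> r x i i \<noteq> 0} = card A * 1" by (simp only: mult_1_right)
  moreover have "card A \<noteq> 0" using card_A by simp
  ultimately have "card {i. i < n \<and> r x i i \<noteq> 0} = 1" by (simp only: mult_cancel_left if_False simp_thms)
  then obtain i where i: "{i. i < n \<and> r x i i \<noteq> 0} = {i}" using card_1_singletonE by blast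
  then have i': "i < n" "r x i i \<noteq> 0" by blast+
  show ?thesis
  proof (rule that[OF i'(1)])
    show "l i (x \<otimes> a \<otimes> inv x) = l i a" if "a \<in> A" for a
      using diagonal_entry(1)[OF x i'(1)] i'(2) that by blast
    fix \<theta> assume \<theta>: "linear_char G A \<theta>" "\<And>a. a \<in> A \<Longrightarrow> \<theta> (x \<otimes> a \<otimes> inv x) = \<theta> a"
    show "(\<forall>a\<in>A. \<theta> a = 1) \<or> (\<forall>a\<in>A. \<theta> a = l i a)"
    proof (rule disjCI)
      assume "\<not> (\<forall>a\<in>A. \<theta> a = l i a)"
      show "\<forall>a\<in>A. \<theta> a = 1"
      proof (rule ccontr)
        assume "\<not> ?thesis"
        then obtain j where j: "j < n" "\<And>a. a \<in> A \<Longrightarrow> \<theta> a = l j a"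
          using linear_char_is_weight[OF \<theta>(1)] by blast
        have "l j (x \<otimes> a \<otimes> inv x) = l j a" if "a \<in> A" for a
          using \<theta>(2)[OF that] j(2)[OF that] j(2)[OF conj_A[OF x that]] by simp
        then have "r x j j \<noteq> 0" using diagonal_entry(1)[OF x j(1)] by blast
        then have "j = i" using i j(1) by blast
        then show False using j(2) \<open>\<not> (\<forall>a\<in>A. \<theta> a = l i a)\<close> by blast
      qed
    qed
  qed
qed

text \<open>The square of the fixed weight is fixed again, hence trivial or equal to the weight; the
  latter would make the weight trivial. So the weight takes the value -1 at some a, and a^p = 1
  forces p to be even.\<close>

lemma p_eq_2_of_unit_coset:
  assumes x: "x \<in> carrier G" and unit: "\<And>a. a \<in> A \<Longrightarrow> cmod (\<chi> (x \<otimes> a)) = 1"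
    and p: "Factorial_Ring.prime (p::nat)" and exp: "\<And>a. a \<in> A \<Longrightarrow> a [^] p = \<one>"
  shows "p = 2"
proof -
  obtain i where i: "i < n" "\<And>a. a \<in> A \<Longrightarrow> l i (x \<otimes> a \<otimes> inv x) = l i a"
    and uniq: "\<And>\<theta>. \<lbrakk>linear_char G A \<theta>; \<And>a. a \<in> A \<Longrightarrow> \<theta> (x \<otimes> a \<otimes> inv x) = \<theta> a\<rbrakk>
      \<Longrightarrow> (\<forall>a\<in>A. \<theta> a = 1) \<or> (\<forall>a\<in>A. \<theta> a = l i a)"
    using unique_fixed_weight[OF x unit] by blast
  have li: "linear_char G A (l i)" by (rule linear_char_l[OF i(1)])
  obtain a where a: "a \<in> A" "l i a \<noteq> 1" using weights_nontrivial[OF i(1)] by blast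
  have "linear_char G A (\<lambda>a. l i a * l i a)" using li by (simp add: linear_char_def)
  then have "(\<forall>a\<in>A. l i a * l i a = 1) \<or> (\<forall>a\<in>A. l i a * l i a = l i a)"
    using uniq[of "\<lambda>a. l i a * l i a"] i(2) by simp
  moreover have "l i a \<noteq> 0" using norm_linear_char[OF subgroup_A finite_A li a(1)] by auto
  ultimately have "l i a * l i a = 1" using a by auto
  then have m1: "l i a = - 1" using a(2) by (simp add: square_eq_1_iff)
  have "a [^] m \<in> A \<and> l i (a [^] m) = l i a ^ m" for m :: nat
  proof (induction m)
    case 0 then show ?case using li subgroup.one_closed[OF subgroup_A] by (simp add: linear_char_def)
  next
    case (Suc m) then show ?case
      using li a(1) subgroup.m_closed[OF subgroup_A, of "a [^] m" a] by (simp add: linear_char_def)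
  qed
  from this[of p] have "(- 1 :: complex) ^ p = 1" using exp[OF a(1)] li m1 by (simp add: linear_char_def)
  then have "even p" by (cases "even p") auto
  then show ?thesis using p primes_dvd_imp_eq two_is_prime_nat by blast
qed

text \<open>Let \<lambda> be the weight fixed by x. Every other weight is multiplied by \<lambda>
  under x, and any two of these others differ by the factor \<lambda>. So one of them determines
  every further one, and at most two exist besides \<lambda>.\<close>

lemma n_le_3_of_unit_coset:
  assumes x: "x \<in> carrier G" and unit: "\<And>a. a \<in> A \<Longrightarrow> cmod (\<chi> (x \<otimes> a)) = 1"
    and exp: "\<And>a. a \<in> A \<Longrightarrow> a \<otimes> a = \<one>" and xx: "x \<otimes> x \<in> centralizer G A"
  shows "n \<le> 3"
proof -
  define \<sigma> where "\<sigma> a = x \<otimes> a \<otimes> inv x" for a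
  obtain i where i: "i < n" "\<And>a. a \<in> A \<Longrightarrow> l i (\<sigma> a) = l i a"
    and uniq: "\<And>\<theta>. \<lbrakk>linear_char G A \<theta>; \<And>a. a \<in> A \<Longrightarrow> \<theta> (\<sigma> a) = \<theta> a\<rbrakk>
      \<Longrightarrow> (\<forall>a\<in>A. \<theta> a = 1) \<or> (\<forall>a\<in>A. \<theta> a = l i a)"
    using unique_fixed_weight[OF x unit] unfolding \<sigma>_def by blast
  have \<sigma>A: "\<sigma> a \<in> A" if "a \<in> A" for a unfolding \<sigma>_def using conj_A[OF x that] .
  have \<sigma>m: "\<sigma> (a \<otimes> b) = \<sigma> a \<otimes> \<sigma> b" if "a \<in> A" "b \<in> A" for a b
    unfolding \<sigma>_def using x A_carrier[OF that(1)] A_carrier[OF that(2)]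
    by (simp add: m_assoc) (simp add: m_assoc[symmetric])
  have \<sigma>1: "\<sigma> \<one> = \<one>" unfolding \<sigma>_def using x by simp
  have \<sigma>\<sigma>: "\<sigma> (\<sigma> a) = a" if a: "a \<in> A" for a
  proof -
    have "\<sigma> (\<sigma> a) = (x \<otimes> x) \<otimes> a \<otimes> inv (x \<otimes> x)"
      unfolding \<sigma>_def using x A_carrier[OF a] by (simp add: m_assoc inv_mult_group)
    then show ?thesis using centralizer_fixes[OF xx a] by simp
  qed
  have lc: "linear_char G A (\<lambda>a. \<theta> a * \<eta> a)" if "linear_char G A \<theta>" "linear_char G A \<eta>" for \<theta> \<eta>
    using that by (simp add: linear_char_def)
  have lc\<sigma>: "linear_char G A (\<lambda>a. \<theta> (\<sigma> a))" if "linear_char G A \<theta>" for \<theta>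
    using that \<sigma>A by (simp add: linear_char_def \<sigma>m \<sigma>1)
  have sq: "l j a * l j a = 1" if "j < n" "a \<in> A" for j a
  proof -
    have "l j a * l j a = l j (a \<otimes> a)" using linear_char_l[OF that(1)] that(2) by (simp add: linear_char_def)
    then show ?thesis using exp[OF that(2)] linear_char_l[OF that(1)] by (simp add: linear_char_def)
  qed
  \<comment> \<open>The product of \<open>l j\<close> with its conjugate under x is fixed by x,
    because x^2 acts trivially. It is therefore 1 or \<open>l i\<close>; the value 1 would make
    \<open>l j\<close> itself fixed, as its square is trivial.\<close>
  have moved: "l j (\<sigma> a) = l j a * l i a" if j: "j < n" "j \<noteq> i" and a: "a \<in> A" for j a
  proof -
    have lj: "linear_char G A (l j)" by (rule linear_char_l[OF j(1)])
    have "(\<forall>a\<in>A. l j a * l j (\<sigma> a) = 1) \<or> (\<forall>a\<in>A. l j a * l j (\<sigma> a) = l i a)"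
      by (rule uniq[OF lc[OF lj lc\<sigma>[OF lj]]]) (simp add: \<sigma>\<sigma> mult.commute)
    moreover have "\<not> (\<forall>a\<in>A. l j a * l j (\<sigma> a) = 1)"
    proof
      assume h: "\<forall>a\<in>A. l j a * l j (\<sigma> a) = 1"
      have "l j (\<sigma> b) = l j b" if b: "b \<in> A" for b
      proof -
        have "l j (\<sigma> b) = (l j b * l j b) * l j (\<sigma> b)" using sq[OF j(1) b] by simp
        also have "\<dots> = l j b * (l j b * l j (\<sigma> b))" by (simp only: mult.assoc)
        also have "\<dots> = l j b" using h b by simp
        finally show ?thesis .
      qed
      then have "(\<forall>a\<in>A. l j a = 1) \<or> (\<forall>a\<in>A. l j a = l i a)" by (intro uniq[OF lj])
      then show False using weights_nontrivial[OF j(1)] distinct[OF j(1) i(1)] j(2) by blast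
    qed
    ultimately have h: "l j a * l j (\<sigma> a) = l i a" using a by blast
    have "l j (\<sigma> a) = (l j a * l j a) * l j (\<sigma> a)" using sq[OF j(1) a] by simp
    also have "\<dots> = l j a * l i a" by (simp only: mult.assoc h)
    finally show ?thesis .
  qed
  \<comment> \<open>Under x both factors pick up \<open>l i\<close>, whose square is trivial, so
    their product is fixed and equals 1 or \<open>l i\<close>. The value 1 would identify the two
    weights.\<close>
  have prod: "\<forall>a\<in>A. l k a = l j a * l i a" if j: "j < n" "j \<noteq> i" and k: "k < n" "k \<noteq> i" "j \<noteq> k" for j k
  proof -
    have "(\<forall>a\<in>A. l j a * l k a = 1) \<or> (\<forall>a\<in>A. l j a * l k a = l i a)"
    proof (rule uniq[OF lc[OF linear_char_l[OF j(1)] linear_char_l[OF k(1)]]])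
      fix a assume a: "a \<in> A"
      have "l j (\<sigma> a) * l k (\<sigma> a) = (l j a * l k a) * (l i a * l i a)"
        by (simp only: moved[OF j a] moved[OF k(1,2) a] mult_ac)
      then show "l j (\<sigma> a) * l k (\<sigma> a) = l j a * l k a" using sq[OF i(1) a] by simp
    qed
    moreover have lk: "l k a = l j a * (l j a * l k a)" if "a \<in> A" for a
      using sq[OF j(1) that] by (simp add: mult.assoc[symmetric])
    moreover have "\<not> (\<forall>a\<in>A. l j a * l k a = 1)"
    proof
      assume h: "\<forall>a\<in>A. l j a * l k a = 1"
      have "\<forall>a\<in>A. l k a = l j a" using lk h by (metis mult.right_neutral)
      then show False using distinct[OF k(1) j(1)] k(3) by blast
    qed
    ultimately show ?thesis by metis
  qed
  show ?thesis
  proof (rule ccontr)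
    assume "\<not> n \<le> 3"
    then have "card ({..<n} - {i}) \<ge> 3" using i(1) by simp
    then obtain T where T: "T \<subseteq> {..<n} - {i}" "card T = 3" by (meson obtain_subset_with_card_n)
    then obtain j k m where jkm: "T = {j,k,m}" "j \<noteq> k" "j \<noteq> m" "k \<noteq> m" by (auto simp: card_3_iff)
    then have b: "j < n" "j \<noteq> i" "k < n" "k \<noteq> i" "m < n" "m \<noteq> i" using T(1) by auto
    have "\<forall>a\<in>A. l k a = l m a"
      using prod[of j k] prod[of j m] b jkm by simp
    then show False using distinct[of k m] b jkm by blast
  qed
qed

end

section \<open>Finite \<open>p\<close>-groups\<close>

context group
begin

lemma nat_pow_mem: "subgroup H G \<Longrightarrow> x \<in> H \<Longrightarrow> x [^] (k::nat) \<in> H"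
  by (induction k) (auto simp: subgroup.one_closed subgroup.m_closed)

lemma pow_card_eq_one:
  assumes H: "subgroup H G" "finite H" and x: "x \<in> H"
  shows "x [^] card H = \<one>"
proof -
  interpret H: group "G\<lparr>carrier := H\<rparr>" using H(1) subgroup_imp_group by blast
  have "x [^]\<^bsub>G\<lparr>carrier := H\<rparr>\<^esub> Coset.order (G\<lparr>carrier := H\<rparr>) = \<one>"
    using H.pow_order_eq_1[of x] x by simp
  then show ?thesis by (simp add: Coset.order_def nat_pow_consistent[symmetric])
qed

lemma eq_one_of_coprime_pows:
  assumes x: "x \<in> carrier G" "x [^] (k::nat) = \<one>" "x [^] (m::nat) = \<one>" "coprime k m"
  shows "x = \<one>"
proof -
  have "ord x dvd k" "ord x dvd m" using x pow_eq_id by auto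
  then have "ord x dvd 1" using x(4) by (metis coprime_common_divisor)
  then show ?thesis using x(1) ord_eq_1 by simp
qed

lemma prime_dvd_ord:
  assumes p: "Factorial_Ring.prime (p::nat)" and x: "x \<in> carrier G" "x \<noteq> \<one>" "x [^] (p ^ k) = \<one>"
  shows "p dvd ord x"
proof -
  have "ord x dvd p ^ k" using x pow_eq_id by auto
  then obtain i where "ord x = p ^ i" using divides_primepow_nat[OF p] by blast
  moreover have "ord x \<noteq> 1" using x ord_eq_1 by blast
  ultimately show ?thesis by (cases i) auto
qed

text \<open>Cauchy's theorem, read off from Sylow's existence theorem with exponent 1, where the
  cofactor \<open>m\<close> may still be divisible by p.\<close>

lemma subgroup_of_prime_order:
  assumes p: "Factorial_Ring.prime (p::nat)" and H: "subgroup H G" "finite H" and dvd: "p dvd card H"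
  obtains x where "x \<in> H" "x \<noteq> \<one>" "x [^] p = \<one>"
proof -
  interpret H: group "G\<lparr>carrier := H\<rparr>" using H(1) subgroup_imp_group by blast
  obtain m where "card H = p * m" using dvd by blast
  then have "Coset.order (G\<lparr>carrier := H\<rparr>) = p ^ 1 * m" by (simp add: Coset.order_def)
  then obtain R where R: "subgroup R (G\<lparr>carrier := H\<rparr>)" "card R = p"
    using sylow_thm[OF p H.is_group, of 1 m] H(2) by auto
  have RH: "R \<subseteq> H" using subgroup.subset[OF R(1)] by simp
  have RG: "subgroup R G" using incl_subgroup[OF H(1) R(1)] .
  have fR: "finite R" using RH H(2) finite_subset by blast
  have "R \<noteq> {\<one>}" using R(2) prime_gt_1_nat[OF p] by auto
  then obtain x where x: "x \<in> R" "x \<noteq> \<one>" using subgroup.one_closed[OF RG] by blast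
  then show ?thesis using that[of x] RH pow_card_eq_one[OF RG fR x(1)] R(2) by auto
qed

text \<open>By Cauchy, a prime q other than p dividing |H| would yield a nontrivial element killed
  both by q and by a power of p.\<close>

lemma card_prime_power:
  assumes p: "Factorial_Ring.prime (p::nat)" and H: "subgroup H G" "finite H"
    and pow: "\<And>x. x \<in> H \<Longrightarrow> \<exists>k. x [^] (p ^ k) = \<one>"
  shows "\<exists>k. card H = p ^ k"
proof -
  have c0: "card H \<noteq> 0" using H(2) subgroup.one_closed[OF H(1)] by auto
  have "q = p" if q: "Factorial_Ring.prime q" "q dvd card H" for q
  proof (rule ccontr)
    assume "q \<noteq> p"
    obtain x where x: "x \<in> H" "x \<noteq> \<one>" "x [^] q = \<one>" using subgroup_of_prime_order[OF q(1) H q(2)] .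
    obtain k where k: "x [^] (p ^ k) = \<one>" using pow x(1) by blast
    have "coprime q (p ^ k)" using primes_coprime[OF q(1) p \<open>q \<noteq> p\<close>] by simp
    then show False
      using eq_one_of_coprime_pows[OF subgroup.mem_carrier[OF H(1) x(1)] x(3) k] x(2) by blast
  qed
  then have "prime_factors (card H) \<subseteq> {p}" by (auto simp: prime_factors_dvd)
  then have "(\<Prod>q\<in>prime_factors (card H). q ^ multiplicity q (card H)) = (\<Prod>q\<in>prime_factors (card H). p ^ multiplicity q (card H))"
    by (intro prod.cong) auto
  moreover have "card H = (\<Prod>q\<in>prime_factors (card H). q ^ multiplicity q (card H))"
    using prime_factorization_nat[of "card H"] c0 by simp
  ultimately have "card H = p ^ (\<Sum>q\<in>prime_factors (card H). multiplicity q (card H))"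
    by (simp add: power_sum)
  then show ?thesis by blast
qed

text \<open>The computation (xN)^j = x^j N carried out with representatives: moving w past x
  conjugates it, and normality keeps the result in N.\<close>

lemma pow_mult_normal:
  assumes N: "N \<lhd> G" and x: "x \<in> carrier G" and v: "v \<in> N"
  shows "\<exists>w\<in>N. (x \<otimes> v) [^] (j::nat) = x [^] j \<otimes> w"
proof (induction j)
  case 0
  have "\<one> \<in> N" using subgroup.one_closed[OF normal_imp_subgroup[OF N]] .
  then show ?case by (intro bexI[of _ \<one>]) simp_all
next
  case (Suc j)
  then obtain w where w: "w \<in> N" "(x \<otimes> v) [^] j = x [^] j \<otimes> w" by blast
  have sN: "subgroup N G" using N normal_imp_subgroup by blast
  have c: "w \<in> carrier G" "v \<in> carrier G" using w(1) v by (simp_all add: subgroup.mem_carrier[OF sN])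
  have "inv x \<otimes> w \<otimes> x \<in> N" using normal_invE(2)[OF N, of "inv x" w] x w by simp
  then have "inv x \<otimes> w \<otimes> x \<otimes> v \<in> N" using subgroup.m_closed[OF sN _ v] by blast
  moreover have "(x \<otimes> v) [^] Suc j = x [^] Suc j \<otimes> (inv x \<otimes> w \<otimes> x \<otimes> v)"
  proof -
    have "x [^] j \<otimes> x \<otimes> (inv x \<otimes> w \<otimes> x \<otimes> v) = x [^] j \<otimes> (x \<otimes> inv x) \<otimes> w \<otimes> x \<otimes> v"
      using x c by (simp only: m_assoc nat_pow_closed m_closed inv_closed)
    also have "\<dots> = (x [^] j \<otimes> w) \<otimes> (x \<otimes> v)" using x c by (simp add: m_assoc)
    finally show ?thesis using w by simp
  qed
  ultimately show ?case by blast
qed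

lemma mult_normal_p_element:
  assumes p: "Factorial_Ring.prime (p::nat)" and N: "N \<lhd> G" "finite N" "card N = p ^ m"
    and x: "x \<in> carrier G" "x [^] (p ^ k) = \<one>" and v: "v \<in> N"
  shows "\<exists>k. (x \<otimes> v) [^] (p ^ k) = \<one>"
proof -
  have sN: "subgroup N G" using N normal_imp_subgroup by blast
  have c: "v \<in> carrier G" by (rule subgroup.mem_carrier[OF sN v])
  obtain w where w: "w \<in> N" "(x \<otimes> v) [^] (p ^ k) = x [^] (p ^ k) \<otimes> w"
    using pow_mult_normal[OF N(1) x(1) v] by blast
  have "w \<in> carrier G" by (rule subgroup.mem_carrier[OF sN w(1)])
  then have "(x \<otimes> v) [^] (p ^ k) = w" using w x by simp
  then have "(x \<otimes> v) [^] (p ^ k * p ^ m) = \<one>"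
    using pow_card_eq_one[OF sN N(2) w(1)] N(3) x c by (simp add: nat_pow_pow[symmetric])
  then show ?thesis by (metis power_add)
qed

lemma normal_set_mult:
  assumes M: "M \<lhd> G" and N: "N \<lhd> G"
  shows "M <#> N \<lhd> G"
proof (rule normal_invI)
  have sM: "subgroup M G" and sN: "subgroup N G" using M N normal_imp_subgroup by auto
  show "subgroup (M <#> N) G" using mult_norm_subgroup[OF M sN] .
  fix g h assume g: "g \<in> carrier G" and "h \<in> M <#> N"
  then obtain a b where ab: "a \<in> M" "b \<in> N" "h = a \<otimes> b" unfolding set_mult_def by blast
  have c: "a \<in> carrier G" "b \<in> carrier G" by (rule subgroup.mem_carrier[OF sM ab(1)], rule subgroup.mem_carrier[OF sN ab(2)])
  have "g \<otimes> h \<otimes> inv g = (g \<otimes> a \<otimes> inv g) \<otimes> (g \<otimes> b \<otimes> inv g)"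
    using g c ab(3) by (simp add: m_assoc) (simp add: m_assoc[symmetric])
  then show "g \<otimes> h \<otimes> inv g \<in> M <#> N"
    using normal_invE(2)[OF M g ab(1)] normal_invE(2)[OF N g ab(2)] unfolding set_mult_def by blast
qed

text \<open>Take a normal p-subgroup M of largest order. For any other one H, the product HM is
  again a normal p-subgroup containing M, so HM = M and H lies in M. Hence the subgroup generated by
  all of them is M.\<close>

lemma O_p_properties:
  assumes p: "Factorial_Ring.prime (p::nat)" and fin: "finite (carrier G)"
  shows "O_p G p \<lhd> G" and "p_subgroup G p (O_p G p)"
    and "\<lbrakk>p_subgroup G p H; H \<lhd> G\<rbrakk> \<Longrightarrow> H \<subseteq> O_p G p"
proof -
  define F where "F = {H. p_subgroup G p H \<and> H \<lhd> G}"
  have sub: "H \<subseteq> O_p G p" if "H \<in> F" for H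
    unfolding O_p_def F_def[symmetric] by (rule subsetI, rule generate.incl) (use that in blast)
  show "H \<subseteq> O_p G p" if "p_subgroup G p H" "H \<lhd> G"
    by (rule sub) (use that in \<open>simp add: F_def\<close>)
  have "{\<one>} \<in> F"
    unfolding F_def p_subgroup_def using one_is_normal triv_subgroup by (auto intro!: exI[of _ 0])
  moreover have "finite F"
  proof (rule finite_subset)
    show "F \<subseteq> Pow (carrier G)" unfolding F_def p_subgroup_def by (auto dest: subgroup.subset)
  qed (use fin in simp)
  ultimately have fin_cards: "finite (card ` F)" "card ` F \<noteq> {}" by auto
  then obtain M where M: "M \<in> F" "card M = Max (card ` F)" using Max_in[OF fin_cards] by (metis imageE)
  have max: "card H \<le> card M" if "H \<in> F" for H
    unfolding M(2) using fin_cards(1) that by (intro Max_ge) auto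
  have nM: "M \<lhd> G" and sM: "subgroup M G" and M': "\<exists>k. card M = p ^ k"
    using M(1) unfolding F_def p_subgroup_def by auto
  have "H \<subseteq> M" if H: "H \<in> F" for H
  proof -
    have nH: "H \<lhd> G" and sH: "subgroup H G" and H': "\<exists>k. card H = p ^ k"
      using H unfolding F_def p_subgroup_def by auto
    have fH: "finite H" and fM: "finite M"
      by (rule finite_subset[OF subgroup.subset[OF sH] fin], rule finite_subset[OF subgroup.subset[OF sM] fin])
    have n: "H <#> M \<lhd> G" by (rule normal_set_mult[OF nH nM])
    then have s: "subgroup (H <#> M) G" by (rule normal_imp_subgroup)
    have f: "finite (H <#> M)" by (rule finite_subset[OF subgroup.subset[OF s] fin])
    have "\<exists>k. card (H <#> M) = p ^ k"
    proof (rule card_prime_power[OF p s f])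
      fix x assume "x \<in> H <#> M"
      then obtain h m where hm: "h \<in> H" "m \<in> M" "x = h \<otimes> m" unfolding set_mult_def by blast
      obtain k i where "card H = p ^ k" "card M = p ^ i" using H' M' by blast
      then show "\<exists>k. x [^] (p ^ k) = \<one>"
        unfolding hm(3) using mult_normal_p_element[OF p nM fM _ _ _ hm(2), of i h k]
          pow_card_eq_one[OF sH fH hm(1)] subgroup.mem_carrier[OF sH hm(1)] by simp
    qed
    then have "H <#> M \<in> F" unfolding F_def p_subgroup_def using n s by simp
    then have "card (H <#> M) \<le> card M" by (rule max)
    moreover have "M \<subseteq> H <#> M"
    proof
      fix m assume m: "m \<in> M"
      have "m = \<one> \<otimes> m" using subgroup.mem_carrier[OF sM m] by simp
      then show "m \<in> H <#> M" unfolding set_mult_def using m subgroup.one_closed[OF sH] by blast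
    qed
    ultimately have eq: "H <#> M = M" using f by (intro card_seteq[symmetric])
    have "H \<subseteq> H <#> M"
    proof
      fix h assume h: "h \<in> H"
      have "h = h \<otimes> \<one>" using subgroup.mem_carrier[OF sH h] by simp
      then show "h \<in> H <#> M" unfolding set_mult_def using h subgroup.one_closed[OF sM] by blast
    qed
    then show ?thesis unfolding eq .
  qed
  then have "\<Union>F \<subseteq> M" by (rule Union_least)
  then have "O_p G p \<subseteq> M" unfolding O_p_def F_def[symmetric] using generate_subgroup_incl[OF _ sM] by simp
  then have "O_p G p = M" using sub[OF M(1)] by blast
  then show "O_p G p \<lhd> G" "p_subgroup G p (O_p G p)" using M(1) unfolding F_def by auto
qed

text \<open>Class equation modulo p. Conjugacy classes have p-power size, and a noncentral element
  has a class with at least two elements. Were the identity the only central element, H without it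
  would be a union of classes of size divisible by p, and p would divide both |H| and |H| -
  1.\<close>

lemma p_group_center_nontrivial:
  assumes p: "Factorial_Ring.prime (p::nat)" and H: "subgroup H G" "finite H" "card H = p ^ m" and nt: "H \<noteq> {\<one>}"
  obtains z where "z \<in> H" "z \<noteq> \<one>" "\<And>h. h \<in> H \<Longrightarrow> h \<otimes> z = z \<otimes> h"
proof -
  interpret H: group "G\<lparr>carrier := H\<rparr>" using H(1) subgroup_imp_group by blast
  have inv: "inv\<^bsub>G\<lparr>carrier := H\<rparr>\<^esub> h = inv h" if "h \<in> H" for h using m_inv_consistent[OF H(1) that] .
  have HG: "h \<in> carrier G" if "h \<in> H" for h using subgroup.mem_carrier[OF H(1) that] .
  define \<phi> where "\<phi> = (\<lambda>g. \<lambda>h\<in>H. g \<otimes> h \<otimes> inv\<^bsub>G\<lparr>carrier := H\<rparr>\<^esub> g)"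
  interpret act: group_action "G\<lparr>carrier := H\<rparr>" H \<phi>
    unfolding \<phi>_def using H.action_by_conjugation by simp
  have orb: "orbit (G\<lparr>carrier := H\<rparr>) \<phi> x = {h \<otimes> x \<otimes> inv h | h. h \<in> H}" if "x \<in> H" for x
  proof -
    have "\<phi> h x = h \<otimes> x \<otimes> inv h" if "h \<in> H" for h
      unfolding \<phi>_def using that \<open>x \<in> H\<close> inv by simp
    then have "(\<lambda>h. \<phi> h x) ` H = (\<lambda>h. h \<otimes> x \<otimes> inv h) ` H" by (rule image_cong[OF refl])
    then show ?thesis unfolding orbit_def by (simp add: Setcompr_eq_image)
  qed
  define \<O> where "\<O> = orbits (G\<lparr>carrier := H\<rparr>) H \<phi>"
  have part: "partition H \<O>" unfolding \<O>_def by (rule act.orbit_partition)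
  have U: "\<Union>\<O> = H"
  proof
    show "\<Union>\<O> \<subseteq> H" using part unfolding partition_def by blast
    show "H \<subseteq> \<Union>\<O>"
    proof
      fix y assume y: "y \<in> H"
      show "y \<in> \<Union>\<O>"
      proof (rule UnionI)
        show "orbit (G\<lparr>carrier := H\<rparr>) \<phi> y \<in> \<O>" unfolding \<O>_def orbits_def using y by blast
        show "y \<in> orbit (G\<lparr>carrier := H\<rparr>) \<phi> y" by (rule act.orbit_refl[OF y])
      qed
    qed
  qed
  have disj: "c1 \<inter> c2 = {}" if c: "c1 \<in> \<O>" "c2 \<in> \<O>" "c1 \<noteq> c2" for c1 c2
  proof (rule ccontr)
    assume "c1 \<inter> c2 \<noteq> {}"
    then obtain y where y: "y \<in> c1" "y \<in> c2" by blast
    then have "y \<in> H" unfolding U[symmetric] using c(1) by (intro UnionI)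
    then have "\<exists>!b. b \<in> \<O> \<and> y \<in> b" using part unfolding partition_def by simp
    then show False using c y by (elim ex1E) metis
  qed
  have one: "\<one> \<in> H" using H(1) subgroup.one_closed by blast
  have o1: "orbit (G\<lparr>carrier := H\<rparr>) \<phi> \<one> = {\<one>}"
  proof -
    have "(\<lambda>h. h \<otimes> \<one> \<otimes> inv h) ` H = (\<lambda>h. \<one>) ` H" by (rule image_cong) (simp_all add: HG)
    also have "\<dots> = {\<one>}" by (rule image_constant[OF one])
    finally show ?thesis unfolding orb[OF one] Setcompr_eq_image .
  qed
  then have in1: "{\<one>} \<in> \<O>" unfolding \<O>_def orbits_def using one by force
  have cH: "p dvd card H"
  proof -
    have "m \<noteq> 0"
    proof
      assume "m = 0"
      then have "card H = Suc 0" using H(3) by simp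
      then obtain y where "H = {y}" unfolding card_1_singleton_iff by blast
      then show False using nt one by simp
    qed
    then show ?thesis using H(3) by simp
  qed
  have "\<exists>z\<in>H. z \<noteq> \<one> \<and> (\<forall>h\<in>H. h \<otimes> z = z \<otimes> h)"
  proof (rule ccontr)
    assume no: "\<not> ?thesis"
    have dvd: "p dvd card c" if c: "c \<in> \<O> - {{\<one>}}" for c
    proof -
      obtain x where x: "x \<in> H" "c = orbit (G\<lparr>carrier := H\<rparr>) \<phi> x" using c unfolding \<O>_def orbits_def by auto
      have "x \<noteq> \<one>"
      proof
        assume "x = \<one>"
        then have "c = {\<one>}" using x(2) o1 by (simp only:)
        then show False using c by (simp only: Diff_iff singleton_iff simp_thms)
      qed
      moreover have "\<not> (x \<noteq> \<one> \<and> (\<forall>h\<in>H. h \<otimes> x = x \<otimes> h))"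
      proof
        assume "x \<noteq> \<one> \<and> (\<forall>h\<in>H. h \<otimes> x = x \<otimes> h)"
        then have "\<exists>z\<in>H. z \<noteq> \<one> \<and> (\<forall>h\<in>H. h \<otimes> z = z \<otimes> h)" by (rule bexI[OF _ x(1)])
        with no show False by (rule notE)
      qed
      ultimately obtain h where h: "h \<in> H" "h \<otimes> x \<noteq> x \<otimes> h" by blast
      have "card c dvd card H"
        unfolding x(2) using act.orbit_stabilizer_theorem[OF x(1)] unfolding Coset.order_def
        by (intro dvdI[of _ _ "card (stabilizer (G\<lparr>carrier := H\<rparr>) \<phi> x)"]) simp
      then obtain i where i: "card c = p ^ i" unfolding H(3) using divides_primepow_nat[OF p] by blast
      have xc: "x \<in> c" unfolding x(2) using act.orbit_refl[OF x(1)] .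
      have yc: "h \<otimes> x \<otimes> inv h \<in> c" unfolding x(2) orb[OF x(1)] using h(1) by blast
      have yx: "h \<otimes> x \<otimes> inv h \<noteq> x"
      proof
        assume "h \<otimes> x \<otimes> inv h = x"
        then have "x \<otimes> h = h \<otimes> x \<otimes> inv h \<otimes> h" by (simp only:)
        also have "\<dots> = h \<otimes> x" using HG[OF h(1)] HG[OF x(1)] by (simp add: m_assoc)
        finally show False using h(2) by simp
      qed
      have "\<not> (\<exists>y. c = {y})"
      proof
        assume "\<exists>y. c = {y}"
        then obtain y where "c = {y}" by (rule exE)
        then show False using xc yc yx by simp
      qed
      then have "card c \<noteq> Suc 0" by (simp only: card_1_singleton_iff not_False_eq_True)
      then have "i \<noteq> 0" using i by (intro notI) simp
      then show ?thesis unfolding i by (intro dvd_power) simp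
    qed
    have "p dvd card (\<Union>(\<O> - {{\<one>}}))"
    proof (rule dvd_partition)
      show "finite (\<Union>(\<O> - {{\<one>}}))"
        by (rule finite_subset[OF _ H(2)]) (unfold U[symmetric], rule Union_mono, rule Diff_subset)
      show "\<forall>c\<in>\<O> - {{\<one>}}. p dvd card c" using dvd by blast
      show "\<forall>c1\<in>\<O> - {{\<one>}}. \<forall>c2\<in>\<O> - {{\<one>}}. c1 \<noteq> c2 \<longrightarrow> c1 \<inter> c2 = {}"
        by (intro ballI impI disj) auto
    qed
    moreover have "\<Union>(\<O> - {{\<one>}}) = H - {\<one>}"
    proof (intro equalityI subsetI)
      fix y assume "y \<in> \<Union>(\<O> - {{\<one>}})"
      then obtain c where c: "y \<in> c" "c \<in> \<O>" "c \<noteq> {\<one>}" by blast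
      then have "y \<noteq> \<one>" using disj[OF in1 c(2)] by auto
      moreover have "y \<in> H" unfolding U[symmetric] using c(1,2) by (intro UnionI)
      ultimately show "y \<in> H - {\<one>}" by simp
    next
      fix y assume y: "y \<in> H - {\<one>}"
      then have "y \<in> \<Union>\<O>" unfolding U by simp
      then obtain c where "y \<in> c" "c \<in> \<O>" by (rule UnionE)
      then show "y \<in> \<Union>(\<O> - {{\<one>}})" using y by (intro UnionI[of c]) auto
    qed
    ultimately have "p dvd card H - 1" by (simp only: card_Diff_singleton[OF one])
    then have "p dvd card H - (card H - 1)" by (rule dvd_diff_nat[OF cH])
    moreover have "card H > 0" using one H(2) card_gt_0_iff by blast
    then have "card H - (card H - 1) = 1" by linarith
    ultimately have "p dvd 1" by (simp only:)
    then show False using prime_gt_1_nat[OF p] by simp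
  qed
  then obtain z where z: "z \<in> H" "z \<noteq> \<one>" "\<forall>h\<in>H. h \<otimes> z = z \<otimes> h" by (elim bexE conjE)
  show ?thesis by (rule that[OF z(1,2)]) (use z(3) in simp)
qed

end

section \<open>Recognising \<open>S\<^sub>4\<close> as a direct factor\<close>

text \<open>A faithful action on an n-set embeds H into the symmetric group, and |H| = n! makes the
  embedding onto. The action is a plain function \<open>f\<close>, constrained only on
  \<open>A\<close>.\<close>

lemma iso_sym_group:
  fixes H :: "('a, 'b) monoid_scheme" and f :: "'a \<Rightarrow> 'c \<Rightarrow> 'c"
  assumes H: "group H" and A: "finite A" "card A = n"
    and closed: "\<And>g a. \<lbrakk>g \<in> carrier H; a \<in> A\<rbrakk> \<Longrightarrow> f g a \<in> A"
    and mult: "\<And>g h a. \<lbrakk>g \<in> carrier H; h \<in> carrier H; a \<in> A\<rbrakk> \<Longrightarrow> f (g \<otimes>\<^bsub>H\<^esub> h) a = f g (f h a)"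
    and one: "\<And>a. a \<in> A \<Longrightarrow> f \<one>\<^bsub>H\<^esub> a = a"
    and faithful: "\<And>g. \<lbrakk>g \<in> carrier H; \<forall>a\<in>A. f g a = a\<rbrakk> \<Longrightarrow> g = \<one>\<^bsub>H\<^esub>"
    and card: "card (carrier H) = fact n"
  shows "H \<cong> sym_group n"
proof -
  interpret group H by (rule H)
  obtain e where e: "bij_betw e {1..n} A" using ex_bij_betw_nat_finite_1[OF A(1)] A(2) by blast
  define d where "d = the_inv_into {1..n} e"
  have ed: "e (d a) = a" "d a \<in> {1..n}" if "a \<in> A" for a
    unfolding d_def using f_the_inv_into_f_bij_betw[OF e] bij_betwE[OF bij_betw_the_inv_into[OF e]] that
    by blast+
  have de: "d (e i) = i" if "i \<in> {1..n}" for i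
    unfolding d_def using the_inv_into_f_f[of e "{1..n}" i] e that by (simp add: bij_betw_def)
  have eA: "e i \<in> A" if "i \<in> {1..n}" for i using bij_betwE[OF e] that by blast
  \<comment> \<open>The action transported along the numbering \<open>e\<close> of \<open>A\<close>;
    outside \<open>{1..n}\<close> it is the identity, as required of elements of
    \<open>sym_group n\<close>.\<close>
  define \<phi> where "\<phi> g = (\<lambda>i. if i \<in> {1..n} then d (f g (e i)) else i)" for g
  have \<phi>_mult: "\<phi> (g \<otimes>\<^bsub>H\<^esub> h) = \<phi> g \<circ> \<phi> h" if gh: "g \<in> carrier H" "h \<in> carrier H" for g h
  proof
    fix i
    show "\<phi> (g \<otimes>\<^bsub>H\<^esub> h) i = (\<phi> g \<circ> \<phi> h) i"
    proof (cases "i \<in> {1..n}")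
      case True
      have fe: "f h (e i) \<in> A" using closed[OF gh(2) eA[OF True]] .
      then show ?thesis
        using True ed[OF fe] mult[OF gh eA[OF True]] unfolding \<phi>_def comp_def by simp
    qed (auto simp: \<phi>_def)
  qed
  have \<phi>_one: "\<phi> \<one>\<^bsub>H\<^esub> = id"
  proof
    fix i show "\<phi> \<one>\<^bsub>H\<^esub> i = id i" unfolding \<phi>_def using one eA de by simp
  qed
  have perm: "\<phi> g permutes {1..n}" if g: "g \<in> carrier H" for g
  proof (rule bij_imp_permutes)
    show "\<phi> g i = i" if "i \<notin> {1..n}" for i using that by (simp only: \<phi>_def if_False)
    have cl: "\<phi> h ` {1..n} \<subseteq> {1..n}" if "h \<in> carrier H" for h
      using ed(2)[OF closed[OF that eA]] by (auto simp: \<phi>_def)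
    have inv: "\<phi> (inv\<^bsub>H\<^esub> g) (\<phi> g i) = i" "\<phi> g (\<phi> (inv\<^bsub>H\<^esub> g) i) = i" for i
    proof -
      have "\<phi> (inv\<^bsub>H\<^esub> g \<otimes>\<^bsub>H\<^esub> g) i = i" "\<phi> (g \<otimes>\<^bsub>H\<^esub> inv\<^bsub>H\<^esub> g) i = i"
        using g \<phi>_one by simp_all
      then show "\<phi> (inv\<^bsub>H\<^esub> g) (\<phi> g i) = i" "\<phi> g (\<phi> (inv\<^bsub>H\<^esub> g) i) = i"
        using \<phi>_mult[OF inv_closed[OF g] g] \<phi>_mult[OF g inv_closed[OF g]] by (simp_all only: comp_apply)
    qed
    show "bij_betw (\<phi> g) {1..n} {1..n}"
      using inv cl[OF g] cl[of "inv\<^bsub>H\<^esub> g"] g by (intro bij_betw_byWitness[of _ "\<phi> (inv\<^bsub>H\<^esub> g)"]) auto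
  qed
  have hom: "\<phi> \<in> hom H (sym_group n)"
    unfolding hom_def sym_group_def using perm \<phi>_mult by auto
  have inj: "inj_on \<phi> (carrier H)"
  proof (rule inj_onI)
    fix g h assume gh: "g \<in> carrier H" "h \<in> carrier H" "\<phi> g = \<phi> h"
    have "\<phi> (inv\<^bsub>H\<^esub> h \<otimes>\<^bsub>H\<^esub> g) = \<phi> (inv\<^bsub>H\<^esub> h) \<circ> \<phi> g" using \<phi>_mult gh by simp
    also have "\<dots> = \<phi> (inv\<^bsub>H\<^esub> h \<otimes>\<^bsub>H\<^esub> h)" unfolding gh(3) using \<phi>_mult[OF inv_closed[OF gh(2)] gh(2)] by (simp only:)
    also have "\<dots> = id" using gh(2) \<phi>_one by simp
    finally have id: "\<phi> (inv\<^bsub>H\<^esub> h \<otimes>\<^bsub>H\<^esub> g) = id" .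
    have u: "inv\<^bsub>H\<^esub> h \<otimes>\<^bsub>H\<^esub> g \<in> carrier H" using gh by simp
    have "f (inv\<^bsub>H\<^esub> h \<otimes>\<^bsub>H\<^esub> g) a = a" if a: "a \<in> A" for a
    proof -
      have "\<phi> (inv\<^bsub>H\<^esub> h \<otimes>\<^bsub>H\<^esub> g) (d a) = d a" unfolding id by simp
      then have "d (f (inv\<^bsub>H\<^esub> h \<otimes>\<^bsub>H\<^esub> g) a) = d a" using ed[OF a] unfolding \<phi>_def by simp
      then have "e (d (f (inv\<^bsub>H\<^esub> h \<otimes>\<^bsub>H\<^esub> g) a)) = e (d a)" by (simp only:)
      then show ?thesis using ed(1)[OF closed[OF u a]] ed(1)[OF a] by (simp only:)
    qed
    then have "inv\<^bsub>H\<^esub> h \<otimes>\<^bsub>H\<^esub> g = \<one>\<^bsub>H\<^esub>" using faithful[OF u] by blast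
    then show "g = h" using gh(1,2) by (metis inv_equality inv_inv inv_closed)
  qed
  have "\<phi> ` carrier H = carrier (sym_group n)"
  proof (rule card_subset_eq)
    show "finite (carrier (sym_group n))" unfolding sym_group_def by (simp add: finite_permutations)
    show "\<phi> ` carrier H \<subseteq> carrier (sym_group n)" using perm by (auto simp: sym_group_def)
    show "card (\<phi> ` carrier H) = card (carrier (sym_group n))"
      using card_image[OF inj] card card_permutations[of "{1..n}" n] by (simp add: sym_group_def)
  qed
  then have "\<phi> \<in> iso H (sym_group n)" using hom inj unfolding iso_def bij_betw_def by blast
  then show ?thesis unfolding is_iso_def by blast
qed

section \<open>From an internal to an external direct product\<close>

context group
begin

lemma iso_DirProd_of_complement:
  fixes K :: "('k, 'm) monoid_scheme"
  assumes M: "subgroup M G" and Z: "subgroup Z G"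
    and comm: "\<And>m z. \<lbrakk>m \<in> M; z \<in> Z\<rbrakk> \<Longrightarrow> m \<otimes> z = z \<otimes> m"
    and triv: "M \<inter> Z = {\<one>}" and cover: "\<And>g. g \<in> carrier G \<Longrightarrow> \<exists>m\<in>M. \<exists>z\<in>Z. g = m \<otimes> z"
    and K: "group K" and iso: "G\<lparr>carrier := M\<rparr> \<cong> K"
  shows "G \<cong> K \<times>\<times> G\<lparr>carrier := Z\<rparr>"
proof -
  interpret K: group K by (rule K)
  interpret M: group "G\<lparr>carrier := M\<rparr>" using M subgroup_imp_group by blast
  interpret Z: group "G\<lparr>carrier := Z\<rparr>" using Z subgroup_imp_group by blast
  have MG: "m \<in> carrier G" if "m \<in> M" for m using subgroup.mem_carrier[OF M that] .
  have ZG: "z \<in> carrier G" if "z \<in> Z" for z using subgroup.mem_carrier[OF Z that] .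
  obtain \<psi> where \<psi>: "\<psi> \<in> iso K (G\<lparr>carrier := M\<rparr>)"
    using M.iso_sym[OF iso] unfolding is_iso_def by blast
  have \<psi>M: "\<psi> k \<in> M" if "k \<in> carrier K" for k using \<psi> that by (auto simp: iso_def hom_def)
  have \<psi>mult: "\<psi> (k \<otimes>\<^bsub>K\<^esub> k') = \<psi> k \<otimes> \<psi> k'" if "k \<in> carrier K" "k' \<in> carrier K" for k k'
    using \<psi> that by (auto simp: iso_def hom_def)
  have \<psi>bij: "bij_betw \<psi> (carrier K) M" using \<psi> by (simp add: iso_def)
  define F where "F = (\<lambda>(k, z). \<psi> k \<otimes> z)"
  have uniq: "m = m' \<and> z = z'" if h: "m \<in> M" "m' \<in> M" "z \<in> Z" "z' \<in> Z" "m \<otimes> z = m' \<otimes> z'" for m m' z z'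
  proof -
    have c: "m \<in> carrier G" "m' \<in> carrier G" "z \<in> carrier G" "z' \<in> carrier G" using h MG ZG by auto
    have "inv m' \<otimes> m = inv m' \<otimes> (m \<otimes> z) \<otimes> inv z" using c by (simp add: m_assoc)
    also have "\<dots> = z' \<otimes> inv z" unfolding h(5) using c by (simp add: m_assoc[symmetric])
    finally have eq: "inv m' \<otimes> m = z' \<otimes> inv z" .
    have "inv m' \<otimes> m \<in> M" using h M by (simp add: subgroup.m_closed subgroup.m_inv_closed)
    moreover have "z' \<otimes> inv z \<in> Z" using h Z by (simp add: subgroup.m_closed subgroup.m_inv_closed)
    ultimately have 1: "inv m' \<otimes> m = \<one>" "z' \<otimes> inv z = \<one>" using triv eq by auto
    have "inv m = inv m'" using inv_equality[OF 1(1)] c by simp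
    then have "m = m'" using c inv_inv by metis
    moreover have "z' = z" using inv_equality[OF 1(2)] c by simp
    ultimately show ?thesis by simp
  qed
  have "F \<in> iso (K \<times>\<times> G\<lparr>carrier := Z\<rparr>) G"
    unfolding iso_def
  proof (intro CollectI conjI)
    show "F \<in> hom (K \<times>\<times> G\<lparr>carrier := Z\<rparr>) G"
    proof (rule homI)
      show "F u \<in> carrier G" if "u \<in> carrier (K \<times>\<times> G\<lparr>carrier := Z\<rparr>)" for u
        using that \<psi>M MG ZG by (auto simp: F_def DirProd_def)
      fix u v assume uv: "u \<in> carrier (K \<times>\<times> G\<lparr>carrier := Z\<rparr>)" "v \<in> carrier (K \<times>\<times> G\<lparr>carrier := Z\<rparr>)"
      obtain k z k' z' where p: "u = (k, z)" "v = (k', z')" by (cases u, cases v)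
      have m: "k \<in> carrier K" "k' \<in> carrier K" "z \<in> Z" "z' \<in> Z" using uv p by (auto simp: DirProd_def)
      have c: "\<psi> k \<in> carrier G" "\<psi> k' \<in> carrier G" "z \<in> carrier G" "z' \<in> carrier G"
        using m \<psi>M MG ZG by auto
      have "F (u \<otimes>\<^bsub>K \<times>\<times> G\<lparr>carrier := Z\<rparr>\<^esub> v) = \<psi> k \<otimes> (\<psi> k' \<otimes> z) \<otimes> z'"
        using p m \<psi>mult c by (simp add: F_def m_assoc)
      also have "\<psi> k' \<otimes> z = z \<otimes> \<psi> k'" using comm \<psi>M m by blast
      also have "\<psi> k \<otimes> (z \<otimes> \<psi> k') \<otimes> z' = F u \<otimes> F v" using p c by (simp add: F_def m_assoc)
      finally show "F (u \<otimes>\<^bsub>K \<times>\<times> G\<lparr>carrier := Z\<rparr>\<^esub> v) = F u \<otimes> F v" .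
    qed
    show "bij_betw F (carrier (K \<times>\<times> G\<lparr>carrier := Z\<rparr>)) (carrier G)"
      unfolding bij_betw_def
    proof
      show "inj_on F (carrier (K \<times>\<times> G\<lparr>carrier := Z\<rparr>))"
      proof (rule inj_onI)
        fix u v assume uv: "u \<in> carrier (K \<times>\<times> G\<lparr>carrier := Z\<rparr>)" "v \<in> carrier (K \<times>\<times> G\<lparr>carrier := Z\<rparr>)"
          and eq: "F u = F v"
        obtain k z k' z' where p: "u = (k, z)" "v = (k', z')" by (cases u, cases v)
        have m: "k \<in> carrier K" "k' \<in> carrier K" "z \<in> Z" "z' \<in> Z" using uv p by (auto simp: DirProd_def)
        have "\<psi> k = \<psi> k' \<and> z = z'" using uniq[OF \<psi>M[OF m(1)] \<psi>M[OF m(2)] m(3,4)] eq p by (simp add: F_def)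
        moreover have "inj_on \<psi> (carrier K)" using \<psi>bij by (rule bij_betw_imp_inj_on)
        ultimately show "u = v" using p m inj_onD by fastforce
      qed
      show "F ` carrier (K \<times>\<times> G\<lparr>carrier := Z\<rparr>) = carrier G"
      proof
        show "F ` carrier (K \<times>\<times> G\<lparr>carrier := Z\<rparr>) \<subseteq> carrier G"
          using \<psi>M MG ZG by (auto simp: F_def DirProd_def)
        show "carrier G \<subseteq> F ` carrier (K \<times>\<times> G\<lparr>carrier := Z\<rparr>)"
        proof
          fix g assume "g \<in> carrier G"
          then obtain m z where mz: "m \<in> M" "z \<in> Z" "g = m \<otimes> z" using cover by blast
          have "m \<in> \<psi> ` carrier K" using mz(1) bij_betw_imp_surj_on[OF \<psi>bij] by simp
          then obtain k where k: "k \<in> carrier K" "m = \<psi> k" by blast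
          have "g = F (k, z)" unfolding mz(3) k(2) by (simp add: F_def)
          moreover have "(k, z) \<in> carrier (K \<times>\<times> G\<lparr>carrier := Z\<rparr>)" using k(1) mz(2) by (simp add: DirProd_def)
          ultimately show "g \<in> F ` carrier (K \<times>\<times> G\<lparr>carrier := Z\<rparr>)" by (rule image_eqI)
        qed
      qed
    qed
  qed
  then have "K \<times>\<times> G\<lparr>carrier := Z\<rparr> \<cong> G" unfolding is_iso_def by blast
  then show ?thesis using group.iso_sym[OF DirProd_group[OF K Z.is_group]] by blast
qed

end

section \<open>Conjugation, and the semidirect product of a Klein four-group with S_3\<close>

definition (in group) cj :: "'a \<Rightarrow> 'a \<Rightarrow> 'a" where
  "cj g v = g \<otimes> v \<otimes> inv g"

context group
begin

lemma cj_closed: "\<lbrakk>g \<in> carrier G; v \<in> carrier G\<rbrakk> \<Longrightarrow> cj g v \<in> carrier G"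
  by (simp add: cj_def)

lemma cj_mult: "\<lbrakk>g \<in> carrier G; h \<in> carrier G; v \<in> carrier G\<rbrakk> \<Longrightarrow> cj (g \<otimes> h) v = cj g (cj h v)"
  by (simp add: cj_def m_assoc inv_mult_group)

lemma cj_distrib: "\<lbrakk>g \<in> carrier G; v \<in> carrier G; w \<in> carrier G\<rbrakk> \<Longrightarrow> cj g (v \<otimes> w) = cj g v \<otimes> cj g w"
  unfolding cj_def by (simp add: m_assoc) (simp add: m_assoc[symmetric])

lemma cj_one: "v \<in> carrier G \<Longrightarrow> cj \<one> v = v"
  by (simp add: cj_def)

lemma cj_one_right: "g \<in> carrier G \<Longrightarrow> cj g \<one> = \<one>"
  by (simp add: cj_def)

lemma cj_inv: "\<lbrakk>g \<in> carrier G; v \<in> carrier G; cj g v = w\<rbrakk> \<Longrightarrow> cj (inv g) w = v"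
  using cj_mult[of "inv g" g v] by (simp add: cj_one)

lemma cj_eq_self_iff: "\<lbrakk>g \<in> carrier G; v \<in> carrier G\<rbrakk> \<Longrightarrow> cj g v = v \<longleftrightarrow> g \<otimes> v = v \<otimes> g"
  unfolding cj_def using inv_solve_right[of v "g \<otimes> v" g] by auto

lemma cj_inject: "\<lbrakk>g \<in> carrier G; v \<in> carrier G; w \<in> carrier G; cj g v = cj g w\<rbrakk> \<Longrightarrow> v = w"
  by (metis cj_inv)

end

text \<open>Coordinates for S_4 times Z: \<open>A\<close> is a Klein four-group, \<open>t\<close>
  acts on it as the transposition of b and c, \<open>k\<close> as the 3-cycle a, b, c. The relations
  of S_3 are required in G itself and not only modulo C_G(A), so that \<open>t\<close> and
  \<open>k\<close> generate a complement of \<open>A\<close>; \<open>fixing\<close> says that C_G(A)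
  is the product of \<open>A\<close> and \<open>Z\<close>.\<close>

locale klein_frame = group G for G (structure) +
  fixes A Z a b c t k
  assumes normal_A: "A \<lhd> G" and A_eq: "A = {\<one>, a, b, c}"
    and ne: "a \<noteq> \<one>" "b \<noteq> \<one>" "c \<noteq> \<one>" "a \<noteq> b" "a \<noteq> c" "b \<noteq> c"
    and ab: "a \<otimes> b = c"
    and comm: "\<And>v w. \<lbrakk>v \<in> A; w \<in> A\<rbrakk> \<Longrightarrow> v \<otimes> w = w \<otimes> v"
    and subgroup_Z: "subgroup Z G" and central: "\<And>z g. \<lbrakk>z \<in> Z; g \<in> carrier G\<rbrakk> \<Longrightarrow> z \<otimes> g = g \<otimes> z"
    and A_inter_Z: "A \<inter> Z = {\<one>}"
    and fixing: "\<And>g. \<lbrakk>g \<in> carrier G; \<And>v. v \<in> A \<Longrightarrow> cj g v = v\<rbrakk> \<Longrightarrow> \<exists>v\<in>A. \<exists>z\<in>Z. g = v \<otimes> z"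
    and tG: "t \<in> carrier G" and kG: "k \<in> carrier G"
    and tt: "t \<otimes> t = \<one>" and kkk: "k \<otimes> k \<otimes> k = \<one>" and tk: "t \<otimes> k = k \<otimes> k \<otimes> t"
    and cj_t: "cj t a = a" "cj t b = c" "cj t c = b"
    and cj_k: "cj k a = b" "cj k b = c" "cj k c = a"
begin

lemma subgroup_A: "subgroup A G"
  using normal_A by (rule normal_imp_subgroup)

lemma AG: "v \<in> A \<Longrightarrow> v \<in> carrier G"
  using subgroup_A by (rule subgroup.mem_carrier)

lemma abc: "a \<in> A" "b \<in> A" "c \<in> A" "a \<in> carrier G" "b \<in> carrier G" "c \<in> carrier G"
proof -
  show 1: "a \<in> A" "b \<in> A" "c \<in> A" unfolding A_eq by simp_all
  show "a \<in> carrier G" "b \<in> carrier G" "c \<in> carrier G" using AG 1 by blast+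
qed

lemma cj_A: "\<lbrakk>g \<in> carrier G; v \<in> A\<rbrakk> \<Longrightarrow> cj g v \<in> A"
  unfolding cj_def by (rule normal_invE(2)[OF normal_A])

lemma cj_by_A: "\<lbrakk>v \<in> A; w \<in> A\<rbrakk> \<Longrightarrow> cj v w = w"
  using cj_eq_self_iff[OF AG AG] comm by blast

text \<open>The subgroup generated by \<open>k\<close> and \<open>t\<close>, a copy of S_3, in the
  normal form given by \<open>tk\<close>. Unbounded exponents avoid reductions modulo 3 and 2 when
  elements are multiplied.\<close>

definition S :: "'a set" where
  "S = {k [^] (i::nat) \<otimes> t [^] (j::nat) | i j. True}"

lemma S_six: "S \<subseteq> {\<one>, k, k \<otimes> k, t, k \<otimes> t, k \<otimes> k \<otimes> t}"
proof
  fix s assume "s \<in> S"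
  then obtain i j :: nat where s: "s = k [^] i \<otimes> t [^] j" unfolding S_def by blast
  have k3: "k [^] i \<in> {\<one>, k, k \<otimes> k}"
  proof (induction i)
    case (Suc i)
    then consider "k [^] i = \<one>" | "k [^] i = k" | "k [^] i = k \<otimes> k" by blast
    then show ?case using kG kkk by cases simp_all
  qed simp
  have t2: "t [^] j \<in> {\<one>, t}"
  proof (induction j)
    case (Suc j)
    then consider "t [^] j = \<one>" | "t [^] j = t" by blast
    then show ?case using tG tt by cases simp_all
  qed simp
  show "s \<in> {\<one>, k, k \<otimes> k, t, k \<otimes> t, k \<otimes> k \<otimes> t}"
    using k3 t2 kG tG unfolding s by auto
qed

lemma S_members: "\<one> \<in> S" "k \<in> S" "k \<otimes> k \<in> S" "t \<in> S" "k \<otimes> t \<in> S" "k \<otimes> k \<otimes> t \<in> S"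
proof -
  have p: "k [^] (i::nat) \<otimes> t [^] (j::nat) \<in> S" for i j unfolding S_def by blast
  have k2: "k [^] (2::nat) = k \<otimes> k" using kG by (simp add: numeral_2_eq_2)
  show "\<one> \<in> S" using p[of 0 0] by simp
  show "k \<in> S" using p[of 1 0] kG by simp
  show "k \<otimes> k \<in> S" using p[of 2 0] kG k2 by simp
  show "t \<in> S" using p[of 0 1] tG by simp
  show "k \<otimes> t \<in> S" using p[of 1 1] kG tG by simp
  show "k \<otimes> k \<otimes> t \<in> S" using p[of 2 1] kG tG k2 by simp
qed

lemma SG: "s \<in> S \<Longrightarrow> s \<in> carrier G"
  unfolding S_def using kG tG by auto

text \<open>Moving one \<open>t\<close> past a power of \<open>k\<close> doubles the exponent, since
  \<open>t\<close> conjugates \<open>k\<close> to its square. Using the square in place of the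
  inverse keeps all exponents natural.\<close>

lemma t_pow_k_pow: "t [^] (j::nat) \<otimes> k [^] (i::nat) = k [^] (2 ^ j * i) \<otimes> t [^] j"
proof -
  have t1: "t \<otimes> k [^] (i::nat) = k [^] (2 * i) \<otimes> t" for i
  proof (induction i)
    case 0
    then show ?case using tG by simp
  next
    case (Suc i)
    have "t \<otimes> k [^] Suc i = (t \<otimes> k [^] i) \<otimes> k" using tG kG by (simp add: m_assoc)
    also have "\<dots> = k [^] (2 * i) \<otimes> (t \<otimes> k)" unfolding Suc using tG kG by (simp add: m_assoc)
    also have "\<dots> = k [^] (2 * i) \<otimes> k \<otimes> k \<otimes> t" unfolding tk using tG kG by (simp add: m_assoc)
    finally show ?case by simp
  qed
  show ?thesis
  proof (induction j arbitrary: i)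
    case 0
    then show ?case using kG by simp
  next
    case (Suc j)
    have "t [^] Suc j \<otimes> k [^] i = t [^] j \<otimes> (t \<otimes> k [^] i)" using tG kG by (simp add: m_assoc)
    also have "\<dots> = (t [^] j \<otimes> k [^] (2 * i)) \<otimes> t" unfolding t1 using tG kG by (simp add: m_assoc)
    also have "\<dots> = k [^] (2 ^ j * (2 * i)) \<otimes> t [^] Suc j" unfolding Suc using tG kG by (simp add: m_assoc)
    finally show ?case by (simp add: mult_ac)
  qed
qed

lemma S_mult: "\<lbrakk>s \<in> S; s' \<in> S\<rbrakk> \<Longrightarrow> s \<otimes> s' \<in> S"
proof -
  assume "s \<in> S" "s' \<in> S"
  then obtain i j i' j' :: nat where s: "s = k [^] i \<otimes> t [^] j" "s' = k [^] i' \<otimes> t [^] j'"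
    unfolding S_def by blast
  have "s \<otimes> s' = k [^] i \<otimes> (t [^] j \<otimes> k [^] i') \<otimes> t [^] j'"
    unfolding s using kG tG by (simp add: m_assoc)
  also have "\<dots> = (k [^] i \<otimes> k [^] (2 ^ j * i')) \<otimes> (t [^] j \<otimes> t [^] j')"
    unfolding t_pow_k_pow using kG tG by (simp add: m_assoc)
  also have "\<dots> = k [^] (i + 2 ^ j * i') \<otimes> t [^] (j + j')"
    using kG tG by (simp add: nat_pow_mult)
  finally show ?thesis unfolding S_def by blast
qed

lemma S_inv: "s \<in> S \<Longrightarrow> inv s \<in> S"
proof -
  assume "s \<in> S"
  then obtain i j :: nat where s: "s = k [^] i \<otimes> t [^] j" unfolding S_def by blast
  have kt: "k [^] i \<otimes> t [^] j \<in> S" for i j :: nat unfolding S_def by blast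
  have pk: "k [^] m \<in> S" for m :: nat using kt[of m 0] kG by simp
  have pt: "t [^] m \<in> S" for m :: nat using kt[of 0 m] tG by simp
  have ik: "inv k = k [^] (2::nat)" using inv_equality[of "k \<otimes> k" k] kkk kG by (simp add: numeral_2_eq_2)
  have it: "inv t = t" using inv_equality[of t t] tt tG by simp
  have "inv s = inv t [^] j \<otimes> inv k [^] i"
    unfolding s using kG tG by (simp add: inv_mult_group nat_pow_inv)
  also have "\<dots> = t [^] j \<otimes> k [^] (2 * i)" unfolding ik it using kG by (simp add: nat_pow_pow)
  finally show ?thesis using S_mult pk pt by simp
qed

lemma subgroup_S: "subgroup S G"
  by (rule subgroupI) (use SG S_members S_inv S_mult in auto)

lemma S_faithful:
  assumes s: "s \<in> S" and fixes_A: "\<And>v. v \<in> A \<Longrightarrow> cj s v = v"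
  shows "s = \<one>"
proof -
  have kk: "cj (k \<otimes> k) a = c" using cj_mult[OF kG kG abc(4)] cj_k by simp
  have kt: "cj (k \<otimes> t) a = b" using cj_mult[OF kG tG abc(4)] cj_k cj_t by simp
  have kkt: "cj (k \<otimes> k \<otimes> t) a = c" using cj_mult[OF m_closed[OF kG kG] tG abc(4)] kk cj_t by simp
  have fa: "cj s a = a" and fb: "cj s b = b" using fixes_A abc by auto
  have "s \<noteq> k" "s \<noteq> k \<otimes> k" "s \<noteq> k \<otimes> t" "s \<noteq> k \<otimes> k \<otimes> t"
    using fa cj_k kk kt kkt ne by auto
  moreover have "s \<noteq> t" using fb cj_t ne by auto
  ultimately show ?thesis using S_six s by blast
qed

lemma A_inter_S: "\<lbrakk>v \<in> A; v \<in> S\<rbrakk> \<Longrightarrow> v = \<one>"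
  using S_faithful cj_by_A by blast

text \<open>The normal form leaves at most six elements. They are distinct because they send the
  pair (a,b) to the six ordered pairs of distinct elements among a, b, c.\<close>

lemma card_S: "card S = 6"
proof (rule antisym)
  have "card S \<le> card {\<one>, k, k \<otimes> k, t, k \<otimes> t, k \<otimes> k \<otimes> t}" by (rule card_mono[OF _ S_six]) simp
  also have "\<dots> \<le> 6"
    using card_length[of "[\<one>, k, k \<otimes> k, t, k \<otimes> t, k \<otimes> k \<otimes> t]"] by simp
  finally show "card S \<le> 6" .
  define p where "p s = (cj s a, cj s b)" for s
  have kkG: "k \<otimes> k \<in> carrier G" using kG by simp
  have "p \<one> = (a, b)" using abc by (simp add: p_def cj_one)
  then have 1: "(a, b) \<in> p ` S" by (rule image_eqI[OF sym S_members(1)])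
  have "p k = (b, c)" by (simp add: p_def cj_k)
  then have 2: "(b, c) \<in> p ` S" by (rule image_eqI[OF sym S_members(2)])
  have "p (k \<otimes> k) = (c, a)" using abc by (simp add: p_def cj_mult[OF kG kG] cj_k)
  then have 3: "(c, a) \<in> p ` S" by (rule image_eqI[OF sym S_members(3)])
  have "p t = (a, c)" by (simp add: p_def cj_t)
  then have 4: "(a, c) \<in> p ` S" by (rule image_eqI[OF sym S_members(4)])
  have "p (k \<otimes> t) = (b, a)" using abc by (simp add: p_def cj_mult[OF kG tG] cj_k cj_t)
  then have 5: "(b, a) \<in> p ` S" by (rule image_eqI[OF sym S_members(5)])
  have "p (k \<otimes> k \<otimes> t) = (c, b)"
    using abc by (simp add: p_def cj_mult[OF kkG tG] cj_mult[OF kG kG] cj_k cj_t)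
  then have 6: "(c, b) \<in> p ` S" by (rule image_eqI[OF sym S_members(6)])
  have "{(a,b), (b,c), (c,a), (a,c), (b,a), (c,b)} \<subseteq> p ` S"
    by (simp only: insert_subset 1 2 3 4 5 6 empty_subsetI simp_thms)
  moreover have fin: "finite S" using S_six by (rule finite_subset) simp
  ultimately have "card {(a,b), (b,c), (c,a), (a,c), (b,a), (c,b)} \<le> card (p ` S)"
    by (intro card_mono) auto
  also have "\<dots> \<le> card S" by (rule card_image_le[OF fin])
  finally show "6 \<le> card S" using ne by (simp add: card_insert_if)
qed

text \<open>Conjugation by g sends (a,b) to one of the six ordered pairs of distinct nonidentity
  elements of \<open>A\<close>, and each pair is reached from \<open>S\<close>. In other words,
  \<open>S\<close> maps onto the full automorphism group of \<open>A\<close>.\<close>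

lemma S_realizes:
  assumes g: "g \<in> carrier G"
  shows "\<exists>s\<in>S. cj s a = cj g a \<and> cj s b = cj g b"
proof -
  have kkG: "k \<otimes> k \<in> carrier G" using kG by simp
  have "cj g a \<noteq> \<one>" "cj g b \<noteq> \<one>" "cj g a \<noteq> cj g b"
    using cj_inject[OF g, of a \<one>] cj_inject[OF g, of b \<one>] cj_inject[OF g, of a b] abc ne cj_one_right[OF g]
    by auto
  then have "(cj g a, cj g b) \<in> {(a,b), (b,c), (c,a), (a,c), (b,a), (c,b)}"
    using cj_A[OF g abc(1)] cj_A[OF g abc(2)] unfolding A_eq by auto
  then consider "cj g a = a" "cj g b = b" | "cj g a = b" "cj g b = c" | "cj g a = c" "cj g b = a"
    | "cj g a = a" "cj g b = c" | "cj g a = b" "cj g b = a" | "cj g a = c" "cj g b = b"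
    by auto
  then show ?thesis
  proof cases
    case 1 then show ?thesis using S_members(1) abc by (intro bexI[of _ \<one>]) (simp_all add: cj_one)
  next
    case 2 then show ?thesis using S_members(2) by (intro bexI[of _ k]) (simp_all add: cj_k)
  next
    case 3 then show ?thesis using S_members(3) abc
      by (intro bexI[of _ "k \<otimes> k"]) (simp_all add: cj_mult[OF kG kG] cj_k)
  next
    case 4 then show ?thesis using S_members(4) by (intro bexI[of _ t]) (simp_all add: cj_t)
  next
    case 5 then show ?thesis using S_members(5) abc
      by (intro bexI[of _ "k \<otimes> t"]) (simp_all add: cj_mult[OF kG tG] cj_k cj_t)
  next
    case 6 then show ?thesis using S_members(6) abc
      by (intro bexI[of _ "k \<otimes> k \<otimes> t"]) (simp_all add: cj_mult[OF kkG tG] cj_mult[OF kG kG] cj_k cj_t)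
  qed
qed

definition M :: "'a set" where
  "M = A <#> S"

lemma subgroup_M: "subgroup M G"
  unfolding M_def by (rule mult_norm_subgroup[OF normal_A subgroup_S])

lemma MG: "m \<in> M \<Longrightarrow> m \<in> carrier G"
  using subgroup_M by (rule subgroup.mem_carrier)

lemma M_E: "m \<in> M \<Longrightarrow> \<exists>v\<in>A. \<exists>s\<in>S. m = v \<otimes> s"
  unfolding M_def set_mult_def by blast

lemma M_I: "\<lbrakk>v \<in> A; s \<in> S\<rbrakk> \<Longrightarrow> v \<otimes> s \<in> M"
  unfolding M_def set_mult_def by blast

lemma A_M: "v \<in> A \<Longrightarrow> v \<in> M"
  using M_I[OF _ S_members(1), of v] AG[of v] by simp

lemma S_M: "s \<in> S \<Longrightarrow> s \<in> M"
  using M_I[OF subgroup.one_closed[OF subgroup_A], of s] SG[of s] by simp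

lemma A_S_unique:
  assumes "v \<in> A" "v' \<in> A" "s \<in> S" "s' \<in> S" "v \<otimes> s = v' \<otimes> s'"
  shows "v = v'" and "s = s'"
proof -
  have g: "v \<in> carrier G" "v' \<in> carrier G" "s \<in> carrier G" "s' \<in> carrier G" using assms AG SG by auto
  have "inv v' \<otimes> v = inv v' \<otimes> (v \<otimes> s) \<otimes> inv s" using g by (simp add: m_assoc)
  also have "\<dots> = s' \<otimes> inv s" unfolding assms(5) using g by (simp add: m_assoc[symmetric])
  finally have eq: "inv v' \<otimes> v = s' \<otimes> inv s" .
  have "inv v' \<otimes> v \<in> A" using assms subgroup_A by (simp add: subgroup.m_closed subgroup.m_inv_closed)
  moreover have "inv v' \<otimes> v \<in> S" unfolding eq using assms S_mult S_inv by simp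
  ultimately have 1: "inv v' \<otimes> v = \<one>" by (rule A_inter_S)
  have "inv v = inv v'" using inv_equality[OF 1] g by simp
  then show v: "v = v'" using g inv_inv by metis
  have "v \<otimes> s = v \<otimes> s'" using assms(5) unfolding v .
  then show "s = s'" using g l_cancel by metis
qed

lemma card_M: "card M = 24"
proof -
  have "bij_betw (\<lambda>(v, s). v \<otimes> s) (A \<times> S) M"
    unfolding bij_betw_def
  proof
    show "inj_on (\<lambda>(v, s). v \<otimes> s) (A \<times> S)"
    proof (rule inj_onI)
      fix x y assume x: "x \<in> A \<times> S" and y: "y \<in> A \<times> S"
        and eq: "(\<lambda>(v, s). v \<otimes> s) x = (\<lambda>(v, s). v \<otimes> s) y"
      obtain v s v' s' where p: "x = (v, s)" "y = (v', s')" by (cases x, cases y)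
      have m: "v \<in> A" "v' \<in> A" "s \<in> S" "s' \<in> S" "v \<otimes> s = v' \<otimes> s'" using x y eq p by simp_all
      show "x = y" unfolding p using A_S_unique(1)[OF m] A_S_unique(2)[OF m] by simp
    qed
    show "(\<lambda>(v, s). v \<otimes> s) ` (A \<times> S) = M"
      unfolding M_def set_mult_def by auto
  qed
  then have "card M = card (A \<times> S)" by (rule bij_betw_same_card[symmetric])
  also have "card A = 4" unfolding A_eq using ne by (simp add: card_insert_if)
  then have "card (A \<times> S) = 24" by (simp add: card_cartesian_product card_S)
  finally show ?thesis .
qed

text \<open>Write the element as v s. Being central it acts trivially on \<open>A\<close>, and so
  does v, hence s does too and s = 1. What remains lies in both \<open>A\<close> and
  \<open>Z\<close>.\<close>

lemma M_inter_Z: "M \<inter> Z = {\<one>}"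
proof -
  have "m = \<one>" if m: "m \<in> M" "m \<in> Z" for m
  proof -
    obtain v s where vs: "v \<in> A" "s \<in> S" "m = v \<otimes> s" using M_E[OF m(1)] by blast
    have "cj s w = w" if w: "w \<in> A" for w
    proof -
      have "cj m w = w" using cj_eq_self_iff[OF MG[OF m(1)] AG[OF w]] central[OF m(2) AG[OF w]] by simp
      moreover have "cj m w = cj v (cj s w)" unfolding vs(3) by (rule cj_mult[OF AG[OF vs(1)] SG[OF vs(2)] AG[OF w]])
      ultimately show ?thesis using cj_by_A[OF vs(1) cj_A[OF SG[OF vs(2)] w]] by simp
    qed
    then have "s = \<one>" using S_faithful[OF vs(2)] by blast
    then have "m = v" using vs AG by simp
    then show ?thesis using A_inter_Z vs(1) m(2) by blast
  qed
  moreover have "\<one> \<in> M" "\<one> \<in> Z" using subgroup_M subgroup_Z by (simp_all add: subgroup.one_closed)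
  ultimately show ?thesis by blast
qed

text \<open>Choose s in \<open>S\<close> inducing the same automorphism of \<open>A\<close> as g.
  Then s^-1 g centralises \<open>A\<close>, so it is a product v z, and s v is the required element
  of \<open>M\<close>.\<close>

lemma M_Z_cover:
  assumes g: "g \<in> carrier G"
  shows "\<exists>m\<in>M. \<exists>z\<in>Z. g = m \<otimes> z"
proof -
  obtain s where s: "s \<in> S" "cj s a = cj g a" "cj s b = cj g b" using S_realizes[OF g] by blast
  have sG: "s \<in> carrier G" using SG[OF s(1)] .
  have eq: "cj s v = cj g v" if "v \<in> A" for v
  proof -
    have "cj s c = cj g c" unfolding ab[symmetric] using s g sG abc by (simp add: cj_distrib)
    moreover have "cj s \<one> = cj g \<one>" using g sG by (simp add: cj_one_right)
    ultimately show ?thesis using that s(2,3) unfolding A_eq by auto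
  qed
  have "cj (inv s \<otimes> g) v = v" if v: "v \<in> A" for v
    using cj_mult[of "inv s" g v] cj_inv[OF sG AG[OF v] eq[OF v]] g sG AG[OF v] by simp
  then obtain v z where vz: "v \<in> A" "z \<in> Z" "inv s \<otimes> g = v \<otimes> z"
    using fixing[of "inv s \<otimes> g"] g sG by auto
  have zG: "z \<in> carrier G" using vz(2) subgroup_Z by (rule subgroup.mem_carrier[rotated])
  have "g = s \<otimes> (inv s \<otimes> g)" using g sG by (simp add: m_assoc[symmetric])
  also have "\<dots> = (s \<otimes> v) \<otimes> z" unfolding vz(3) using sG zG AG[OF vz(1)] by (simp add: m_assoc)
  finally have "g = (s \<otimes> v) \<otimes> z" .
  moreover have "s \<otimes> v \<in> M" using S_M[OF s(1)] A_M[OF vz(1)] subgroup_M by (simp add: subgroup.m_closed)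
  ultimately show ?thesis using vz(2) by blast
qed

text \<open>\<open>M\<close> acts on the cosets of \<open>S\<close>, and each coset contains exactly one element of \<open>A\<close>.\<close>

definition aff :: "'a \<Rightarrow> 'a \<Rightarrow> 'a" where
  "aff m w = (THE v. v \<in> A \<and> inv v \<otimes> (m \<otimes> w) \<in> S)"

lemma aff_unique:
  assumes m: "m \<in> M" and w: "w \<in> A" and v: "v \<in> A" "inv v \<otimes> (m \<otimes> w) \<in> S"
  shows "aff m w = v"
  unfolding aff_def
proof (rule the_equality)
  fix v' assume v': "v' \<in> A \<and> inv v' \<otimes> (m \<otimes> w) \<in> S"
  have g: "m \<otimes> w \<in> carrier G" "v \<in> carrier G" "v' \<in> carrier G" using MG[OF m] AG w v v' by auto
  have "v' \<otimes> (inv v' \<otimes> (m \<otimes> w)) = v \<otimes> (inv v \<otimes> (m \<otimes> w))"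
    using g by (simp add: m_assoc[symmetric])
  then show "v' = v" using A_S_unique(1)[OF conjunct1[OF v'] v(1) conjunct2[OF v'] v(2)] by simp
qed (use v in simp)

lemma aff:
  assumes m: "m \<in> M" and w: "w \<in> A"
  shows "aff m w \<in> A" and "inv (aff m w) \<otimes> (m \<otimes> w) \<in> S"
proof -
  have "m \<otimes> w \<in> M" using m A_M[OF w] subgroup_M by (simp add: subgroup.m_closed)
  then obtain v s where vs: "v \<in> A" "s \<in> S" "m \<otimes> w = v \<otimes> s" using M_E by blast
  have "inv v \<otimes> (m \<otimes> w) = s" unfolding vs(3) using AG[OF vs(1)] SG[OF vs(2)] by (simp add: m_assoc[symmetric])
  then have "inv v \<otimes> (m \<otimes> w) \<in> S" using vs(2) by simp
  moreover from this have "aff m w = v" by (rule aff_unique[OF m w vs(1)])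
  ultimately show "aff m w \<in> A" "inv (aff m w) \<otimes> (m \<otimes> w) \<in> S" using vs(1) by simp_all
qed

lemma M_iso_sym_group: "G\<lparr>carrier := M\<rparr> \<cong> sym_group 4"
proof (rule iso_sym_group[where A = A and f = aff])
  show "group (G\<lparr>carrier := M\<rparr>)" using subgroup_M subgroup_imp_group by blast
  show "finite A" "card A = 4" unfolding A_eq using ne by (simp_all add: card_insert_if)
  show "aff g v \<in> A" if "g \<in> carrier (G\<lparr>carrier := M\<rparr>)" "v \<in> A" for g v using that aff(1) by simp
  show "aff \<one>\<^bsub>G\<lparr>carrier := M\<rparr>\<^esub> v = v" if v: "v \<in> A" for v
    using aff_unique[OF subgroup.one_closed[OF subgroup_M] v v] AG[OF v] S_members(1) by simp
  show "card (carrier (G\<lparr>carrier := M\<rparr>)) = fact 4" using card_M by (simp add: fact_numeral)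
  show "aff (g \<otimes>\<^bsub>G\<lparr>carrier := M\<rparr>\<^esub> h) w = aff g (aff h w)"
    if gh: "g \<in> carrier (G\<lparr>carrier := M\<rparr>)" "h \<in> carrier (G\<lparr>carrier := M\<rparr>)" and w: "w \<in> A" for g h w
  proof -
    have gM: "g \<in> M" and hM: "h \<in> M" using gh by simp_all
    define u where "u = aff h w"
    define v where "v = aff g u"
    have u: "u \<in> A" "inv u \<otimes> (h \<otimes> w) \<in> S" unfolding u_def using aff[OF hM w] .
    have v: "v \<in> A" "inv v \<otimes> (g \<otimes> u) \<in> S" unfolding v_def using aff[OF gM u(1)] .
    have c: "g \<in> carrier G" "h \<in> carrier G" "u \<in> carrier G" "v \<in> carrier G" "w \<in> carrier G"
      using MG[OF gM] MG[OF hM] AG u v w by auto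
    have "inv v \<otimes> ((g \<otimes> h) \<otimes> w) = (inv v \<otimes> (g \<otimes> u)) \<otimes> (inv u \<otimes> (h \<otimes> w))"
    proof -
      have "u \<otimes> (inv u \<otimes> (h \<otimes> w)) = h \<otimes> w" using c by (simp add: m_assoc[symmetric])
      then show ?thesis using c by (simp add: m_assoc)
    qed
    then have "inv v \<otimes> ((g \<otimes> h) \<otimes> w) \<in> S" using S_mult[OF v(2) u(2)] by simp
    then have "aff (g \<otimes> h) w = v"
      using aff_unique[OF _ w v(1)] subgroup.m_closed[OF subgroup_M gM hM] by blast
    then show ?thesis by (simp add: v_def u_def)
  qed
  show "g = \<one>\<^bsub>G\<lparr>carrier := M\<rparr>\<^esub>" if g: "g \<in> carrier (G\<lparr>carrier := M\<rparr>)" "\<forall>w\<in>A. aff g w = w" for g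
  proof -
    have gM: "g \<in> M" using g by simp
    have gG: "g \<in> carrier G" using MG[OF gM] .
    \<comment> \<open>Fixing the coset of the identity puts g into \<open>S\<close>. Fixing the
      coset of w then puts w^-1 (g w g^-1) into \<open>S\<close> as well as into \<open>A\<close>,
      so it is trivial and g commutes with w.\<close>
    have st: "inv w \<otimes> (g \<otimes> w) \<in> S" if "w \<in> A" for w using aff(2)[OF gM that] g(2) that by simp
    have gS: "g \<in> S" using st[OF subgroup.one_closed[OF subgroup_A]] gG by simp
    have "cj g w = w" if w: "w \<in> A" for w
    proof -
      have wG: "w \<in> carrier G" using AG[OF w] .
      have "inv w \<otimes> cj g w = (inv w \<otimes> (g \<otimes> w)) \<otimes> inv g" unfolding cj_def using gG wG by (simp add: m_assoc)
      then have "inv w \<otimes> cj g w \<in> S" using S_mult[OF st[OF w] S_inv[OF gS]] by simp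
      moreover have "inv w \<otimes> cj g w \<in> A"
        using w cj_A[OF gG w] subgroup_A by (simp add: subgroup.m_closed subgroup.m_inv_closed)
      ultimately have 1: "inv w \<otimes> cj g w = \<one>" using A_inter_S by blast
      have "inv (cj g w) = inv w" using inv_equality[OF 1] cj_closed[OF gG wG] wG by simp
      then show ?thesis using cj_closed[OF gG wG] wG inv_inv by metis
    qed
    then have "g = \<one>" by (rule S_faithful[OF gS])
    then show ?thesis by simp
  qed
qed

lemma iso_S4_times_center: "G \<cong> sym_group 4 \<times>\<times> G\<lparr>carrier := Z\<rparr>"
proof (rule iso_DirProd_of_complement[OF subgroup_M subgroup_Z _ M_inter_Z M_Z_cover sym_group_is_group M_iso_sym_group])
  show "m \<otimes> z = z \<otimes> m" if "m \<in> M" "z \<in> Z" for m z using central[OF that(2) MG[OF that(1)]] by simp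
qed

end

section \<open>Finding the involution and the element of order 3\<close>

context group
begin

lemma subgroup_centralizer:
  assumes P: "P \<subseteq> carrier G"
  shows "subgroup (centralizer G P) G"
proof (rule subgroupI)
  show "centralizer G P \<subseteq> carrier G" by (auto simp: centralizer_def)
  have "\<one> \<in> centralizer G P" using P by (auto simp: centralizer_def)
  then show "centralizer G P \<noteq> {}" by blast
  show "inv g \<in> centralizer G P" if g: "g \<in> centralizer G P" for g
  proof -
    have gG: "g \<in> carrier G" using g by (simp add: centralizer_def)
    have "inv g \<otimes> x = x \<otimes> inv g" if x: "x \<in> P" for x
    proof -
      have xG: "x \<in> carrier G" using x P by blast
      have "inv g \<otimes> x = inv g \<otimes> (x \<otimes> g) \<otimes> inv g" using gG xG by (simp add: m_assoc)
      also have "x \<otimes> g = g \<otimes> x" using g x by (simp add: centralizer_def)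
      also have "inv g \<otimes> (g \<otimes> x) \<otimes> inv g = x \<otimes> inv g" using gG xG by (simp add: m_assoc[symmetric])
      finally show ?thesis .
    qed
    then show ?thesis using gG by (simp add: centralizer_def)
  qed
  show "g \<otimes> h \<in> centralizer G P" if g: "g \<in> centralizer G P" and h: "h \<in> centralizer G P" for g h
  proof -
    have gG: "g \<in> carrier G" and hG: "h \<in> carrier G" using g h by (simp_all add: centralizer_def)
    have "g \<otimes> h \<otimes> x = x \<otimes> (g \<otimes> h)" if x: "x \<in> P" for x
    proof -
      have xG: "x \<in> carrier G" using x P by blast
      have "g \<otimes> h \<otimes> x = g \<otimes> (h \<otimes> x)" using gG hG xG by (simp add: m_assoc)
      also have "h \<otimes> x = x \<otimes> h" using h x by (simp add: centralizer_def)
      also have "g \<otimes> (x \<otimes> h) = (g \<otimes> x) \<otimes> h" using gG hG xG by (simp add: m_assoc)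
      also have "g \<otimes> x = x \<otimes> g" using g x by (simp add: centralizer_def)
      finally show ?thesis using gG hG xG by (simp add: m_assoc)
    qed
    then show ?thesis using gG hG by (simp add: centralizer_def)
  qed
qed

lemma subgroup_center: "subgroup (group_center G) G"
  unfolding group_center_def by (rule subgroup_centralizer) simp

lemma center_commute: "\<lbrakk>z \<in> group_center G; g \<in> carrier G\<rbrakk> \<Longrightarrow> z \<otimes> g = g \<otimes> z"
  by (simp add: group_center_def centralizer_def)

text \<open>The element x supplies the transposition, corrected by an element of A to become an
  involution. Minimality of A supplies an element moving the involution fixed by x, hence a 3-cycle
  on A. Oddness of the centre is what allows the 3-cycle to be lifted to an element of order
  3.\<close>

lemma klein_normal_imp_iso_S4:
  assumes fin: "finite (carrier G)" and A: "A \<lhd> G" "card A = 4" and exp: "\<And>v. v \<in> A \<Longrightarrow> v \<otimes> v = \<one>"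
    and cover: "\<And>g. g \<in> centralizer G A \<Longrightarrow> \<exists>v\<in>A. \<exists>z\<in>group_center G. g = v \<otimes> z"
    and AZ: "A \<inter> group_center G = {\<one>}" and odd: "odd (card (group_center G))"
    and x: "x \<in> carrier G" "x \<notin> centralizer G A" "x \<otimes> x \<in> A"
    and minimal: "\<And>B. \<lbrakk>B \<lhd> G; B \<subseteq> A; B \<noteq> {\<one>}\<rbrakk> \<Longrightarrow> B = A"
  shows "G \<cong> sym_group 4 \<times>\<times> G\<lparr>carrier := group_center G\<rparr>"
proof -
  have sA: "subgroup A G" using A(1) by (rule normal_imp_subgroup)
  have AG: "v \<in> carrier G" if "v \<in> A" for v using subgroup.mem_carrier[OF sA that] .
  have Am: "v \<otimes> w \<in> A" if "v \<in> A" "w \<in> A" for v w using subgroup.m_closed[OF sA that] .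
  have oneA: "\<one> \<in> A" using sA by (rule subgroup.one_closed)
  have finA: "finite A" using A(2) by (intro card_ge_0_finite) simp
  have cjA: "cj g v \<in> A" if "g \<in> carrier G" "v \<in> A" for g v
    unfolding cj_def by (rule normal_invE(2)[OF A(1) that])
  have self_inv: "inv v = v" if "v \<in> A" for v using inv_equality[OF exp[OF that]] AG[OF that] by simp
  have comm: "v \<otimes> w = w \<otimes> v" if "v \<in> A" "w \<in> A" for v w
    using self_inv[OF Am[OF that]] inv_mult_group[of v w] self_inv that AG by simp
  have A_fix: "cj v w = w" if "v \<in> A" "w \<in> A" for v w
    using cj_eq_self_iff[OF AG AG] comm that by blast
  have cent: "g \<in> centralizer G A" if "g \<in> carrier G" "\<And>v. v \<in> A \<Longrightarrow> cj g v = v" for g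
    using that cj_eq_self_iff[OF that(1) AG] by (simp add: centralizer_def)
  \<comment> \<open>A basis of A adapted to x: b is moved, c is its image, and a = bc is the one
    nonidentity element fixed by x, which interchanges b and c.\<close>
  obtain b where b: "b \<in> A" "cj x b \<noteq> b" using cent[OF x(1)] x(2) by blast
  define c where "c = cj x b"
  define a where "a = b \<otimes> c"
  have c: "c \<in> A" unfolding c_def by (rule cjA[OF x(1) b(1)])
  have a: "a \<in> A" unfolding a_def by (rule Am[OF b(1) c])
  have aG: "a \<in> carrier G" and bG: "b \<in> carrier G" and cG: "c \<in> carrier G" using AG a b(1) c by auto
  have b1: "b \<noteq> \<one>" using b(2) cj_one_right[OF x(1)] by auto
  have bc: "b \<noteq> c" using b(2) unfolding c_def by auto
  have xc: "cj x c = b"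
  proof -
    have "cj x c = cj (x \<otimes> x) b" unfolding c_def by (rule cj_mult[OF x(1) x(1) bG, symmetric])
    then show ?thesis using A_fix[OF x(3) b(1)] by simp
  qed
  have c1: "c \<noteq> \<one>" using xc cj_one_right[OF x(1)] b1 by auto
  have a1: "a \<noteq> \<one>"
  proof
    assume "a = \<one>"
    then have "inv c = b" using inv_equality[of b c] bG cG unfolding a_def by simp
    then show False using self_inv[OF c] bc by simp
  qed
  have ab: "a \<otimes> b = c"
    unfolding a_def comm[OF b(1) c] using exp[OF b(1)] bG cG by (simp add: m_assoc)
  have ac: "a \<otimes> c = b" unfolding a_def using exp[OF c] bG cG by (simp add: m_assoc)
  have "a \<noteq> b" using ab exp[OF b(1)] c1 by auto
  have "a \<noteq> c" using ac exp[OF c] b1 by auto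
  have A_eq: "A = {\<one>, a, b, c}"
  proof (rule card_subset_eq[OF finA, symmetric])
    show "{\<one>, a, b, c} \<subseteq> A" using oneA a b(1) c by simp
    show "card {\<one>, a, b, c} = card A"
      using A(2) a1 b1 c1 bc \<open>a \<noteq> b\<close> \<open>a \<noteq> c\<close> by (simp add: card_insert_if)
  qed
  have xa: "cj x a = a"
    unfolding a_def using cj_distrib[OF x(1) bG cG] xc comm[OF b(1) c] by (simp add: c_def)
  have cj_xx: "cj x (x \<otimes> x) = x \<otimes> x" unfolding cj_def using x(1) by (simp add: m_assoc)
  have "x \<otimes> x \<noteq> b" using cj_xx b(2) by auto
  moreover have "x \<otimes> x \<noteq> c" using cj_xx xc bc by auto
  ultimately have xx: "x \<otimes> x = \<one> \<or> x \<otimes> x = a" using x(3) A_eq by blast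
  obtain t where t: "t \<in> carrier G" "t \<otimes> t = \<one>" "cj t a = a" "cj t b = c" "cj t c = b"
  proof (cases "x \<otimes> x = \<one>")
    case True
    show ?thesis by (rule that[OF x(1) True xa _ xc]) (simp add: c_def)
  next
    case False
    then have xxa: "x \<otimes> x = a" using xx by blast
    \<comment> \<open>Here x^2 = a, and x b replaces x. It acts on A in the same way, and moving b
      past x turns it into c, so (x b)^2 = x^2 (c b) = a a = 1.\<close>
    have xb: "cj (x \<otimes> b) v = cj x v" if "v \<in> A" for v
      using cj_mult[OF x(1) bG AG[OF that]] A_fix[OF b(1) that] by simp
    have "x \<otimes> c = b \<otimes> x"
    proof -
      have "b \<otimes> x = x \<otimes> c \<otimes> inv x \<otimes> x" using xc unfolding cj_def by simp
      then show ?thesis using x(1) cG by (simp add: m_assoc)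
    qed
    then have "(x \<otimes> b) \<otimes> (x \<otimes> b) = x \<otimes> (x \<otimes> c) \<otimes> b" using x(1) bG cG by (simp add: m_assoc)
    also have "\<dots> = (x \<otimes> x) \<otimes> (c \<otimes> b)" using x(1) bG cG by (simp add: m_assoc)
    also have "\<dots> = a \<otimes> a" unfolding xxa a_def comm[OF b(1) c] ..
    also have "\<dots> = \<one>" by (rule exp[OF a])
    finally have tt: "(x \<otimes> b) \<otimes> (x \<otimes> b) = \<one>" .
    show ?thesis
    proof (rule that[OF m_closed[OF x(1) bG] tt])
      show "cj (x \<otimes> b) a = a" using xb[OF a] xa by simp
      show "cj (x \<otimes> b) b = c" using xb[OF b(1)] by (simp add: c_def)
      show "cj (x \<otimes> b) c = b" using xb[OF c] xc by simp
    qed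
  qed
  have tG: "t \<in> carrier G" by (rule t(1))
  have "\<exists>g\<in>carrier G. cj g a \<noteq> a"
  proof (rule ccontr)
    assume "\<not> ?thesis"
    then have fix_a: "cj g a = a" if "g \<in> carrier G" for g using that by blast
    \<comment> \<open>If every conjugation fixed a, the group of order 2 generated by a would be a
      proper nontrivial normal subgroup inside A.\<close>
    have "subgroup {\<one>, a} G"
      by (rule subgroupI) (use aG exp[OF a] self_inv[OF a] in auto)
    then have "{\<one>, a} \<lhd> G"
    proof (rule normal_invI)
      fix g v assume "g \<in> carrier G" "v \<in> {\<one>, a}"
      then show "g \<otimes> v \<otimes> inv g \<in> {\<one>, a}" using fix_a unfolding cj_def by auto
    qed
    then have "{\<one>, a} = A" by (rule minimal) (use oneA a a1 in auto)
    then have "b \<in> {\<one>, a}" using b(1) by simp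
    then show False using b1 \<open>a \<noteq> b\<close> by simp
  qed
  then obtain g0 where g0: "g0 \<in> carrier G" "cj g0 a \<noteq> a" by blast
  have "\<exists>g\<in>carrier G. cj g a = b"
  proof -
    have "cj g0 a \<noteq> \<one>" using cj_inject[OF g0(1) aG one_closed] cj_one_right[OF g0(1)] a1 by auto
    then have "cj g0 a = b \<or> cj g0 a = c" using cjA[OF g0(1) a] g0(2) A_eq by blast
    then show ?thesis
    proof
      assume "cj g0 a = b" then show ?thesis using g0(1) by blast
    next
      assume "cj g0 a = c"
      then have "cj (t \<otimes> g0) a = b" using cj_mult[OF tG g0(1) aG] t(5) by simp
      then show ?thesis using tG g0(1) by (intro bexI[of _ "t \<otimes> g0"]) simp_all
    qed
  qed
  then obtain g where g: "g \<in> carrier G" "cj g a = b" by blast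
  have gc: "cj g c = b \<otimes> cj g b" unfolding ab[symmetric] using cj_distrib[OF g(1) aG bG] g(2) by simp
  \<comment> \<open>An element sending a to b induces either the 3-cycle or the transposition of a
    and b. In the second case multiplying by t, which interchanges b and c, turns it into the
    3-cycle.\<close>
  obtain h where h: "h \<in> carrier G" "cj h a = b" "cj h b = c" "cj h c = a"
  proof -
    have "cj g b \<noteq> \<one>" using cj_inject[OF g(1) bG one_closed] cj_one_right[OF g(1)] b1 by auto
    moreover have "cj g b \<noteq> b" using cj_inject[OF g(1) bG aG] g(2) \<open>a \<noteq> b\<close> by auto
    ultimately have "cj g b = a \<or> cj g b = c" using cjA[OF g(1) b(1)] A_eq by blast
    then show ?thesis
    proof
      assume gb: "cj g b = c"
      show ?thesis by (rule that[OF g(1,2) gb]) (simp add: gc gb a_def)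
    next
      assume gb: "cj g b = a"
      have gcc: "cj g c = c" using gc gb comm[OF b(1) a] ab by simp
      show ?thesis
      proof (rule that[of "g \<otimes> t"])
        show "g \<otimes> t \<in> carrier G" using g(1) tG by simp
        show "cj (g \<otimes> t) a = b" using cj_mult[OF g(1) tG aG] t(3) g(2) by simp
        show "cj (g \<otimes> t) b = c" using cj_mult[OF g(1) tG bG] t(4) gcc by simp
        show "cj (g \<otimes> t) c = a" using cj_mult[OF g(1) tG cG] t(5) gb by simp
      qed
    qed
  qed
  have ha: "cj (inv h) a = c" "cj (inv h) b = a" "cj (inv h) c = b"
    using cj_inv[OF h(1) cG h(4)] cj_inv[OF h(1) aG h(2)] cj_inv[OF h(1) bG h(3)] .
  have it: "inv t = t" using inv_equality[OF t(2)] tG by simp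
  have ih: "inv h \<in> carrier G" using h(1) by simp
  \<comment> \<open>The commutator kills the central ambiguity in the choice of \<open>h\<close>: it is inverted by \<open>t\<close>.\<close>
  define k where "k = inv h \<otimes> (t \<otimes> (h \<otimes> t))"
  have kG: "k \<in> carrier G" unfolding k_def using h(1) tG by simp
  have cjk: "cj k v = cj (inv h) (cj t (cj h (cj t v)))" if "v \<in> carrier G" for v
    unfolding k_def using that h(1) tG ih by (simp add: cj_mult cj_closed)
  have ka: "cj k a = b" using cjk[OF aG] t h ha by simp
  have kb: "cj k b = c" using cjk[OF bG] t h ha by simp
  have kc: "cj k c = a" using cjk[OF cG] t h ha by simp
  have inv_k: "inv k = t \<otimes> k \<otimes> t"
  proof (rule inv_equality)
    have "t \<otimes> k \<otimes> t \<otimes> k = t \<otimes> inv h \<otimes> t \<otimes> h \<otimes> (t \<otimes> t) \<otimes> inv h \<otimes> t \<otimes> h \<otimes> t"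
      unfolding k_def using h(1) tG by (simp add: m_assoc)
    also have "\<dots> = t \<otimes> inv h \<otimes> t \<otimes> (h \<otimes> inv h) \<otimes> t \<otimes> h \<otimes> t"
      unfolding t(2) using h(1) tG by (simp add: m_assoc)
    also have "\<dots> = t \<otimes> inv h \<otimes> (t \<otimes> t) \<otimes> h \<otimes> t" using h(1) tG by (simp add: m_assoc)
    also have "\<dots> = t \<otimes> (inv h \<otimes> h) \<otimes> t" unfolding t(2) using h(1) tG by (simp add: m_assoc)
    also have "\<dots> = \<one>" using h(1) tG t(2) by simp
    finally show "t \<otimes> k \<otimes> t \<otimes> k = \<one>" .
  qed (use kG tG in simp_all)
  have kkkG: "k \<otimes> k \<otimes> k \<in> carrier G" using kG by simp
  have "cj (k \<otimes> k \<otimes> k) v = v" if v: "v \<in> A" for v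
  proof -
    have "cj (k \<otimes> k \<otimes> k) v = cj k (cj k (cj k v))"
      using kG AG[OF v] by (simp add: cj_mult cj_closed)
    then show ?thesis using v ka kb kc cj_one_right[OF kG] unfolding A_eq by auto
  qed
  then obtain v z where vz: "v \<in> A" "z \<in> group_center G" "k \<otimes> k \<otimes> k = v \<otimes> z"
    using cover[OF cent[OF kkkG]] by blast
  have zG: "z \<in> carrier G" using vz(2) by (simp add: group_center_def centralizer_def)
  have vG: "v \<in> carrier G" by (rule AG[OF vz(1)])
  have zfix: "cj g z = z" if "g \<in> carrier G" for g
    using cj_eq_self_iff[OF that zG] center_commute[OF vz(2) that] by simp
  \<comment> \<open>k commutes with its own cube v z and with the central z, hence with v; but a
    3-cycle fixes only the identity of A.\<close>
  have "v = \<one>"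
  proof -
    have "cj k (k \<otimes> k \<otimes> k) = k \<otimes> k \<otimes> k" unfolding cj_def using kG by (simp add: m_assoc)
    then have "cj k v \<otimes> z = v \<otimes> z" unfolding vz(3) using cj_distrib[OF kG vG zG] zfix[OF kG] by simp
    then have "cj k v = v" using r_cancel cj_closed[OF kG vG] vG zG by metis
    then show ?thesis using vz(1) ka kb kc \<open>a \<noteq> b\<close> \<open>a \<noteq> c\<close> bc unfolding A_eq by auto
  qed
  then have kz: "k \<otimes> k \<otimes> k = z" using vz(3) zG by simp
  \<comment> \<open>Conjugation by t inverts k, hence also k^3 = z, while it fixes the central
    element z.\<close>
  have "inv z = z"
  proof -
    have "cj t k = inv k" unfolding cj_def it inv_k ..
    then have "cj t (k \<otimes> k \<otimes> k) = inv k \<otimes> inv k \<otimes> inv k" using tG kG by (simp add: cj_distrib)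
    also have "\<dots> = inv (k \<otimes> k \<otimes> k)" using kG by (simp add: inv_mult_group m_assoc)
    finally show ?thesis unfolding kz using zfix[OF tG] by simp
  qed
  then have zz: "z [^] (2::nat) = \<one>" using zG r_inv[OF zG] by (simp add: numeral_2_eq_2)
  have finZ: "finite (group_center G)"
    by (rule finite_subset[OF subgroup.subset[OF subgroup_center] fin])
  have "z = \<one>"
    by (rule eq_one_of_coprime_pows[OF zG zz pow_card_eq_one[OF subgroup_center finZ vz(2)]])
      (use odd in \<open>simp add: coprime_left_2_iff_odd\<close>)
  then have kkk: "k \<otimes> k \<otimes> k = \<one>" using kz by simp
  have ik: "inv k = k \<otimes> k" by (rule inv_equality[OF kkk]) (use kG in simp_all)
  have tk: "t \<otimes> k = k \<otimes> k \<otimes> t"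
  proof -
    have "k \<otimes> k \<otimes> t = t \<otimes> k \<otimes> t \<otimes> t" using inv_k ik by simp
    also have "\<dots> = t \<otimes> k" using tG kG t(2) by (simp add: m_assoc)
    finally show ?thesis by simp
  qed
  interpret klein_frame G A "group_center G" a b c t k
  proof (intro klein_frame.intro klein_frame_axioms.intro)
    show "\<exists>v\<in>A. \<exists>z\<in>group_center G. g = v \<otimes> z"
      if "g \<in> carrier G" "\<And>v. v \<in> A \<Longrightarrow> cj g v = v" for g using cover[OF cent[OF that]] .
  qed (fact is_group A(1) A_eq a1 b1 c1 bc \<open>a \<noteq> b\<close> \<open>a \<noteq> c\<close> ab comm subgroup_center center_commute AZ
      kG t kkk tk ka kb kc)+
  show ?thesis by (rule iso_S4_times_center)
qed

end

section \<open>The theorem\<close>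

lemma (in group) cj_pow: "\<lbrakk>g \<in> carrier G; v \<in> carrier G\<rbrakk> \<Longrightarrow> cj g (v [^] (m::nat)) = cj g v [^] m"
  by (induction m) (simp_all add: cj_one_right cj_distrib)

text \<open>The weight basis is used with A acting as a normal subgroup of itself: all matrices are
  diagonal, so the index set containing only 0 is invariant and irreducibility gives degree
  1.\<close>

lemma irr_char_abelian_imp_linear_char:
  fixes G :: "('a, 'b) monoid_scheme"
  assumes G: "group G" and A: "subgroup A G" "finite A"
    and comm: "\<And>a b. \<lbrakk>a \<in> A; b \<in> A\<rbrakk> \<Longrightarrow> a \<otimes>\<^bsub>G\<^esub> b = b \<otimes>\<^bsub>G\<^esub> a"
    and \<theta>: "irr_char (G\<lparr>carrier := A\<rparr>) \<theta>"
  shows "linear_char G A \<theta>"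
proof -
  interpret G: group G by (rule G)
  let ?H = "G\<lparr>carrier := A\<rparr>"
  have H: "group ?H" using A(1) G.subgroup_imp_group by blast
  interpret H: group ?H by (rule H)
  have norm: "A \<lhd> ?H"
  proof (rule H.normal_invI)
    show "subgroup A ?H" using H.subgroup_self by simp
    show "x \<otimes>\<^bsub>?H\<^esub> h \<otimes>\<^bsub>?H\<^esub> inv\<^bsub>?H\<^esub> x \<in> A" if "x \<in> carrier ?H" "h \<in> A" for x h
      using H.m_closed[OF H.m_closed[OF that(1), of h] H.inv_closed[OF that(1)]] that(2) by simp
  qed
  obtain n r l where W: "weighted_rep ?H A n r l \<theta>" and n: "n > 0"
    by (rule weighted_rep_exists[OF H _ norm _ \<theta>]) (use A comm in auto)
  interpret W: weighted_rep ?H A n r l \<theta> by (rule W)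
  have "{0::nat} = {} \<or> {0} = {..<n}"
    by (rule W.irreducible) (use n W.r_A in auto)
  then have "{..<n} = {0}" by auto
  then have "\<theta> a = l 0 a" if "a \<in> A" for a using W.\<chi>_A[OF that] by simp
  moreover have "linear_char ?H A (l 0)" by (rule W.linear_char_l[OF n])
  ultimately show ?thesis
    using subgroup.one_closed[OF A(1)] subgroup.m_closed[OF A(1)] by (simp add: linear_char_def)
qed

section \<open>The hypotheses of the theorem, and the elementary abelian structure of P\<close>

locale unit_on_p_singular = group G for G (structure) +
  fixes p :: nat and \<chi> :: "'a \<Rightarrow> complex"
  assumes prime_p: "Factorial_Ring.prime p" and finite_G: "finite (carrier G)"
    and irr: "irr_char G \<chi>" and faithful: "faithful_char G \<chi>" and nonlinear: "Re (\<chi> \<one>) > 1"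
    and unit: "\<And>x. \<lbrakk>x \<in> carrier G; p dvd ord x\<rbrakk> \<Longrightarrow> cmod (\<chi> x) = 1"
    and O_p_nontrivial: "O_p G p \<noteq> {\<one>}"
begin

abbreviation "P \<equiv> O_p G p"

lemma normal_P: "P \<lhd> G" and p_subgroup_P: "p_subgroup G p P"
  using O_p_properties[OF prime_p finite_G] by blast+

lemma subgroup_P: "subgroup P G"
  using normal_P by (rule normal_imp_subgroup)

lemma PG: "x \<in> P \<Longrightarrow> x \<in> carrier G"
  using subgroup_P by (rule subgroup.mem_carrier)

lemma finite_P: "finite P"
  by (rule finite_subset[OF subgroup.subset[OF subgroup_P] finite_G])

lemma card_P: obtains m where "card P = p ^ m"
  using p_subgroup_P unfolding p_subgroup_def by blast

lemma unit_p_element: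
  assumes "x \<in> carrier G" "x \<noteq> \<one>" "x [^] (p ^ k) = \<one>"
  shows "cmod (\<chi> x) = 1"
  using unit[OF assms(1) prime_dvd_ord[OF prime_p assms]] .

lemma normal_p_subgroup_le:
  assumes B: "B \<lhd> G" and pow: "\<And>x. x \<in> B \<Longrightarrow> \<exists>k. x [^] (p ^ k) = \<one>"
  shows "p_subgroup G p B" and "B \<subseteq> P"
proof -
  have sB: "subgroup B G" using B by (rule normal_imp_subgroup)
  have "finite B" by (rule finite_subset[OF subgroup.subset[OF sB] finite_G])
  then show 1: "p_subgroup G p B"
    unfolding p_subgroup_def using card_prime_power[OF prime_p sB _ pow] sB by blast
  show "B \<subseteq> P" by (rule O_p_properties(3)[OF prime_p finite_G 1 B])
qed

text \<open>Nonidentity elements of B are p-singular, so \<chi> is unimodular there and the orbit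
  count applies. The degree \<open>n\<close> is \<chi>(1) whatever B is, so any two such subgroups
  have the same order.\<close>

lemma simple_weights_exist:
  assumes B: "B \<lhd> G" "p_subgroup G p B" "B \<noteq> {\<one>}"
    and comm: "\<And>a b. \<lbrakk>a \<in> B; b \<in> B\<rbrakk> \<Longrightarrow> a \<otimes> b = b \<otimes> a"
  obtains n r l where "simple_weights G B n r l \<chi>" and "\<chi> \<one> = of_nat n"
proof -
  have sB: "subgroup B G" using B(1) by (rule normal_imp_subgroup)
  have fB: "finite B" by (rule finite_subset[OF subgroup.subset[OF sB] finite_G])
  obtain n r l where W: "weighted_rep G B n r l \<chi>" and n: "\<chi> \<one> = of_nat n"
    by (rule weighted_rep_exists[OF is_group finite_G B(1) comm irr])
  interpret W: weighted_rep G B n r l \<chi> by (rule W)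
  have n1: "n > 1" using nonlinear n by simp
  obtain m where m: "card B = p ^ m" using B(2) unfolding p_subgroup_def by blast
  have unitB: "cmod (\<chi> a) = 1" if "a \<in> B" "a \<noteq> \<one>" for a
    using unit_p_element[OF subgroup.mem_carrier[OF sB that(1)] that(2)] pow_card_eq_one[OF sB fB that(1)] m
    by simp
  have "simple_weights G B n r l \<chi>"
  proof (intro simple_weights.intro simple_weights_axioms.intro)
    show "weighted_rep G B n r l \<chi>" by (rule W)
    show "n > 1" by (rule n1)
    show "card B = n + 1" by (rule W.weights_distinct(1)[OF n1 B(3) unitB])
    show "i = j" if "i < n" "j < n" "\<forall>a\<in>B. l i a = l j a" for i j
      by (rule W.weights_distinct(2)[OF n1 B(3) unitB that])
    show "g = \<one>" if "g \<in> carrier G" "\<chi> g = \<chi> \<one>" for g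
      using faithful that unfolding faithful_char_def char_kernel_def by blast
  qed
  then show ?thesis using that n by blast
qed

lemma elementary_P:
  shows "\<And>a b. \<lbrakk>a \<in> P; b \<in> P\<rbrakk> \<Longrightarrow> a \<otimes> b = b \<otimes> a" and "\<And>a. a \<in> P \<Longrightarrow> a [^] p = \<one>"
proof -
  obtain m where m: "card P = p ^ m" by (rule card_P)
  \<comment> \<open>\<open>C\<close> is Z(P). Its elements killed by p form the subgroup
    \<open>A\<close> below, because \<open>C\<close> is abelian.\<close>
  define C where "C = P \<inter> centralizer G P"
  have PC: "P \<subseteq> carrier G" using subgroup_P by (rule subgroup.subset)
  have sC: "subgroup C G"
    unfolding C_def using subgroups_Inter_pair[OF subgroup_P subgroup_centralizer[OF PC]] .
  have finC: "finite C" unfolding C_def using finite_P by simp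
  define A where "A = {a \<in> C. a [^] p = \<one>}"
  have CG: "a \<in> carrier G" if "a \<in> C" for a using subgroup.mem_carrier[OF sC that] .
  have C_comm: "a \<otimes> b = b \<otimes> a" if "a \<in> C" "b \<in> P" for a b
    using that unfolding C_def centralizer_def by simp
  have CP: "a \<in> P" if "a \<in> C" for a using that unfolding C_def by simp
  have cjC: "cj g a \<in> C" if g: "g \<in> carrier G" and a: "a \<in> C" for g a
  proof -
    have aG: "a \<in> carrier G" by (rule CG[OF a])
    have cjP: "cj h y \<in> P" if "h \<in> carrier G" "y \<in> P" for h y
      unfolding cj_def by (rule normal_invE(2)[OF normal_P that])
    have "cj g a \<otimes> y = y \<otimes> cj g a" if y: "y \<in> P" for y
    proof -
      have yG: "y \<in> carrier G" by (rule PG[OF y])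
      define w where "w = cj (inv g) y"
      have w: "w \<in> P" unfolding w_def using cjP[OF _ y] g by simp
      have wG: "w \<in> carrier G" by (rule PG[OF w])
      have "cj g w = y" unfolding w_def using cj_mult[of g "inv g" y] g yG by (simp add: cj_one)
      then have "cj g a \<otimes> y = cj g (a \<otimes> w)" using cj_distrib[OF g aG wG] by simp
      also have "a \<otimes> w = w \<otimes> a" by (rule C_comm[OF a w])
      also have "cj g (w \<otimes> a) = y \<otimes> cj g a" using cj_distrib[OF g wG aG] \<open>cj g w = y\<close> by simp
      finally show ?thesis .
    qed
    then show ?thesis
      unfolding C_def centralizer_def using cjP[OF g CP[OF a]] cj_closed[OF g aG] by simp
  qed
  have sA: "subgroup A G"
  proof (rule subgroupI)
    show "A \<subseteq> carrier G" unfolding A_def using CG by blast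
    have "\<one> \<in> A" unfolding A_def using subgroup.one_closed[OF sC] by simp
    then show "A \<noteq> {}" by blast
    show "inv a \<in> A" if "a \<in> A" for a
      using that subgroup.m_inv_closed[OF sC] CG unfolding A_def by (auto simp: nat_pow_inv)
    show "a \<otimes> b \<in> A" if "a \<in> A" "b \<in> A" for a b
    proof -
      have ab: "a \<in> C" "b \<in> C" "a [^] p = \<one>" "b [^] p = \<one>" using that unfolding A_def by auto
      have "(a \<otimes> b) [^] p = a [^] p \<otimes> b [^] p"
        by (rule pow_mult_distrib[OF C_comm[OF ab(1) CP[OF ab(2)]] CG[OF ab(1)] CG[OF ab(2)]])
      then show ?thesis unfolding A_def using ab subgroup.m_closed[OF sC ab(1,2)] by simp
    qed
  qed
  have nA: "A \<lhd> G"
  proof (rule normal_invI[OF sA])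
    fix g a assume g: "g \<in> carrier G" and a: "a \<in> A"
    then have "a \<in> C" "a [^] p = \<one>" unfolding A_def by auto
    then have "cj g a \<in> A" unfolding A_def using cjC[OF g] cj_pow[OF g CG, of a p] cj_one_right[OF g] by simp
    then show "g \<otimes> a \<otimes> inv g \<in> A" unfolding cj_def .
  qed
  have ntA: "A \<noteq> {\<one>}"
  proof -
    \<comment> \<open>A nontrivial centre of P has order divisible by p, and Cauchy's theorem
      provides a nonidentity element of \<open>A\<close>.\<close>
    obtain z where z: "z \<in> P" "z \<noteq> \<one>" "\<And>h. h \<in> P \<Longrightarrow> h \<otimes> z = z \<otimes> h"
      by (rule p_group_center_nontrivial[OF prime_p subgroup_P finite_P m O_p_nontrivial]) blast
    then have zC: "z \<in> C" unfolding C_def centralizer_def using PG by auto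
    have "\<exists>k. card C = p ^ k"
    proof (rule card_prime_power[OF prime_p sC finC])
      fix x assume "x \<in> C"
      then show "\<exists>k. x [^] (p ^ k) = \<one>" using pow_card_eq_one[OF subgroup_P finite_P CP] m by metis
    qed
    then obtain k where k: "card C = p ^ k" by blast
    have "k \<noteq> 0"
    proof
      assume "k = 0"
      then have "card C = Suc 0" using k by simp
      then obtain y where "C = {y}" unfolding card_1_singleton_iff by blast
      then show False using zC z(2) subgroup.one_closed[OF sC] by simp
    qed
    then have "p dvd card C" using k by simp
    then obtain y where y: "y \<in> C" "y \<noteq> \<one>" "y [^] p = \<one>"
      using subgroup_of_prime_order[OF prime_p sC finC] by blast
    then have "y \<in> A" unfolding A_def by simp
    then show ?thesis using y(2) by blast
  qed
  have A_comm: "a \<otimes> b = b \<otimes> a" if "a \<in> A" "b \<in> A" for a b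
    using C_comm CP that unfolding A_def by blast
  have "\<exists>k. a [^] (p ^ k) = \<one>" if "a \<in> A" for a
    using that unfolding A_def by (intro exI[of _ 1]) simp
  then have pA: "p_subgroup G p A" by (rule normal_p_subgroup_le(1)[OF nA])
  obtain n r l where sw: "simple_weights G A n r l \<chi>" and n: "\<chi> \<one> = of_nat n"
    by (rule simple_weights_exist[OF nA pA ntA A_comm])
  have P_cent: "P \<subseteq> centralizer G A"
  proof
    fix x assume x: "x \<in> P"
    have "x \<otimes> a = a \<otimes> x" if "a \<in> A" for a using C_comm[of a x] that x unfolding A_def by simp
    then show "x \<in> centralizer G A" unfolding centralizer_def using PG[OF x] by simp
  qed
  show P_comm: "a \<otimes> b = b \<otimes> a" if "a \<in> P" "b \<in> P" for a b
    using simple_weights.centralizer_commute[OF sw] P_cent that by blast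
  \<comment> \<open>Only now, with P known to be abelian, can the orbit count be repeated for P.
    Both counts give order \<chi>(1) + 1, and A lies in P.\<close>
  obtain n' r' l' where sw': "simple_weights G P n' r' l' \<chi>" and n': "\<chi> \<one> = of_nat n'"
    by (rule simple_weights_exist[OF normal_P p_subgroup_P O_p_nontrivial P_comm])
  have "card A = card P"
    using simple_weights.card_A[OF sw] simple_weights.card_A[OF sw'] n n' by simp
  moreover have "A \<subseteq> P" unfolding A_def using CP by blast
  ultimately have "A = P" using finite_P card_subset_eq by blast
  then show "a [^] p = \<one>" if "a \<in> P" for a using that unfolding A_def by blast
qed

section \<open>The centraliser of P and the two alternatives, in a weight basis for P\<close>

context
  fixes n r l
  assumes sw: "simple_weights G P n r l \<chi>" and \<chi>_one: "\<chi> \<one> = of_nat n"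
begin

interpretation W: simple_weights G P n r l \<chi> by (rule sw)

lemma unit_P: "\<lbrakk>a \<in> P; a \<noteq> \<one>\<rbrakk> \<Longrightarrow> cmod (\<chi> a) = 1"
  using unit_p_element[of a 1] PG elementary_P(2) by simp

lemma P_inter_center: "P \<inter> group_center G = {\<one>}"
  by (rule W.center_inter_A[OF unit_P])

lemma P_le_centralizer: "P \<subseteq> centralizer G P"
  unfolding centralizer_def using PG elementary_P(1) by blast

lemma subgroup_C: "subgroup (centralizer G P) G"
  by (rule subgroup_centralizer[OF subgroup.subset[OF subgroup_P]])

text \<open>C_G(P) is abelian, so its p-elements form a subgroup D. It is invariant under
  conjugation, hence a normal p-subgroup of G, and so contained in P.\<close>

lemma p_element_of_centralizer:
  assumes c: "c \<in> centralizer G P" and pow: "c [^] (p ^ k) = \<one>"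
  shows "c \<in> P"
proof -
  let ?C = "centralizer G P"
  have CG: "d \<in> carrier G" if "d \<in> ?C" for d using subgroup.mem_carrier[OF subgroup_C that] .
  define D where "D = {d \<in> ?C. \<exists>k. d [^] (p ^ k) = \<one>}"
  have sD: "subgroup D G"
  proof (rule subgroupI)
    show "D \<subseteq> carrier G" unfolding D_def using CG by blast
    have "\<one> \<in> D" unfolding D_def using subgroup.one_closed[OF subgroup_C] by simp
    then show "D \<noteq> {}" by blast
    show "inv d \<in> D" if d: "d \<in> D" for d
    proof -
      obtain k where k: "d \<in> ?C" "d [^] (p ^ k) = \<one>" using d unfolding D_def by blast
      then have "inv d [^] (p ^ k) = \<one>" using nat_pow_inv[OF CG[OF k(1)]] by simp
      then show ?thesis unfolding D_def using subgroup.m_inv_closed[OF subgroup_C k(1)] by blast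
    qed
    show "d \<otimes> e \<in> D" if de: "d \<in> D" "e \<in> D" for d e
    proof -
      obtain k m where k: "d \<in> ?C" "d [^] (p ^ k) = \<one>" "e \<in> ?C" "e [^] (p ^ m) = \<one>"
        using de unfolding D_def by blast
      have g: "d \<in> carrier G" "e \<in> carrier G" using CG k by auto
      have "d [^] (p ^ k * p ^ m) = \<one>" "e [^] (p ^ m * p ^ k) = \<one>"
        using k g by (simp_all add: nat_pow_pow[symmetric])
      then have "(d \<otimes> e) [^] (p ^ k * p ^ m) = \<one>"
        using pow_mult_distrib[OF W.centralizer_commute[OF k(1,3)] g, of "p ^ k * p ^ m"] by (simp add: mult.commute)
      then have "\<exists>i. (d \<otimes> e) [^] (p ^ i) = \<one>" by (metis power_add)
      then show ?thesis unfolding D_def using subgroup.m_closed[OF subgroup_C k(1,3)] by blast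
    qed
  qed
  have "D \<lhd> G"
  proof (rule normal_invI[OF sD])
    fix g d assume g: "g \<in> carrier G" and "d \<in> D"
    then obtain k where k: "d \<in> ?C" "d [^] (p ^ k) = \<one>" unfolding D_def by blast
    have dG: "d \<in> carrier G" by (rule CG[OF k(1)])
    have "cj g d \<otimes> x = x \<otimes> cj g d" if x: "x \<in> P" for x
    proof -
      have xG: "x \<in> carrier G" by (rule PG[OF x])
      define w where "w = cj (inv g) x"
      have w: "w \<in> P" unfolding w_def cj_def by (rule normal_invE(2)[OF normal_P _ x]) (use g in simp)
      have wG: "w \<in> carrier G" by (rule PG[OF w])
      have gw: "cj g w = x" unfolding w_def using cj_mult[of g "inv g" x] g xG by (simp add: cj_one)
      then have "cj g d \<otimes> x = cj g (d \<otimes> w)" using cj_distrib[OF g dG wG] by simp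
      also have "d \<otimes> w = w \<otimes> d" using k(1) w unfolding centralizer_def by simp
      also have "cj g (w \<otimes> d) = x \<otimes> cj g d" using cj_distrib[OF g wG dG] gw by simp
      finally show ?thesis .
    qed
    then have "cj g d \<in> ?C" unfolding centralizer_def using cj_closed[OF g dG] by simp
    moreover have "cj g d [^] (p ^ k) = \<one>" using cj_pow[OF g dG, of "p ^ k"] k(2) cj_one_right[OF g] by simp
    ultimately have "cj g d \<in> D" unfolding D_def by blast
    then show "g \<otimes> d \<otimes> inv g \<in> D" unfolding cj_def .
  qed
  then have "D \<subseteq> P" by (rule normal_p_subgroup_le(2)) (simp add: D_def)
  then show ?thesis using c pow unfolding D_def by blast
qed

text \<open>For a in P other than the identity, c a is p-singular: otherwise a power prime to p
  would kill c a and c, hence a, although a^p = 1. So \<chi> is unimodular on the coset cP except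
  possibly at c itself, which is what the scalar-matrix argument asks for.\<close>

lemma p'_element_of_centralizer:
  assumes c: "c \<in> centralizer G P" and pow: "c [^] m = \<one>" and m: "coprime p (m::nat)"
  shows "c \<in> group_center G"
proof (rule W.centralizer_central[OF c])
  fix a assume a: "a \<in> P" "a \<noteq> \<one>"
  have cG: "c \<in> carrier G" using c by (simp add: centralizer_def)
  have aG: "a \<in> carrier G" by (rule PG[OF a(1)])
  have ca: "c \<otimes> a = a \<otimes> c" using c a by (simp add: centralizer_def)
  have "p dvd ord (c \<otimes> a)"
  proof (rule ccontr)
    assume "\<not> p dvd ord (c \<otimes> a)"
    then have cop: "coprime p (ord (c \<otimes> a) * m)"
      using prime_imp_coprime[OF prime_p] m by simp
    have "\<one> = (c \<otimes> a) [^] (ord (c \<otimes> a) * m)"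
      using pow_eq_id[of "c \<otimes> a" "ord (c \<otimes> a) * m"] cG aG by simp
    also have "\<dots> = c [^] (ord (c \<otimes> a) * m) \<otimes> a [^] (ord (c \<otimes> a) * m)"
      by (rule pow_mult_distrib[OF ca cG aG])
    also have "c [^] (ord (c \<otimes> a) * m) = \<one>"
      using pow cG nat_pow_pow[OF cG, of m "ord (c \<otimes> a)"] by (simp add: mult.commute)
    finally have "a [^] (ord (c \<otimes> a) * m) = \<one>" using aG by simp
    then have "a = \<one>" using eq_one_of_coprime_pows[OF aG elementary_P(2)[OF a(1)] _ cop] by blast
    then show False using a(2) by blast
  qed
  then show "cmod (\<chi> (c \<otimes> a)) = 1" using unit cG aG by simp
qed

text \<open>Write the order of c as q m with q a power of p and m prime to p. With m u = q v + 1,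
  the power c^(m u) is a p-element, c^(q v) has order prime to p, and c is the quotient of the
  two.\<close>

lemma centralizer_decomp:
  assumes c: "c \<in> centralizer G P"
  shows "\<exists>v\<in>P. \<exists>z\<in>group_center G. c = v \<otimes> z"
proof -
  have cG: "c \<in> carrier G" using c by (simp add: centralizer_def)
  have powC: "c [^] (i::nat) \<in> centralizer G P" for i using nat_pow_mem[OF subgroup_C c] .
  have o0: "ord c \<noteq> 0" using ord_ge_1[OF finite_G cG] by simp
  have "\<not> is_unit p" using prime_p not_prime_unit by blast
  then obtain m where m: "ord c = p ^ multiplicity p (ord c) * m" "\<not> p dvd m"
    by (rule multiplicity_decompose'[OF o0])
  define q where "q = p ^ multiplicity p (ord c)"
  have oc: "ord c = q * m" unfolding q_def by (rule m(1))
  have cop: "coprime p m" using m(2) prime_imp_coprime[OF prime_p] by blast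
  have "coprime m q" unfolding q_def using cop by (simp add: coprime_commute)
  have m0: "m \<noteq> 0" using m(2) by (intro notI) simp
  obtain u v where uv: "m * u = q * v + 1"
    using bezout_nat[OF m0, of q] \<open>coprime m q\<close> by auto
  have q1: "c [^] (m * u) \<in> P"
  proof (rule p_element_of_centralizer[OF powC])
    have "(c [^] (m * u)) [^] q = c [^] (ord c * u)"
      unfolding nat_pow_pow[OF cG] oc by (simp only: mult_ac)
    also have "\<dots> = \<one>" using pow_eq_id[OF cG] by simp
    finally show "(c [^] (m * u)) [^] (p ^ multiplicity p (ord c)) = \<one>" unfolding q_def .
  qed
  have q2: "c [^] (q * v) \<in> group_center G"
  proof (rule p'_element_of_centralizer[OF powC _ cop])
    have "(c [^] (q * v)) [^] m = c [^] (ord c * v)"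
      unfolding nat_pow_pow[OF cG] oc by (simp only: mult_ac)
    also have "\<dots> = \<one>" using pow_eq_id[OF cG] by simp
    finally show "(c [^] (q * v)) [^] m = \<one>" .
  qed
  have "c [^] (m * u) = c \<otimes> c [^] (q * v)"
    unfolding uv Suc_eq_plus1[symmetric] by (rule nat_pow_Suc2[OF cG])
  then have "c [^] (m * u) \<otimes> inv (c [^] (q * v)) = c" using cG by (simp add: m_assoc)
  moreover have "inv (c [^] (q * v)) \<in> group_center G" using subgroup.m_inv_closed[OF subgroup_center q2] .
  ultimately show ?thesis using q1 by metis
qed

lemma direct_product_centralizer:
  "internal_direct_product G (centralizer G P) P (group_center G)"
  unfolding internal_direct_product_def
proof (intro conjI ballI)
  show "subgroup P G" "subgroup (group_center G) G" by (rule subgroup_P, rule subgroup_center)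
  show "P \<inter> group_center G = {\<one>}" by (rule P_inter_center)
  show "a \<otimes> b = b \<otimes> a" if "a \<in> P" "b \<in> group_center G" for a b
    using center_commute[OF that(2) PG[OF that(1)]] by simp
  show "P <#> group_center G = centralizer G P"
  proof
    show "centralizer G P \<subseteq> P <#> group_center G"
      using centralizer_decomp unfolding set_mult_def by blast
    have "group_center G \<subseteq> centralizer G P"
      unfolding group_center_def centralizer_def using PG by blast
    then show "P <#> group_center G \<subseteq> centralizer G P"
      using P_le_centralizer subgroup.m_closed[OF subgroup_C] unfolding set_mult_def by blast
  qed
qed

text \<open>The nontrivial irreducible characters of P are linear, hence weights, and the weights
  are a single orbit.\<close>

lemma transitive_on_weights: "transitive_on_nontriv_irr G P"
  unfolding transitive_on_nontriv_irr_def
proof (intro allI impI, elim conjE)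
  fix \<theta> \<theta>' assume \<theta>: "irr_char (G\<lparr>carrier := P\<rparr>) \<theta>" "\<exists>x\<in>P. \<theta> x \<noteq> 1"
    and \<theta>': "irr_char (G\<lparr>carrier := P\<rparr>) \<theta>'" "\<exists>x\<in>P. \<theta>' x \<noteq> 1"
  obtain i where i: "i < n" "\<forall>a\<in>P. \<theta> a = l i a"
    using W.linear_char_is_weight[OF irr_char_abelian_imp_linear_char[OF is_group subgroup_P finite_P elementary_P(1) \<theta>(1)] \<theta>(2)]
    by blast
  obtain j where j: "j < n" "\<forall>a\<in>P. \<theta>' a = l j a"
    using W.linear_char_is_weight[OF irr_char_abelian_imp_linear_char[OF is_group subgroup_P finite_P elementary_P(1) \<theta>'(1)] \<theta>'(2)]
    by blast
  obtain g where g: "g \<in> carrier G" "\<forall>a\<in>P. l i (g \<otimes> a \<otimes> inv g) = l j a"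
    using W.weights_transitive[OF i(1) j(1)] by blast
  have "conj_char G g \<theta> x = \<theta>' x" if x: "x \<in> P" for x
    unfolding conj_char_def using i(2) j(2) g(2) x normal_invE(2)[OF normal_P g(1) x] by simp
  then show "\<exists>g\<in>carrier G. \<forall>x\<in>P. conj_char G g \<theta> x = \<theta>' x" using g(1) by blast
qed

lemma \<chi>_one_eq: "\<chi> \<one> = of_nat (card P) - 1"
  using W.card_A \<chi>_one by simp

text \<open>A Sylow subgroup is larger than P and contains some y outside P. Among the iterated p-th
  powers of y, the last one outside P is taken as x, so that x^p lies in P. All elements of xP are
  then nonidentity p-elements, and \<chi> is unimodular on the whole coset.\<close>

lemma p_element_outside:
  assumes "\<not> sylow_subgroup G p P"
  obtains x where "x \<in> carrier G" "x \<notin> P" "x [^] p \<in> P" "\<And>a. a \<in> P \<Longrightarrow> cmod (\<chi> (x \<otimes> a)) = 1"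
proof -
  obtain m where m: "card P = p ^ m" by (rule card_P)
  define s where "s = multiplicity p (Coset.order G)"
  have o0: "Coset.order G \<noteq> 0" using finite_G order_gt_0_iff_finite by simp
  have p1: "p > 1" using prime_gt_1_nat[OF prime_p] .
  have "card P dvd Coset.order G" using lagrange[OF subgroup_P] by (metis dvd_triv_right)
  then have "m \<le> s" unfolding s_def m using o0 p1 by (intro multiplicity_geI) auto
  moreover have "m \<noteq> s" using assms subgroup_P m unfolding sylow_subgroup_def s_def by auto
  ultimately have ms: "m < s" by simp
  obtain d where "Coset.order G = p ^ s * d" using multiplicity_dvd[of p "Coset.order G"] unfolding s_def by blast
  then obtain S where S: "subgroup S G" "card S = p ^ s"
    using sylow_thm[OF prime_p is_group, of s d] finite_G by blast
  have finS: "finite S" by (rule finite_subset[OF subgroup.subset[OF S(1)] finite_G])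
  have "\<not> S \<subseteq> P"
  proof
    assume "S \<subseteq> P"
    then have "card S \<le> card P" using finite_P by (intro card_mono)
    moreover have "p ^ m < p ^ s" using ms p1 by simp
    ultimately show False using m S(2) by simp
  qed
  then obtain y where y: "y \<in> S" "y \<notin> P" by blast
  have yG: "y \<in> carrier G" by (rule subgroup.mem_carrier[OF S(1) y(1)])
  have ys: "y [^] (p ^ s) = \<one>" using pow_card_eq_one[OF S(1) finS y(1)] S(2) by simp
  define j where "j = (LEAST j. y [^] (p ^ j) \<in> P)"
  have oneP: "\<one> \<in> P" by (rule subgroup.one_closed[OF subgroup_P])
  have ex: "y [^] (p ^ s) \<in> P" using ys oneP by simp
  have j: "y [^] (p ^ j) \<in> P" unfolding j_def by (rule LeastI[of "\<lambda>j. y [^] (p ^ j) \<in> P", OF ex])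
  have "j \<noteq> 0"
  proof
    assume "j = 0" then show False using j y(2) yG by simp
  qed
  then obtain i where i: "j = Suc i" by (cases j) auto
  define x where "x = y [^] (p ^ i)"
  have xG: "x \<in> carrier G" unfolding x_def using yG by simp
  have xP: "x \<notin> P"
  proof
    assume "x \<in> P"
    then have "j \<le> i" unfolding j_def x_def by (rule Least_le)
    then show False using i by simp
  qed
  have xp: "x [^] p \<in> P" using j unfolding i x_def nat_pow_pow[OF yG] by (simp add: mult.commute)
  have xs: "x [^] (p ^ s) = \<one>"
    unfolding x_def nat_pow_pow[OF yG] using ys yG nat_pow_pow[OF yG, of "p ^ s" "p ^ i"] by (simp add: mult.commute)
  have "cmod (\<chi> (x \<otimes> a)) = 1" if a: "a \<in> P" for a
  proof -
    have aG: "a \<in> carrier G" by (rule PG[OF a])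
    obtain k where k: "(x \<otimes> a) [^] (p ^ k) = \<one>"
      using mult_normal_p_element[OF prime_p normal_P finite_P m xG xs a] by blast
    have "x \<otimes> a \<noteq> \<one>"
    proof
      assume 1: "x \<otimes> a = \<one>"
      have "x = inv a" using inv_equality[OF 1 aG xG] by simp
      then show False using xP subgroup.m_inv_closed[OF subgroup_P a] by simp
    qed
    then show ?thesis using unit_p_element[OF _ _ k] xG aG by simp
  qed
  then show ?thesis using that xG xP xp by blast
qed

lemma S4_case:
  assumes "\<not> sylow_subgroup G p P"
  shows "p = 2" and "G \<cong> sym_group 4 \<times>\<times> G\<lparr>carrier := group_center G\<rparr>"
    and "odd (card (group_center G))"
proof -
  obtain x where x: "x \<in> carrier G" "x \<notin> P" "x [^] p \<in> P" and xa: "\<And>a. a \<in> P \<Longrightarrow> cmod (\<chi> (x \<otimes> a)) = 1"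
    using p_element_outside[OF assms] by blast
  show p2: "p = 2" by (rule W.p_eq_2_of_unit_coset[OF x(1) xa prime_p elementary_P(2)])
  have exp: "v \<otimes> v = \<one>" if "v \<in> P" for v
    using elementary_P(2)[OF that] PG[OF that] unfolding p2 by (simp add: numeral_2_eq_2)
  have xx: "x \<otimes> x \<in> P" using x(1,3) unfolding p2 by (simp add: numeral_2_eq_2)
  have n3: "n \<le> 3"
    by (rule W.n_le_3_of_unit_coset[OF x(1) xa exp subsetD[OF P_le_centralizer xx]])
  obtain m where m: "card P = p ^ m" by (rule card_P)
  have "n + 1 = 2 ^ m" using W.card_A m p2 by simp
  \<comment> \<open>From 1 < n \<le> 3 the order n + 1 is 3 or 4, and it is a power of 2.\<close>
  then have m4: "2 ^ m = (3::nat) \<or> 2 ^ m = (4::nat)" using n3 W.n_gt_1 by presburger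
  have "m \<noteq> 0" using m4 by (intro notI) simp
  then have ev: "even ((2::nat) ^ m)" by simp
  have "2 ^ m \<noteq> (3::nat)"
  proof
    assume "2 ^ m = (3::nat)"
    with ev have "even (3::nat)" by (simp only:)
    then show False by simp
  qed
  then have card4: "card P = 4" using m4 m p2 by simp
  \<comment> \<open>x is killed by p^2, so if it centralised P it would be one of the p-elements of
    C_G(P), all of which lie in P.\<close>
  have xC: "x \<notin> centralizer G P"
  proof
    assume xC: "x \<in> centralizer G P"
    have "x [^] (p ^ 2) = \<one>"
      using elementary_P(2)[OF x(3)] nat_pow_pow[OF x(1), of p p] by (simp add: power2_eq_square)
    then show False using p_element_of_centralizer[OF xC] x(2) by blast
  qed
  show odd: "odd (card (group_center G))"
  proof
    \<comment> \<open>A central involution would be a p-element centralising P, hence in P, which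
      meets the centre trivially.\<close>
    assume "even (card (group_center G))"
    then have "2 dvd card (group_center G)" by simp
    moreover have "finite (group_center G)"
      by (rule finite_subset[OF subgroup.subset[OF subgroup_center] finite_G])
    ultimately obtain z where z: "z \<in> group_center G" "z \<noteq> \<one>" "z [^] (2::nat) = \<one>"
      using subgroup_of_prime_order[OF two_is_prime_nat subgroup_center] by blast
    have zC: "z \<in> centralizer G P" using z(1) PG unfolding group_center_def centralizer_def by blast
    have "z \<in> P" by (rule p_element_of_centralizer[OF zC, of 1]) (use z(3) p2 in simp)
    then show False using P_inter_center z(1,2) by blast
  qed
  show "G \<cong> sym_group 4 \<times>\<times> G\<lparr>carrier := group_center G\<rparr>"
  proof (rule klein_normal_imp_iso_S4[OF finite_G normal_P card4 exp centralizer_decomp P_inter_center odd x(1) xC xx])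
    \<comment> \<open>Minimality of P: the orbit count gives every nontrivial normal subgroup of G
      inside P the order \<chi>(1) + 1 = |P|.\<close>
    fix B assume B: "B \<lhd> G" "B \<subseteq> P" "B \<noteq> {\<one>}"
    have "\<exists>k. b [^] (p ^ k) = \<one>" if "b \<in> B" for b
      using elementary_P(2)[of b] that B(2) by (intro exI[of _ 1]) auto
    then have pB: "p_subgroup G p B" by (rule normal_p_subgroup_le(1)[OF B(1)])
    have B_comm: "a \<otimes> b = b \<otimes> a" if "a \<in> B" "b \<in> B" for a b using elementary_P(1) that B(2) by blast
    obtain n' r' l' where sw': "simple_weights G B n' r' l' \<chi>" and n': "\<chi> \<one> = of_nat n'"
      by (rule simple_weights_exist[OF B(1) pB B(3) B_comm])
    have "card B = card P" using simple_weights.card_A[OF sw'] W.card_A n' \<chi>_one by simp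
    then show "B = P" using B(2) finite_P card_subset_eq by blast
  qed
qed

end

lemma dichotomy:
  "(sylow_subgroup G p P \<and> elementary_abelian G p P \<and>
      internal_direct_product G (centralizer G P) P (group_center G) \<and>
      transitive_on_nontriv_irr G P \<and> \<chi> \<one> = of_nat (card P) - 1)
    \<or> (p = 2 \<and> G \<cong> DirProd (sym_group 4) (G\<lparr>carrier := group_center G\<rparr>) \<and> odd (card (group_center G)))"
proof -
  obtain n r l where sw: "simple_weights G P n r l \<chi>" "\<chi> \<one> = of_nat n"
    by (rule simple_weights_exist[OF normal_P p_subgroup_P O_p_nontrivial elementary_P(1)])
  have ea: "elementary_abelian G p P"
    unfolding elementary_abelian_def using subgroup_P elementary_P by blast
  show ?thesis
  proof (cases "sylow_subgroup G p P")
    case True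
    then show ?thesis
      using ea direct_product_centralizer[OF sw] transitive_on_weights[OF sw] \<chi>_one_eq[OF sw] by blast
  next
    case False
    then show ?thesis using S4_case[OF sw False] by blast
  qed
qed

end

theorem theorem2p5:
  fixes G :: "('g, 'b) monoid_scheme" and p :: nat and \<chi> :: "'g \<Rightarrow> complex"
  assumes "Factorial_Ring.prime p"
    and "group G" and "finite (carrier G)"
    and "irr_char G \<chi>" and "faithful_char G \<chi>" and "Re (\<chi> \<one>\<^bsub>G\<^esub>) > 1"
    and "\<forall>x \<in> carrier G. p_singular G p x \<longrightarrow> root_of_unity (\<chi> x)"
    and "O_p G p \<noteq> {\<one>\<^bsub>G\<^esub>}"
  shows "(sylow_subgroup G p (O_p G p) \<and> elementary_abelian G p (O_p G p) \<and>
          internal_direct_product G (centralizer G (O_p G p)) (O_p G p) (group_center G) \<and>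
          transitive_on_nontriv_irr G (O_p G p) \<and>
          \<chi> \<one>\<^bsub>G\<^esub> = of_nat (card (O_p G p)) - 1)
       \<or> (p = 2 \<and> G \<cong> DirProd (sym_group 4) (G\<lparr>carrier := group_center G\<rparr>) \<and> odd (card (group_center G)))"
proof -
  have unit: "cmod (\<chi> x) = 1" if x: "x \<in> carrier G" "p dvd group.ord G x" for x
  proof -
    obtain m :: nat where m: "m > 0" "\<chi> x ^ m = 1"
      using assms(7) x unfolding p_singular_def root_of_unity_def by blast
    then have "cmod (\<chi> x) ^ m = 1 ^ m" by (simp flip: norm_power)
    then show ?thesis using power_eq_imp_eq_base[of "cmod (\<chi> x)" m 1] m(1) by simp
  qed
  interpret unit_on_p_singular G p \<chi>
    by (intro unit_on_p_singular.intro unit_on_p_singular_axioms.intro assms unit)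
  show ?thesis by (rule dichotomy)
qed

end
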